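(* Let $U:\mathcal C\to\mathbf{Set}$ be topological. Suppose there is a set-indexed family $(Q_i)_{i\in I}$ of objects of $\mathcal C$ with nonempty underlying sets such that all morphisms $X\to Q_i$ ($i\in I$) jointly form a $U$-initial source for every $X\in\mathcal C$, and every morphism $A\to Q_i$ extends along every $U$-initial injection $A\to B$. Let $\mathcal E$ consist of the morphisms with surjective underlying functions, and $\mathcal M$ of the $U$-initial injections. Then there is a conservative functor $G:\mathcal C\to\mathbf{Set}$ such that $Gf$ is surjective, respectively injective, if and only if $f\in\mathcal E$, respectively $f\in\mathcal M$, and $G$ preserves pullbacks of two $\mathcal M$-morphisms with common codomain and pushouts of two $\mathcal E$-morphisms with common domain. Moreover, let $\mathbb Z^{(-)}:\mathbf{Set}\to\mathbf{Ab}$ send a set to its free abelian group and a function to its linear extension, and put $H=\mathbb Z^{(-)}\circ G$. The form with subgroup fibres and transport $$\mathsf N_X=\operatorname{Sub}_{\mathbf{Ab}}(HX),\qquad f_!(S)=Hf(S),\qquad f^*(T)=(Hf)^{-1}(T)$$ for $X\in\mathcal C$, $f:X\to Y$, $S\le HX$, and $T\le HY$ is noetherian, has complete algebraic modular fibres, and induces $(\mathcal E,\mathcal M)$.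
   Context: Topological functors. Let $U:\mathcal C\to\mathbf{Set}$ be faithful. A source of morphisms $(a_j:X\to X_j)_{j\in J}$ is $U$-initial if a function $h:UZ\to UX$ underlies a morphism $Z\to X$ precisely when every $(Ua_j)h$ underlies a morphism $Z\to X_j$. $U$ is topological if it is faithful and every possibly large or empty source of functions $(s_j:S\to UX_j)_{j\in J}$ has a $U$-initial lift to an object with underlying set $S$ (with the usual amnestic normalization, making the lift unique). A $U$-initial injection is a morphism with injective underlying function which, as a one-map source, is $U$-initial. A morphism $a:A\to Q$ extends along $m:A\to B$ if $a=bm$ for some morphism $b:B\to Q$. $\operatorname{Sub}_{\mathbf{Ab}}(A)$ is the lattice of subgroups of $A$. A complete lattice is algebraic when each element is a join of compact elements. Conventions: categories are locally small; "set" is relative to a fixed universe. A conservative functor is one that reflects isomorphisms. A proper factorization system $(\mathcal E,\mathcal M)$ is an orthogonal factorization system with every morphism in $\mathcal E$ an epimorphism and every morphism in $\mathcal M$ a monomorphism. Forms. An (orean) form $\mathsf F$ on a category $\mathcal C$ assigns to each object $X$ a set-sized bounded lattice $\mathsf F(X)$ (the fibre over $X$; its elements are called clusters) and to each morphism $f:X\to Y$ monotone maps (transports) $f_!:\mathsf F(X)\to\mathsf F(Y)$ and $f^*:\mathsf F(Y)\to\mathsf F(X)$ with $f_!S\le T\iff S\le f^*T$, such that $(gf)_!=g_!f_!$, $(gf)^*=f^*g^*$, and identities act as identities. Put $\operatorname{Im}f=f_!\top_X$ and $\operatorname{Ker}f=f^*\bot_Y$. A cluster in $\mathsf F(X)$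 is conormal if it is the image of some morphism of $\mathcal C$ with codomain $X$, and normal if it is the kernel of some morphism of $\mathcal C$ with domain $X$. An embedding of a conormal $S\in\mathsf F(X)$ is a morphism $\iota$ into $X$ with $\operatorname{Im}\iota=S$ such that every morphism $f$ into $X$ with $\operatorname{Im}f\le S$ factors as $f=\iota h$ for a unique $h$. A quotient of a normal $K\in\mathsf F(X)$ is a morphism $\pi$ out of $X$ with $\operatorname{Ker}\pi=K$ such that every morphism $g$ out of $X$ with $K\le\operatorname{Ker}g$ factors as $g=h\pi$ for a unique $h$. The form is noetherian if: (N1) $f^*f_!S=S\vee\operatorname{Ker}f$ and $f_!f^*T=T\wedge\operatorname{Im}f$ for all $f,S,T$; (N2) every morphism $f$ factors as $f=me$ with $e$ a quotient of $\operatorname{Ker}f$ and $m$ an embedding of $\operatorname{Im}f$; (N3) the join of two normal clusters (in the same fibre) is normal, and the meet of two conormal clusters is conormal. For a noetherian form, the class of all quotients (of normal clusters) and the class of all embeddings (of conormal clusters) form a proper factorization system, the one induced by the form (quotients as left class, embeddings as right class). *)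

theory Defs
  imports
    "HOL-Algebra.Free_Abelian_Groups"
    "HOL-Algebra.Complete_Lattice"
    "HOL-Library.FuncSet"
    "HOL-Library.Equipollence"
begin

section \<open>The fixed universe\<close>

text \<open>A Grothendieck universe \<open>V\<close> satisfies \<open>x \<in> V\<close> iff \<open>x \<subseteq> V\<close> and
  \<open>\<bar>x\<bar> < \<bar>V\<bar>\<close>, and its cardinality is strongly inaccessible. Hence a universe is given here by
  a set \<open>V\<close> of strongly inaccessible cardinality; its sets are the subsets of \<open>V\<close> of smaller
  cardinality. \<open>small\<close> is stated for arbitrary types, so that index sets, hom-sets and fibres
  can also be called set-sized.\<close>

definition small :: "'u set \<Rightarrow> 'x set \<Rightarrow> bool" where
  "small V A \<longleftrightarrow> A \<prec> V"

definition universe :: "'u set \<Rightarrow> bool" where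
  "universe V \<longleftrightarrow>
     small V (UNIV :: nat set) \<and>
     (\<forall>A \<subseteq> V. small V A \<longrightarrow> small V (Pow A)) \<and>
     (\<forall>A \<subseteq> V. \<forall>B :: 'u \<Rightarrow> 'u set. small V A \<longrightarrow> (\<forall>a\<in>A. B a \<subseteq> V \<and> small V (B a)) \<longrightarrow>
        small V (\<Union>a\<in>A. B a))"

section \<open>Categories and functors\<close>

record ('o, 'a) cat =
  Ob :: "'o set"
  Ar :: "'a set"
  Dom :: "'a \<Rightarrow> 'o"
  Cod :: "'a \<Rightarrow> 'o"
  Idt :: "'o \<Rightarrow> 'a"
  Cmp :: "'a \<Rightarrow> 'a \<Rightarrow> 'a"  (infixl "\<odot>\<index>" 70)

text \<open>\<open>g \<odot>\<^bsub>C\<^esub> f\<close> is the composite \<open>g \<circ> f\<close>, meaningful when \<open>Dom C g = Cod C f\<close>.\<close>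

definition homset :: "('o, 'a, 'z) cat_scheme \<Rightarrow> 'o \<Rightarrow> 'o \<Rightarrow> 'a set" where
  "homset C X Y = {f \<in> Ar C. Dom C f = X \<and> Cod C f = Y}"

locale category =
  fixes C :: "('o, 'a, 'z) cat_scheme" (structure)
  assumes dom_ob: "f \<in> Ar C \<Longrightarrow> Dom C f \<in> Ob C"
    and cod_ob: "f \<in> Ar C \<Longrightarrow> Cod C f \<in> Ob C"
    and idt_hom: "X \<in> Ob C \<Longrightarrow> Idt C X \<in> homset C X X"
    and cmp_hom: "\<lbrakk>f \<in> homset C X Y; g \<in> homset C Y Z\<rbrakk> \<Longrightarrow> g \<odot> f \<in> homset C X Z"
    and idt_left: "f \<in> homset C X Y \<Longrightarrow> Idt C Y \<odot> f = f"
    and idt_right: "f \<in> homset C X Y \<Longrightarrow> f \<odot> Idt C X = f"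
    and cmp_assoc: "\<lbrakk>f \<in> homset C W X; g \<in> homset C X Y; h \<in> homset C Y Z\<rbrakk>
      \<Longrightarrow> h \<odot> (g \<odot> f) = (h \<odot> g) \<odot> f"

definition locally_small :: "'u set \<Rightarrow> ('o, 'a, 'z) cat_scheme \<Rightarrow> bool" where
  "locally_small V C \<longleftrightarrow> (\<forall>X\<in>Ob C. \<forall>Y\<in>Ob C. small V (homset C X Y))"

definition is_iso :: "('o, 'a, 'z) cat_scheme \<Rightarrow> 'a \<Rightarrow> bool" where
  "is_iso C f \<longleftrightarrow> f \<in> Ar C \<and>
     (\<exists>g \<in> homset C (Cod C f) (Dom C f).
        g \<odot>\<^bsub>C\<^esub> f = Idt C (Dom C f) \<and> f \<odot>\<^bsub>C\<^esub> g = Idt C (Cod C f))"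

definition is_mono :: "('o, 'a, 'z) cat_scheme \<Rightarrow> 'a \<Rightarrow> bool" where
  "is_mono C m \<longleftrightarrow> m \<in> Ar C \<and>
     (\<forall>Z\<in>Ob C. \<forall>f \<in> homset C Z (Dom C m). \<forall>g \<in> homset C Z (Dom C m).
        m \<odot>\<^bsub>C\<^esub> f = m \<odot>\<^bsub>C\<^esub> g \<longrightarrow> f = g)"

definition is_epi :: "('o, 'a, 'z) cat_scheme \<Rightarrow> 'a \<Rightarrow> bool" where
  "is_epi C e \<longleftrightarrow> e \<in> Ar C \<and>
     (\<forall>Z\<in>Ob C. \<forall>f \<in> homset C (Cod C e) Z. \<forall>g \<in> homset C (Cod C e) Z.
        f \<odot>\<^bsub>C\<^esub> e = g \<odot>\<^bsub>C\<^esub> e \<longrightarrow> f = g)"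

text \<open>The square with projections \<open>p, q\<close> is a pullback of the cospan \<open>m, n\<close>.\<close>

definition is_pullback :: "('o, 'a, 'z) cat_scheme \<Rightarrow> 'a \<Rightarrow> 'a \<Rightarrow> 'a \<Rightarrow> 'a \<Rightarrow> bool" where
  "is_pullback C m n p q \<longleftrightarrow>
     m \<in> Ar C \<and> n \<in> Ar C \<and> p \<in> Ar C \<and> q \<in> Ar C \<and>
     Cod C m = Cod C n \<and> Dom C p = Dom C q \<and> Cod C p = Dom C m \<and> Cod C q = Dom C n \<and>
     m \<odot>\<^bsub>C\<^esub> p = n \<odot>\<^bsub>C\<^esub> q \<and>
     (\<forall>Z\<in>Ob C. \<forall>u \<in> homset C Z (Dom C m). \<forall>v \<in> homset C Z (Dom C n).
        m \<odot>\<^bsub>C\<^esub> u = n \<odot>\<^bsub>C\<^esub> v \<longrightarrow>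
        (\<exists>!h. h \<in> homset C Z (Dom C p) \<and> p \<odot>\<^bsub>C\<^esub> h = u \<and> q \<odot>\<^bsub>C\<^esub> h = v))"

text \<open>The square with coprojections \<open>p, q\<close> is a pushout of the span \<open>d, e\<close>.\<close>

definition is_pushout :: "('o, 'a, 'z) cat_scheme \<Rightarrow> 'a \<Rightarrow> 'a \<Rightarrow> 'a \<Rightarrow> 'a \<Rightarrow> bool" where
  "is_pushout C d e p q \<longleftrightarrow>
     d \<in> Ar C \<and> e \<in> Ar C \<and> p \<in> Ar C \<and> q \<in> Ar C \<and>
     Dom C d = Dom C e \<and> Cod C p = Cod C q \<and> Dom C p = Cod C d \<and> Dom C q = Cod C e \<and>
     p \<odot>\<^bsub>C\<^esub> d = q \<odot>\<^bsub>C\<^esub> e \<and>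
     (\<forall>Z\<in>Ob C. \<forall>u \<in> homset C (Cod C d) Z. \<forall>v \<in> homset C (Cod C e) Z.
        u \<odot>\<^bsub>C\<^esub> d = v \<odot>\<^bsub>C\<^esub> e \<longrightarrow>
        (\<exists>!h. h \<in> homset C (Cod C p) Z \<and> h \<odot>\<^bsub>C\<^esub> p = u \<and> h \<odot>\<^bsub>C\<^esub> q = v))"

record ('o, 'a, 'p, 'b) ftor =
  fob :: "'o \<Rightarrow> 'p"
  far :: "'a \<Rightarrow> 'b"

definition is_functor ::
  "('o, 'a, 'z) cat_scheme \<Rightarrow> ('p, 'b, 'y) cat_scheme \<Rightarrow> ('o, 'a, 'p, 'b) ftor \<Rightarrow> bool" where
  "is_functor C D F \<longleftrightarrow>
     category C \<and> category D \<and>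
     (\<forall>X\<in>Ob C. fob F X \<in> Ob D) \<and>
     (\<forall>f\<in>Ar C. far F f \<in> homset D (fob F (Dom C f)) (fob F (Cod C f))) \<and>
     (\<forall>X\<in>Ob C. far F (Idt C X) = Idt D (fob F X)) \<and>
     (\<forall>f\<in>Ar C. \<forall>g\<in>Ar C. Dom C g = Cod C f \<longrightarrow>
        far F (g \<odot>\<^bsub>C\<^esub> f) = far F g \<odot>\<^bsub>D\<^esub> far F f)"

definition faithful :: "('o, 'a, 'z) cat_scheme \<Rightarrow> ('o, 'a, 'p, 'b) ftor \<Rightarrow> bool" where
  "faithful C F \<longleftrightarrow> (\<forall>X\<in>Ob C. \<forall>Y\<in>Ob C. inj_on (far F) (homset C X Y))"

text \<open>Reflecting isomorphisms.\<close>

definition conservative ::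
  "('o, 'a, 'z) cat_scheme \<Rightarrow> ('p, 'b, 'y) cat_scheme \<Rightarrow> ('o, 'a, 'p, 'b) ftor \<Rightarrow> bool" where
  "conservative C D F \<longleftrightarrow> (\<forall>f\<in>Ar C. is_iso D (far F f) \<longrightarrow> is_iso C f)"

definition preserves_pullbacks_of ::
  "('o, 'a, 'z) cat_scheme \<Rightarrow> ('p, 'b, 'y) cat_scheme \<Rightarrow> ('o, 'a, 'p, 'b) ftor \<Rightarrow> 'a set \<Rightarrow> bool"
  where
  "preserves_pullbacks_of C D F M \<longleftrightarrow>
     (\<forall>m\<in>M. \<forall>n\<in>M. \<forall>p q. is_pullback C m n p q \<longrightarrow>
        is_pullback D (far F m) (far F n) (far F p) (far F q))"

definition preserves_pushouts_of ::
  "('o, 'a, 'z) cat_scheme \<Rightarrow> ('p, 'b, 'y) cat_scheme \<Rightarrow> ('o, 'a, 'p, 'b) ftor \<Rightarrow> 'a set \<Rightarrow> bool"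
  where
  "preserves_pushouts_of C D F E \<longleftrightarrow>
     (\<forall>d\<in>E. \<forall>e\<in>E. \<forall>p q. is_pushout C d e p q \<longrightarrow>
        is_pushout D (far F d) (far F e) (far F p) (far F q))"

definition proper_factorization_system ::
  "('o, 'a, 'z) cat_scheme \<Rightarrow> 'a set \<Rightarrow> 'a set \<Rightarrow> bool" where
  "proper_factorization_system C E M \<longleftrightarrow>
     E \<subseteq> Ar C \<and> M \<subseteq> Ar C \<and>
     (\<forall>f. is_iso C f \<longrightarrow> f \<in> E \<and> f \<in> M) \<and>
     (\<forall>f\<in>E. \<forall>g\<in>E. Dom C g = Cod C f \<longrightarrow> g \<odot>\<^bsub>C\<^esub> f \<in> E) \<and>
     (\<forall>f\<in>M. \<forall>g\<in>M. Dom C g = Cod C f \<longrightarrow> g \<odot>\<^bsub>C\<^esub> f \<in> M) \<and>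
     (\<forall>f\<in>Ar C. \<exists>e\<in>E. \<exists>m\<in>M. Dom C m = Cod C e \<and> f = m \<odot>\<^bsub>C\<^esub> e) \<and>
     (\<forall>e\<in>E. \<forall>m\<in>M. \<forall>u \<in> homset C (Dom C e) (Dom C m). \<forall>v \<in> homset C (Cod C e) (Cod C m).
        m \<odot>\<^bsub>C\<^esub> u = v \<odot>\<^bsub>C\<^esub> e \<longrightarrow>
        (\<exists>!d. d \<in> homset C (Cod C e) (Dom C m) \<and> d \<odot>\<^bsub>C\<^esub> e = u \<and> m \<odot>\<^bsub>C\<^esub> d = v)) \<and>
     (\<forall>e\<in>E. is_epi C e) \<and> (\<forall>m\<in>M. is_mono C m)"

section \<open>The category of sets of the universe\<close>

datatype 'u setfun = SetFun (src: "'u set") (tgt: "'u set") (app: "'u \<Rightarrow> 'u")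

text \<open>Functions are extensional (\<open>undefined\<close> outside their source), so that equality of arrows
  is equality of functions.\<close>

definition setcat :: "'u set \<Rightarrow> ('u set, 'u setfun) cat" where
  "setcat V = \<lparr>
     Ob = {A. A \<subseteq> V \<and> small V A},
     Ar = {f. src f \<subseteq> V \<and> small V (src f) \<and> tgt f \<subseteq> V \<and> small V (tgt f) \<and>
              app f \<in> src f \<rightarrow>\<^sub>E tgt f},
     Dom = src,
     Cod = tgt,
     Idt = (\<lambda>A. SetFun A A (\<lambda>x\<in>A. x)),
     Cmp = (\<lambda>g f. SetFun (src f) (tgt g) (compose (src f) (app g) (app f)))\<rparr>"

definition surjective_fun :: "'u setfun \<Rightarrow> bool" where
  "surjective_fun f \<longleftrightarrow> app f ` src f = tgt f"

definition injective_fun :: "'u setfun \<Rightarrow> bool" where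
  "injective_fun f \<longleftrightarrow> inj_on (app f) (src f)"

lemma category_setcat:
  fixes V :: "'u set"
  shows "category (setcat V)"
proof
  fix X assume "X \<in> Ob (setcat V)"
  then show "Idt (setcat V) X \<in> homset (setcat V) X X"
    by (auto simp: setcat_def homset_def)
next
  fix f g :: "'u setfun" and X Y Z
  assume "f \<in> homset (setcat V) X Y" "g \<in> homset (setcat V) Y Z"
  then show "g \<odot>\<^bsub>setcat V\<^esub> f \<in> homset (setcat V) X Z"
    by (auto simp: setcat_def homset_def compose_def PiE_iff)
next
  fix f :: "'u setfun" and X Y
  assume "f \<in> homset (setcat V) X Y"
  then show "Idt (setcat V) Y \<odot>\<^bsub>setcat V\<^esub> f = f"
    by (cases f) (auto simp: setcat_def homset_def compose_def PiE_iff extensional_def fun_eq_iff)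
next
  fix f :: "'u setfun" and X Y
  assume "f \<in> homset (setcat V) X Y"
  then show "f \<odot>\<^bsub>setcat V\<^esub> Idt (setcat V) X = f"
    by (cases f) (auto simp: setcat_def homset_def compose_def PiE_iff extensional_def fun_eq_iff)
next
  fix f g h :: "'u setfun" and W X Y Z
  assume "f \<in> homset (setcat V) W X" "g \<in> homset (setcat V) X Y" "h \<in> homset (setcat V) Y Z"
  then show "h \<odot>\<^bsub>setcat V\<^esub> (g \<odot>\<^bsub>setcat V\<^esub> f) = (h \<odot>\<^bsub>setcat V\<^esub> g) \<odot>\<^bsub>setcat V\<^esub> f"
    by (auto simp: setcat_def homset_def compose_def PiE_iff Pi_iff)
qed (auto simp: setcat_def)

section \<open>Topological functors\<close>

text \<open>A source with vertex \<open>X\<close> is given by the class \<open>\<A>\<close> of its morphisms, which may be large or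
  empty; repetitions in an indexed family do not affect initiality.\<close>

definition initial_source ::
  "'u set \<Rightarrow> ('o, 'a, 'z) cat_scheme \<Rightarrow> ('o, 'a, 'u set, 'u setfun) ftor \<Rightarrow> 'o \<Rightarrow> 'a set \<Rightarrow> bool"
  where
  "initial_source V C U X \<A> \<longleftrightarrow>
     X \<in> Ob C \<and> (\<forall>a\<in>\<A>. a \<in> Ar C \<and> Dom C a = X) \<and>
     (\<forall>Z\<in>Ob C. \<forall>h \<in> homset (setcat V) (fob U Z) (fob U X).
        (\<exists>f \<in> homset C Z X. far U f = h) \<longleftrightarrow>
        (\<forall>a\<in>\<A>. \<exists>g \<in> homset C Z (Cod C a). far U g = far U a \<odot>\<^bsub>setcat V\<^esub> h))"

text \<open>A source of functions out of \<open>S\<close> is likewise a class \<open>\<Sigma>\<close> of pairs \<open>(X, s)\<close> with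
  \<open>s : S \<rightarrow> U X\<close>. For faithful \<open>U\<close>, the morphisms out of \<open>A\<close> in the last clause are exactly the
  (unique) lifts of the members of \<open>\<Sigma>\<close>.\<close>

definition initial_lift ::
  "'u set \<Rightarrow> ('o, 'a, 'z) cat_scheme \<Rightarrow> ('o, 'a, 'u set, 'u setfun) ftor
    \<Rightarrow> 'u set \<Rightarrow> ('o \<times> 'u setfun) set \<Rightarrow> 'o \<Rightarrow> bool" where
  "initial_lift V C U S \<Sigma> A \<longleftrightarrow>
     A \<in> Ob C \<and> fob U A = S \<and>
     (\<forall>(X, s)\<in>\<Sigma>. \<exists>a \<in> homset C A X. far U a = s) \<and>
     initial_source V C U A {a \<in> Ar C. Dom C a = A \<and> (Cod C a, far U a) \<in> \<Sigma>}"

definition amnestic ::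
  "'u set \<Rightarrow> ('o, 'a, 'z) cat_scheme \<Rightarrow> ('o, 'a, 'u set, 'u setfun) ftor \<Rightarrow> bool" where
  "amnestic V C U \<longleftrightarrow>
     (\<forall>f. is_iso C f \<and> far U f = Idt (setcat V) (fob U (Dom C f)) \<longrightarrow> f = Idt C (Dom C f))"

definition topological ::
  "'u set \<Rightarrow> ('o, 'a, 'z) cat_scheme \<Rightarrow> ('o, 'a, 'u set, 'u setfun) ftor \<Rightarrow> bool" where
  "topological V C U \<longleftrightarrow>
     is_functor C (setcat V) U \<and> faithful C U \<and> amnestic V C U \<and>
     (\<forall>S \<in> Ob (setcat V). \<forall>\<Sigma>.
        (\<forall>(X, s)\<in>\<Sigma>. X \<in> Ob C \<and> s \<in> homset (setcat V) S (fob U X)) \<longrightarrow>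
        (\<exists>A. initial_lift V C U S \<Sigma> A))"

lemma initial_lift_unique:
  assumes top: "topological V C U"
    and A: "initial_lift V C U S \<Sigma> A" and B: "initial_lift V C U S \<Sigma> B"
  shows "A = B"
proof -
  have functr: "is_functor C (setcat V) U" and faith: "faithful C U" and amn: "amnestic V C U"
    using top by (auto simp: topological_def)
  interpret C: category C using functr by (simp add: is_functor_def)
  interpret S: category "setcat V" by (rule category_setcat)
  have lift: "\<exists>f \<in> homset C P R. far U f = Idt (setcat V) S"
    if P: "initial_lift V C U S \<Sigma> P" and R: "initial_lift V C U S \<Sigma> R" for P R
  proof -
    let ?i = "Idt (setcat V) S"
    have ob: "P \<in> Ob C" "R \<in> Ob C" "fob U P = S" "fob U R = S"
      using P R by (auto simp: initial_lift_def)
    have "S \<in> Ob (setcat V)"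
      using functr ob by (auto simp: is_functor_def)
    then have i: "?i \<in> homset (setcat V) (fob U P) (fob U R)"
      using ob S.idt_hom by simp
    have "\<exists>g \<in> homset C P (Cod C a). far U g = far U a \<odot>\<^bsub>setcat V\<^esub> ?i"
      if a: "a \<in> Ar C" "Dom C a = R" "(Cod C a, far U a) \<in> \<Sigma>" for a
    proof -
      obtain g where g: "g \<in> homset C P (Cod C a)" "far U g = far U a"
        using P a(3) by (fastforce simp: initial_lift_def)
      have "far U a \<in> homset (setcat V) S (fob U (Cod C a))"
        using functr a ob by (auto simp: is_functor_def)
      then show ?thesis using g S.idt_right by metis
    qed
    moreover have "initial_source V C U R {a \<in> Ar C. Dom C a = R \<and> (Cod C a, far U a) \<in> \<Sigma>}"
      using R by (simp add: initial_lift_def)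
    ultimately show ?thesis
      using i ob unfolding initial_source_def by blast
  qed
  have ob: "A \<in> Ob C" "B \<in> Ob C" "fob U A = S" "fob U B = S"
    using A B by (auto simp: initial_lift_def)
  have SO: "S \<in> Ob (setcat V)"
    using functr ob by (auto simp: is_functor_def)
  obtain f where f: "f \<in> homset C A B" "far U f = Idt (setcat V) S"
    using lift[OF A B] by blast
  obtain g where g: "g \<in> homset C B A" "far U g = Idt (setcat V) S"
    using lift[OF B A] by blast
  have ii: "Idt (setcat V) S \<odot>\<^bsub>setcat V\<^esub> Idt (setcat V) S = Idt (setcat V) S"
    using S.idt_left S.idt_hom SO by blast
  have inv: "k \<odot>\<^bsub>C\<^esub> h = Idt C P"
    if h: "h \<in> homset C P R" "far U h = Idt (setcat V) S"
      and k: "k \<in> homset C R P" "far U k = Idt (setcat V) S"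
      and P: "P \<in> Ob C" "fob U P = S" for h k P R
  proof -
    have "far U (k \<odot>\<^bsub>C\<^esub> h) = far U (Idt C P)"
      using functr h k P ii by (auto simp: is_functor_def homset_def)
    moreover have "inj_on (far U) (homset C P P)"
      using faith P by (auto simp: faithful_def)
    ultimately show ?thesis
      using C.cmp_hom[OF h(1) k(1)] C.idt_hom[OF P(1)] by (auto dest: inj_onD)
  qed
  have "is_iso C f"
    using f g inv[OF f g] inv[OF g f] ob by (auto simp: is_iso_def homset_def)
  then have "f = Idt C A"
    using amn f ob by (auto simp: amnestic_def homset_def)
  then show ?thesis
    using f C.idt_hom[OF ob(1)] by (auto simp: homset_def)
qed

definition surjections ::
  "('o, 'a, 'z) cat_scheme \<Rightarrow> ('o, 'a, 'u set, 'u setfun) ftor \<Rightarrow> 'a set" where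
  "surjections C U = {f \<in> Ar C. surjective_fun (far U f)}"

definition initial_injections ::
  "'u set \<Rightarrow> ('o, 'a, 'z) cat_scheme \<Rightarrow> ('o, 'a, 'u set, 'u setfun) ftor \<Rightarrow> 'a set" where
  "initial_injections V C U =
     {m \<in> Ar C. injective_fun (far U m) \<and> initial_source V C U (Dom C m) {m}}"

definition extends_along :: "('o, 'a, 'z) cat_scheme \<Rightarrow> 'a \<Rightarrow> 'a \<Rightarrow> bool" where
  "extends_along C a m \<longleftrightarrow> (\<exists>b \<in> homset C (Cod C m) (Cod C a). a = b \<odot>\<^bsub>C\<^esub> m)"

section \<open>Forms\<close>

text \<open>\<open>push F f\<close> and \<open>pull F f\<close> are the transports \<open>f\<^sub>!\<close> and \<open>f\<^sup>*\<close>.\<close>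

record ('o, 'a, 'c) form =
  fibre :: "'o \<Rightarrow> 'c gorder"
  push :: "'a \<Rightarrow> 'c \<Rightarrow> 'c"
  pull :: "'a \<Rightarrow> 'c \<Rightarrow> 'c"

definition is_form ::
  "'u set \<Rightarrow> ('o, 'a, 'z) cat_scheme \<Rightarrow> ('o, 'a, 'c) form \<Rightarrow> bool" where
  "is_form V C F \<longleftrightarrow>
     (\<forall>X\<in>Ob C. bounded_lattice (fibre F X) \<and> small V (carrier (fibre F X))) \<and>
     (\<forall>X Y. \<forall>f \<in> homset C X Y.
        push F f \<in> carrier (fibre F X) \<rightarrow> carrier (fibre F Y) \<and>
        pull F f \<in> carrier (fibre F Y) \<rightarrow> carrier (fibre F X) \<and>
        (\<forall>S \<in> carrier (fibre F X). \<forall>S' \<in> carrier (fibre F X).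
           S \<sqsubseteq>\<^bsub>fibre F X\<^esub> S' \<longrightarrow> push F f S \<sqsubseteq>\<^bsub>fibre F Y\<^esub> push F f S') \<and>
        (\<forall>T \<in> carrier (fibre F Y). \<forall>T' \<in> carrier (fibre F Y).
           T \<sqsubseteq>\<^bsub>fibre F Y\<^esub> T' \<longrightarrow> pull F f T \<sqsubseteq>\<^bsub>fibre F X\<^esub> pull F f T') \<and>
        (\<forall>S \<in> carrier (fibre F X). \<forall>T \<in> carrier (fibre F Y).
           push F f S \<sqsubseteq>\<^bsub>fibre F Y\<^esub> T \<longleftrightarrow> S \<sqsubseteq>\<^bsub>fibre F X\<^esub> pull F f T)) \<and>
     (\<forall>X Y Z. \<forall>f \<in> homset C X Y. \<forall>g \<in> homset C Y Z.
        (\<forall>S \<in> carrier (fibre F X). push F (g \<odot>\<^bsub>C\<^esub> f) S = push F g (push F f S)) \<and>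
        (\<forall>T \<in> carrier (fibre F Z). pull F (g \<odot>\<^bsub>C\<^esub> f) T = pull F f (pull F g T))) \<and>
     (\<forall>X\<in>Ob C. \<forall>S \<in> carrier (fibre F X).
        push F (Idt C X) S = S \<and> pull F (Idt C X) S = S)"

definition Im_cl :: "('o, 'a, 'z) cat_scheme \<Rightarrow> ('o, 'a, 'c) form \<Rightarrow> 'a \<Rightarrow> 'c" where
  "Im_cl C F f = push F f \<top>\<^bsub>fibre F (Dom C f)\<^esub>"

definition Ker_cl :: "('o, 'a, 'z) cat_scheme \<Rightarrow> ('o, 'a, 'c) form \<Rightarrow> 'a \<Rightarrow> 'c" where
  "Ker_cl C F f = pull F f \<bottom>\<^bsub>fibre F (Cod C f)\<^esub>"

definition conormal ::
  "('o, 'a, 'z) cat_scheme \<Rightarrow> ('o, 'a, 'c) form \<Rightarrow> 'o \<Rightarrow> 'c \<Rightarrow> bool" where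
  "conormal C F X S \<longleftrightarrow> S \<in> carrier (fibre F X) \<and> (\<exists>f\<in>Ar C. Cod C f = X \<and> Im_cl C F f = S)"

definition normal_cl ::
  "('o, 'a, 'z) cat_scheme \<Rightarrow> ('o, 'a, 'c) form \<Rightarrow> 'o \<Rightarrow> 'c \<Rightarrow> bool" where
  "normal_cl C F X K \<longleftrightarrow> K \<in> carrier (fibre F X) \<and> (\<exists>f\<in>Ar C. Dom C f = X \<and> Ker_cl C F f = K)"

definition is_embedding ::
  "('o, 'a, 'z) cat_scheme \<Rightarrow> ('o, 'a, 'c) form \<Rightarrow> 'o \<Rightarrow> 'c \<Rightarrow> 'a \<Rightarrow> bool" where
  "is_embedding C F X S \<iota> \<longleftrightarrow>
     conormal C F X S \<and> \<iota> \<in> Ar C \<and> Cod C \<iota> = X \<and> Im_cl C F \<iota> = S \<and>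
     (\<forall>f\<in>Ar C. Cod C f = X \<and> Im_cl C F f \<sqsubseteq>\<^bsub>fibre F X\<^esub> S \<longrightarrow>
        (\<exists>!h. h \<in> homset C (Dom C f) (Dom C \<iota>) \<and> f = \<iota> \<odot>\<^bsub>C\<^esub> h))"

definition is_quotient ::
  "('o, 'a, 'z) cat_scheme \<Rightarrow> ('o, 'a, 'c) form \<Rightarrow> 'o \<Rightarrow> 'c \<Rightarrow> 'a \<Rightarrow> bool" where
  "is_quotient C F X K \<pi> \<longleftrightarrow>
     normal_cl C F X K \<and> \<pi> \<in> Ar C \<and> Dom C \<pi> = X \<and> Ker_cl C F \<pi> = K \<and>
     (\<forall>g\<in>Ar C. Dom C g = X \<and> K \<sqsubseteq>\<^bsub>fibre F X\<^esub> Ker_cl C F g \<longrightarrow>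
        (\<exists>!h. h \<in> homset C (Cod C \<pi>) (Cod C g) \<and> g = h \<odot>\<^bsub>C\<^esub> \<pi>))"

definition noetherian_form ::
  "'u set \<Rightarrow> ('o, 'a, 'z) cat_scheme \<Rightarrow> ('o, 'a, 'c) form \<Rightarrow> bool" where
  "noetherian_form V C F \<longleftrightarrow>
     is_form V C F \<and>
     (\<forall>X Y. \<forall>f \<in> homset C X Y.
        (\<forall>S \<in> carrier (fibre F X).
           pull F f (push F f S) = S \<squnion>\<^bsub>fibre F X\<^esub> Ker_cl C F f) \<and>
        (\<forall>T \<in> carrier (fibre F Y).
           push F f (pull F f T) = T \<sqinter>\<^bsub>fibre F Y\<^esub> Im_cl C F f)) \<and>
     (\<forall>X Y. \<forall>f \<in> homset C X Y. \<exists>e m.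
        is_quotient C F X (Ker_cl C F f) e \<and> is_embedding C F Y (Im_cl C F f) m \<and>
        Cod C e = Dom C m \<and> f = m \<odot>\<^bsub>C\<^esub> e) \<and>
     (\<forall>X\<in>Ob C. \<forall>K L. normal_cl C F X K \<and> normal_cl C F X L \<longrightarrow>
        normal_cl C F X (K \<squnion>\<^bsub>fibre F X\<^esub> L)) \<and>
     (\<forall>X\<in>Ob C. \<forall>S T. conormal C F X S \<and> conormal C F X T \<longrightarrow>
        conormal C F X (S \<sqinter>\<^bsub>fibre F X\<^esub> T))"

definition form_induces ::
  "('o, 'a, 'z) cat_scheme \<Rightarrow> ('o, 'a, 'c) form \<Rightarrow> 'a set \<Rightarrow> 'a set \<Rightarrow> bool" where
  "form_induces C F E M \<longleftrightarrow>
     E = {e. \<exists>X\<in>Ob C. \<exists>K. is_quotient C F X K e} \<and>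
     M = {m. \<exists>X\<in>Ob C. \<exists>S. is_embedding C F X S m} \<and>
     proper_factorization_system C E M"

section \<open>Algebraic and modular lattices\<close>

definition compact_element :: "'c gorder \<Rightarrow> 'c \<Rightarrow> bool" where
  "compact_element L k \<longleftrightarrow> k \<in> carrier L \<and>
     (\<forall>A \<subseteq> carrier L. k \<sqsubseteq>\<^bsub>L\<^esub> \<Squnion>\<^bsub>L\<^esub>A \<longrightarrow> (\<exists>B \<subseteq> A. finite B \<and> k \<sqsubseteq>\<^bsub>L\<^esub> \<Squnion>\<^bsub>L\<^esub>B))"

definition algebraic_lattice :: "'c gorder \<Rightarrow> bool" where
  "algebraic_lattice L \<longleftrightarrow> complete_lattice L \<and>
     (\<forall>x \<in> carrier L. \<exists>K. (\<forall>k\<in>K. compact_element L k) \<and> x = \<Squnion>\<^bsub>L\<^esub>K)"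

definition modular_lattice :: "'c gorder \<Rightarrow> bool" where
  "modular_lattice L \<longleftrightarrow> lattice L \<and>
     (\<forall>a \<in> carrier L. \<forall>b \<in> carrier L. \<forall>c \<in> carrier L. a \<sqsubseteq>\<^bsub>L\<^esub> c \<longrightarrow>
        a \<squnion>\<^bsub>L\<^esub> (b \<sqinter>\<^bsub>L\<^esub> c) = (a \<squnion>\<^bsub>L\<^esub> b) \<sqinter>\<^bsub>L\<^esub> c)"

section \<open>The subgroup form\<close>

text \<open>The linear extension of a function; only its values on the support of the argument matter.\<close>

definition free_ab_map :: "'u setfun \<Rightarrow> ('u \<Rightarrow>\<^sub>0 int) \<Rightarrow> ('u \<Rightarrow>\<^sub>0 int)" where
  "free_ab_map g = frag_extend (\<lambda>x. frag_of (app g x))"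

definition subgroup_lattice :: "('g, 'w) monoid_scheme \<Rightarrow> 'g set gorder" where
  "subgroup_lattice A = \<lparr>carrier = {S. subgroup S A}, eq = (=), le = (\<subseteq>)\<rparr>"

text \<open>Here \<open>HO\<close> and \<open>HA\<close> are the object and morphism parts of a functor to abelian groups.\<close>

definition subgroup_form ::
  "('o, 'a, 'z) cat_scheme \<Rightarrow> ('o \<Rightarrow> 'g monoid) \<Rightarrow> ('a \<Rightarrow> 'g \<Rightarrow> 'g) \<Rightarrow> ('o, 'a, 'g set) form" where
  "subgroup_form C HO HA = \<lparr>
     fibre = (\<lambda>X. subgroup_lattice (HO X)),
     push = (\<lambda>f S. HA f ` S),
     pull = (\<lambda>f T. {x \<in> carrier (HO (Dom C f)). HA f x \<in> T})\<rparr>"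

end

theory Submission
  imports Defs
begin

text \<open>
  Add a two-point indiscrete object to the family \<open>Q\<close>, so that functions into its members separate
  points. For an object \<open>X\<close> let \<open>S(X)\<close> be the set of all functions from \<open>U X\<close> into members of the
  family and \<open>R(X) \<subseteq> S(X)\<close> the set of those that underlie morphisms. A morphism \<open>f : X \<rightarrow> Y\<close> acts by
  precomposition \<open>S(Y) \<rightarrow> S(X)\<close>, \<open>R(Y) \<rightarrow> R(X)\<close>; this is injective for \<open>f\<close> in \<open>\<E>\<close>, and surjective
  on both levels for \<open>f\<close> in \<open>\<M>\<close>. The powerset of \<open>R(X)\<close> would be a covariant functor preserving the
  pushouts, but not the intersections: morphisms on two subobjects that agree on the intersection need
  not extend to a common morphism. Arbitrary functions do glue, but the powerset of \<open>S(X)\<close> ignores the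
  structure of \<open>X\<close>.

  Hence \<open>G X\<close> consists of the nonempty lists of subsets of \<open>S(X)\<close> whose last entry has a trace on
  \<open>R(X)\<close> that differs from the traces of all earlier entries, and \<open>G f\<close> takes preimages and then cuts
  the list at the first entry whose trace is that of the last one. The entries are subsets of \<open>S(X)\<close>,
  which gives intersections, and only comparisons on \<open>R(X)\<close> depend on the structure. For a pushout \<open>D\<close>
  of \<open>A\<close> and \<open>B\<close> under \<open>X\<close> one has \<open>S(D) = S(A) \<inter> S(B)\<close> and \<open>R(D) = R(A) \<inter> R(B)\<close>. If the last entry
  \<open>\<theta>\<close> of a list and an earlier entry \<open>\<phi>\<close> agree on \<open>R(D)\<close>, appending a set that agrees with \<open>\<theta>\<close> on
  \<open>R(A)\<close> and with \<open>\<phi>\<close> on \<open>R(B)\<close> gives a list that becomes equal to the original one over \<open>A\<close> and to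
  the one cut at \<open>\<phi>\<close> over \<open>B\<close>; so the kernel of \<open>G X \<rightarrow> G D\<close> is the join of the other two.

  Since \<open>G\<close> also detects factorizations through \<open>\<E>\<close> and \<open>\<M>\<close>, and kernels of linear extensions are
  generated by differences of points, the axioms of a noetherian form carry over to the subgroups of
  \<open>\<int>\<^bsup>(G X)\<^esup>\<close>.
\<close>

section \<open>Small sets\<close>

lemma small_lepoll: "small V A" if "small V B" "A \<lesssim> B"
  using that lesspoll_trans1 by (auto simp: small_def)

lemma small_subset: "small V A" if "small V B" "A \<subseteq> B"
  using that small_lepoll subset_imp_lepoll by blast

lemma small_image: "small V (f ` A)" if "small V A"
  using that small_lepoll image_lepoll by blast

lemma small_obtain_inj:
  assumes "small V A"
  obtains g where "inj_on g A" "g ` A \<subseteq> V" "small V (g ` A)"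
proof -
  obtain g where "inj_on g A" "g ` A \<subseteq> V"
    using assms lesspoll_imp_lepoll unfolding small_def lepoll_def by metis
  then show thesis using that small_image[OF assms] by blast
qed

lemma small_Pow:
  fixes A :: "'x set"
  assumes "universe V" "small V A"
  shows "small V (Pow A)"
proof -
  obtain g where g: "inj_on g A" "g ` A \<subseteq> V" "small V (g ` A)"
    using small_obtain_inj[OF assms(2)] .
  have "inj_on (image g) (Pow A)"
    using g(1) by (simp add: inj_on_image_Pow)
  moreover have "image g ` Pow A \<subseteq> Pow (g ` A)" by blast
  ultimately have "Pow A \<lesssim> Pow (g ` A)" unfolding lepoll_def by blast
  moreover have "small V (Pow (g ` A))" using assms(1) g by (auto simp: universe_def)
  ultimately show ?thesis using small_lepoll by blast
qed

lemma universe_small_nat: "small V (UNIV :: nat set)" if "universe V"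
  using that by (simp add: universe_def)

lemma universe_infinite: "infinite V" if "universe V"
  using universe_small_nat[OF that] lesspoll_imp_lepoll
  by (auto simp: small_def infinite_le_lepoll)

text \<open>The universe axiom bounds only unions of small subsets of \<open>V\<close> indexed by a
  small subset of \<open>V\<close>. As \<open>V\<close> is infinite, a bijection of
  \<open>V \<times> V\<close> with \<open>V\<close> codes pairs, and the coded sum becomes such a
  union.\<close>

lemma small_Sigma:
  fixes A :: "'x set" and B :: "'x \<Rightarrow> 'y set"
  assumes V: "universe V" and A: "small V A" and B: "\<And>a. a \<in> A \<Longrightarrow> small V (B a)"
  shows "small V (Sigma A B)"
proof -
  have "infinite V" using universe_infinite[OF V] .
  then have "|V \<times> V| =o |V|" by (rule card_of_Times_same_infinite)
  then obtain p where p: "bij_betw p (V \<times> V) V"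
    using card_of_ordIso by blast
  obtain g where g: "inj_on g A" "g ` A \<subseteq> V" "small V (g ` A)"
    using small_obtain_inj[OF A] .
  have "\<forall>a\<in>A. \<exists>h. inj_on h (B a) \<and> h ` B a \<subseteq> V"
    using B small_obtain_inj by metis
  then obtain h where h: "\<And>a. a \<in> A \<Longrightarrow>
    inj_on (h a) (B a) \<and> h a ` B a \<subseteq> V"
    by metis
  \<comment> \<open>The summands are reindexed by the code of \<open>a\<close> in \<open>V\<close>,
    because the axiom wants an index set inside \<open>V\<close>.\<close>
  define D where "D v = (let a = inv_into A g v in (\<lambda>b. p (v, h a b)) ` B a)" for v
  have D: "D (g a) = (\<lambda>b. p (g a, h a b)) ` B a" if "a \<in> A" for a
    using that g(1) by (simp add: D_def)
  have pV: "p z \<in> V" if "z \<in> V \<times> V" for z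
    using p that bij_betwE by blast
  have "small V (\<Union>v\<in>g ` A. D v)"
  proof -
    have "D v \<subseteq> V \<and> small V (D v)" if "v \<in> g ` A" for v
      using that g h B by (fastforce simp: D intro!: small_image pV)
    then show ?thesis using V g unfolding universe_def by blast
  qed
  moreover have "Sigma A B \<lesssim> (\<Union>v\<in>g ` A. D v)"
  proof -
    let ?f = "\<lambda>(a, b). p (g a, h a b)"
    have "inj_on ?f (Sigma A B)"
    proof (rule inj_onI, clarify)
      fix a b a' b' assume *: "a \<in> A" "b \<in> B a" "a' \<in> A" "b' \<in> B a'"
        and eq: "p (g a, h a b) = p (g a', h a' b')"
      have "(g a, h a b) \<in> V \<times> V" "(g a', h a' b') \<in> V \<times> V"
        using * g h by blast+
      then have "g a = g a' \<and> h a b = h a' b'"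
        using eq p by (auto simp: bij_betw_def dest: inj_onD)
      then show "a = a' \<and> b = b'" using * g(1) h by (metis inj_onD)
    qed
    moreover have "?f ` Sigma A B \<subseteq> (\<Union>v\<in>g ` A. D v)"
      using D by auto
    ultimately show ?thesis unfolding lepoll_def by blast
  qed
  ultimately show ?thesis using small_lepoll by blast
qed

text \<open>A list is determined by its graph, a subset of \<open>nat\<close> times
  \<open>A\<close>, so lists inject into a small powerset.\<close>

lemma small_lists:
  fixes A :: "'x set"
  assumes "universe V" "small V A"
  shows "small V (lists A)"
proof -
  let ?f = "\<lambda>l :: 'x list. (\<lambda>i. (i, l ! i)) ` {..<length l}"
  have "inj_on ?f (lists A)"
  proof (rule inj_onI)
    fix l l' :: "'x list" assume eq: "?f l = ?f l'"
    have "fst ` ?f k = {..<length k}" for k :: "'x list"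
      by (simp add: image_image)
    then have "{..<length l} = {..<length l'}" using eq by metis
    then have "length l = length l'" by simp
    moreover have "l ! i = l' ! i" if "i < length l" for i
    proof -
      have "(i, l ! i) \<in> ?f l'" using that eq by blast
      then show ?thesis by blast
    qed
    ultimately show "l = l'" by (simp add: nth_equalityI)
  qed
  moreover have "?f ` lists A \<subseteq> Pow ((UNIV :: nat set) \<times> A)"
    by (auto simp: in_lists_conv_set)
  ultimately have "lists A \<lesssim> Pow ((UNIV :: nat set) \<times> A)"
    unfolding lepoll_def by blast
  moreover have "small V (Pow ((UNIV :: nat set) \<times> A))"
    using assms by (intro small_Pow small_Sigma universe_small_nat)
  ultimately show ?thesis by (rule small_lepoll[rotated])
qed

text \<open>A formal sum is determined by the graph of its coefficients on its support, which embeds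
  the free group into the powerset of \<open>S\<close> times the integers. Subgroups are then
  bounded by one more powerset.\<close>

lemma small_free_Abelian_subgroups:
  fixes S :: "'a set"
  assumes "universe V" "small V S"
  shows "small V {H. subgroup H (free_Abelian_group S)}"
proof -
  let ?f = "\<lambda>a :: 'a \<Rightarrow>\<^sub>0 int. {(x, Poly_Mapping.lookup a x) | x. x \<in> Poly_Mapping.keys a}"
  have "inj_on ?f (carrier (free_Abelian_group S))"
  proof (rule inj_onI)
    fix a b assume eq: "?f a = ?f b"
    have le: "Poly_Mapping.lookup a x = Poly_Mapping.lookup b x"
      if "?f a = ?f b" "x \<in> Poly_Mapping.keys a" for a b x
      using that by blast
    show "a = b"
    proof (rule poly_mapping_eqI)
      fix x show "Poly_Mapping.lookup a x = Poly_Mapping.lookup b x"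
        using le[OF eq] le[OF eq[symmetric]] by (metis in_keys_iff)
    qed
  qed
  moreover have "?f ` carrier (free_Abelian_group S) \<subseteq> Pow (S \<times> (UNIV :: int set))"
    by auto
  ultimately have le: "carrier (free_Abelian_group S) \<lesssim> Pow (S \<times> (UNIV :: int set))"
    unfolding lepoll_def by blast
  have "(UNIV :: int set) \<lesssim> (UNIV :: nat set)"
    unfolding lepoll_def by (meson inj_to_nat top_greatest)
  then have "small V (UNIV :: int set)"
    using assms universe_small_nat small_lepoll by blast
  then have "small V (Pow (S \<times> (UNIV :: int set)))"
    using assms by (intro small_Pow small_Sigma)
  then have "small V (carrier (free_Abelian_group S))"
    using le by (rule small_lepoll)
  then have "small V (Pow (carrier (free_Abelian_group S)))"
    using assms small_Pow by blast
  then show ?thesis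
    by (rule small_subset) (auto dest: subgroup.subset)
qed

section \<open>Cut lists\<close>

text \<open>The target of the comparison is a separate argument so that it stays fixed along the
  recursion; it need not occur in the list. The first matching entry is kept, hence a nonempty list
  stays nonempty.\<close>

fun upto_mod :: "'x set \<Rightarrow> 'x set \<Rightarrow> 'x set list \<Rightarrow> 'x set list" where
  "upto_mod R \<theta> [] = []"
| "upto_mod R \<theta> (\<phi> # l) = \<phi> # (if \<phi> \<inter> R = \<theta> \<inter> R then [] else upto_mod R \<theta> l)"

text \<open>Entries are compared on \<open>R\<close> only, but they are not reduced modulo \<open>R\<close>: a list remembers which
  restrictions its entries factor through.\<close>

definition cut :: "'x set \<Rightarrow> 'x set list \<Rightarrow> 'x set list" where
  "cut R l = upto_mod R (last l) l"

lemma upto_mod_cong: "upto_mod R \<theta> l = upto_mod R \<theta>' l"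
  if "\<theta> \<inter> R = \<theta>' \<inter> R"
  using that by (induction l) auto

lemma upto_mod_nonempty [simp]: "upto_mod R \<theta> l = [] \<longleftrightarrow> l = []"
  by (cases l) auto

lemma cut_nonempty [simp]: "cut R l = [] \<longleftrightarrow> l = []"
  by (simp add: cut_def)

lemma set_upto_mod: "set (upto_mod R \<theta> l) \<subseteq> set l"
  by (induction l) auto

lemma set_cut: "set (cut R l) \<subseteq> set l"
  unfolding cut_def by (rule set_upto_mod)

lemma length_upto_mod: "length (upto_mod R \<theta> l) \<le> length l"
  by (induction l) auto

lemma length_cut: "length (cut R l) \<le> length l"
  unfolding cut_def by (rule length_upto_mod)

lemma take_length_upto_mod: "take (length (upto_mod R \<theta> l)) l = upto_mod R \<theta> l"
  by (induction l) auto

text \<open>A cut list is a prefix of the original one, so comparing lengths decides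
  equality.\<close>

lemma cut_eq_if_length: "cut R l = l" if "length l \<le> length (cut R l)"
  using that take_length_upto_mod[of R "last l" l] by (simp add: cut_def)

lemma last_upto_mod:
  assumes "\<phi> \<in> set l" "\<phi> \<inter> R = \<theta> \<inter> R"
  shows "last (upto_mod R \<theta> l) \<inter> R = \<theta> \<inter> R"
  using assms(1)
proof (induction l)
  case (Cons \<psi> l)
  then have "l \<noteq> []" if "\<psi> \<inter> R \<noteq> \<theta> \<inter> R" using that assms(2)
    by auto
  then show ?case using Cons assms(2) by (cases "\<psi> = \<phi>") auto
qed simp

lemma last_cut: "l \<noteq> [] \<Longrightarrow> last (cut R l) \<inter> R = last l \<inter> R"
  unfolding cut_def by (rule last_upto_mod[of "last l"]) auto

text \<open>If \<open>F\<close> carries every match to a match, the first match after applying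
  \<open>F\<close> comes no later than the one before. Shortening the list beforehand therefore
  cannot remove it.\<close>

lemma upto_mod_map_upto_mod:
  assumes "\<And>\<phi>. \<phi> \<in> set l \<Longrightarrow>
    \<phi> \<inter> R = \<theta> \<inter> R \<Longrightarrow>
      F \<phi> \<inter> R' = \<theta>' \<inter> R'"
  shows "upto_mod R' \<theta>' (map F (upto_mod R \<theta> l)) = upto_mod R' \<theta>' (map F l)"
  using assms
proof (induction l)
  case (Cons \<psi> l)
  have "upto_mod R' \<theta>' (map F (upto_mod R \<theta> l)) = upto_mod R' \<theta>' (map F l)"
    using Cons.prems by (intro Cons.IH) auto
  moreover have "\<psi> \<inter> R = \<theta> \<inter> R \<Longrightarrow>
    F \<psi> \<inter> R' = \<theta>' \<inter> R'"
    using Cons.prems by simp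
  ultimately show ?case by auto
qed simp

text \<open>The source of functoriality: equality of traces is preserved by \<open>F\<close>, so an
  intermediate cut changes neither the target trace nor the first position where it is
  attained.\<close>

lemma cut_map_cut:
  assumes "\<And>\<phi> \<psi>. \<phi> \<inter> R = \<psi> \<inter> R \<Longrightarrow>
    F \<phi> \<inter> R' = F \<psi> \<inter> R'"
  shows "cut R' (map F (cut R l)) = cut R' (map F l)"
proof (cases "l = []")
  case False
  have "F (last (cut R l)) \<inter> R' = F (last l) \<inter> R'"
    by (rule assms) (rule last_cut[OF False])
  then have "cut R' (map F (cut R l)) = upto_mod R' (F (last l)) (map F (cut R l))"
    using False upto_mod_cong by (simp add: cut_def[of R'] last_map)
  also have "\<dots> = upto_mod R' (F (last l)) (map F l)"
    unfolding cut_def by (rule upto_mod_map_upto_mod) (rule assms)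
  finally show ?thesis using False by (simp add: cut_def last_map)
qed (simp add: cut_def)

lemma cut_cut [simp]: "cut R (cut R l) = cut R l"
  using cut_map_cut[of R "\<lambda>\<phi>. \<phi>" R l] by simp

text \<open>When \<open>F\<close> also reflects equality of traces, matches occur at the same
  positions before and after \<open>F\<close>.\<close>

lemma cut_map:
  assumes "\<And>\<phi> \<psi>. \<phi> \<in> set l \<Longrightarrow>
    \<psi> \<in> set l \<Longrightarrow> F \<phi> \<inter> R' = F \<psi> \<inter> R' \<longleftrightarrow> \<phi> \<inter> R = \<psi> \<inter> R"
  shows "cut R' (map F l) = map F (cut R l)"
proof (cases "l = []")
  case False
  have "upto_mod R' (F \<theta>) (map F k) = map F (upto_mod R \<theta> k)"
    if "set k \<subseteq> set l" "\<theta> \<in> set l" for k \<theta>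
    using that
  proof (induction k)
    case (Cons \<psi> k)
    have "F \<psi> \<inter> R' = F \<theta> \<inter> R' \<longleftrightarrow> \<psi> \<inter> R = \<theta> \<inter> R"
      using Cons.prems by (intro assms) auto
    then show ?case using Cons by simp
  qed simp
  then show ?thesis using False by (simp add: cut_def last_map)
qed (simp add: cut_def)

text \<open>If \<open>l\<close> could be shortened, the mapped list could be shortened at least as
  much, by \<open>cut_map_cut\<close>. This is how lists built by taking direct images are
  recognized as cut.\<close>

lemma cut_reflect:
  assumes "\<And>\<phi> \<psi>. \<phi> \<inter> R = \<psi> \<inter> R \<Longrightarrow>
    F \<phi> \<inter> R' = F \<psi> \<inter> R'"
    and "cut R' (map F l) = map F l"
  shows "cut R l = l"
proof (rule cut_eq_if_length)
  have "map F l = cut R' (map F (cut R l))"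
    using assms(2) cut_map_cut[of R F R' l, OF assms(1)] by simp
  then have "length l \<le> length (map F (cut R l))" using length_cut by (metis length_map)
  then show "length l \<le> length (cut R l)" by simp
qed

lemma upto_mod_append:
  "\<phi> \<in> set l \<Longrightarrow> \<phi> \<inter> R = \<theta> \<inter> R \<Longrightarrow>
    upto_mod R \<theta> (l @ k) = upto_mod R \<theta> l"
  by (induction l) auto

text \<open>An appended entry that matches an earlier one only redirects the cut and then disappears
  itself. So one new last entry can choose, independently over two sets \<open>R\<close>, where a
  list is cut.\<close>

lemma cut_snoc: "cut R (l @ [\<chi>]) = upto_mod R \<chi> l"
  if "\<phi> \<in> set l" "\<phi> \<inter> R = \<chi> \<inter> R"
  using upto_mod_append[OF that] by (simp add: cut_def)

section \<open>Preimages of cut lists\<close>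

definition pre :: "('y \<Rightarrow> 'x) \<Rightarrow> 'y set \<Rightarrow> 'x set \<Rightarrow> 'y set" where
  "pre g S \<phi> = {s \<in> S. g s \<in> \<phi>}"

definition cutlists :: "'x set \<Rightarrow> 'x set \<Rightarrow> 'x set list set" where
  "cutlists S R = {l \<in> lists (Pow S). l \<noteq> [] \<and> cut R l = l}"

definition cutmap :: "('y \<Rightarrow> 'x) \<Rightarrow> 'y set \<Rightarrow> 'y set \<Rightarrow> 'x set list \<Rightarrow> 'y set list" where
  "cutmap g S R l = cut R (map (pre g S) l)"

lemma pre_subset: "pre g S \<phi> \<subseteq> S"
  by (auto simp: pre_def)

lemma pre_mod: "\<phi> \<inter> R = \<psi> \<inter> R \<Longrightarrow>
  g ` R' \<subseteq> R \<Longrightarrow> pre g S \<phi> \<inter> R' = pre g S \<psi> \<inter> R'"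
  by (auto simp: pre_def)

lemma cut_in_cutlists: "l \<in> lists (Pow S) \<Longrightarrow> l \<noteq> [] \<Longrightarrow>
  cut R l \<in> cutlists S R"
  using set_cut[of R l] by (auto simp: cutlists_def in_lists_conv_set)

lemma map_pre_lists: "map (pre g S) l \<in> lists (Pow S)"
  by (induction l) (auto simp: pre_def)

lemma cutmap_in_cutlists: "l \<noteq> [] \<Longrightarrow> cutmap g S R l \<in> cutlists S R"
  unfolding cutmap_def by (rule cut_in_cutlists[OF map_pre_lists]) simp

lemma cutmap_cut:
  "g ` R' \<subseteq> R \<Longrightarrow> cutmap g S' R' (cut R l) = cutmap g S' R' l"
  unfolding cutmap_def by (rule cut_map_cut) (rule pre_mod)

lemma cutmap_cutmap:
  assumes "h ` R2 \<subseteq> R1" "h ` S2 \<subseteq> S1" "\<And>s. s \<in> S2 \<Longrightarrow>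
    g (h s) = k s"
  shows "cutmap h S2 R2 (cutmap g S1 R1 l) = cutmap k S2 R2 l"
proof -
  have "pre h S2 (pre g S1 \<phi>) = pre k S2 \<phi>" for \<phi>
    using assms(2,3) by (auto simp: pre_def)
  then have "map (pre h S2) (map (pre g S1) l) = map (pre k S2) l" by simp
  then have "cutmap h S2 R2 (map (pre g S1) l) = cutmap k S2 R2 l"
    by (simp only: cutmap_def)
  then show ?thesis
    by (simp only: cutmap_def[of g] cutmap_cut[OF assms(1)])
qed

lemma cutmap_id:
  assumes "l \<in> cutlists S R" "\<And>s. s \<in> S \<Longrightarrow> g s = s"
  shows "cutmap g S R l = l"
proof -
  have "pre g S \<phi> = \<phi>" if "\<phi> \<subseteq> S" for \<phi>
    using that by (auto simp: pre_def subset_iff assms(2))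
  then have "map (pre g S) l = l"
    using assms(1) by (intro map_idI) (auto simp: cutlists_def in_lists_conv_set)
  then show ?thesis using assms(1) by (simp add: cutmap_def cutlists_def)
qed

text \<open>Since \<open>g\<close> maps \<open>R'\<close> onto \<open>R\<close>, preimages also
  reflect equality of traces, so a list that is already cut stays uncut.\<close>

lemma cutmap_onto:
  assumes l: "l \<in> cutlists S R" and SR: "g ` S' = S" "g ` R' = R"  "R' \<subseteq> S'"
  shows "cutmap g S' R' l = map (pre g S') l"
proof -
  have "pre g S' \<phi> \<inter> R' = pre g S' \<psi> \<inter> R' \<longleftrightarrow> \<phi> \<inter> R = \<psi> \<inter> R" for \<phi> \<psi>
    using SR by (fastforce simp: pre_def)
  then have "cutmap g S' R' l = map (pre g S') (cut R l)"
    unfolding cutmap_def by (rule cut_map)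
  then show ?thesis using l by (simp add: cutlists_def)
qed

text \<open>Nothing is cut off by \<open>cutmap_onto\<close>, and taking preimages under the
  surjection from \<open>S'\<close> to \<open>S\<close> is injective on subsets of
  \<open>S\<close>.\<close>

lemma inj_on_cutmap:
  assumes SR: "g ` S' = S" "g ` R' = R" "R' \<subseteq> S'"
  shows "inj_on (cutmap g S' R') (cutlists S R)"
proof (rule inj_onI)
  fix l l' assume l: "l \<in> cutlists S R" "l' \<in> cutlists S R"
    and eq: "cutmap g S' R' l = cutmap g S' R' l'"
  have "inj_on (pre g S') (Pow S)"
    unfolding SR(1)[symmetric] by (intro inj_onI) (fastforce simp: pre_def set_eq_iff)
  then have "inj_on (map (pre g S')) (lists (Pow S))" by (rule inj_on_mapI[OF inj_on_subset]) auto
  then show "l = l'"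
    using l eq cutmap_onto[OF _ SR] by (auto simp: cutlists_def dest: inj_onD)
qed

text \<open>For injective \<open>g\<close> the direct image is a right inverse of the preimage.
  Applied entrywise to a cut list it gives a list that is cut again, by
  \<open>cut_reflect\<close>.\<close>

lemma cutmap_surj:
  assumes "inj_on g S'" "g ` S' \<subseteq> S" "g ` R' \<subseteq> R"
  shows "cutmap g S' R' ` cutlists S R = cutlists S' R'"
proof
  show "cutmap g S' R' ` cutlists S R \<subseteq> cutlists S' R'"
    using cutmap_in_cutlists by (fastforce simp: cutlists_def[of S R])
  show "cutlists S' R' \<subseteq> cutmap g S' R' ` cutlists S R"
  proof
    fix m assume m: "m \<in> cutlists S' R'"
    define l where "l = map (image g) m"
    have "pre g S' (g ` \<phi>) = \<phi>" if "\<phi> \<in> set m" for \<phi>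
      using that m assms(1) by (auto simp: pre_def cutlists_def in_lists_conv_set inj_on_def)
    then have ml: "map (pre g S') l = m" by (simp add: l_def map_idI)
    have mod: "pre g S' \<phi> \<inter> R' = pre g S' \<psi> \<inter> R'"
      if "\<phi> \<inter> R = \<psi> \<inter> R" for \<phi> \<psi>
      using that assms(3) by (rule pre_mod)
    have "cut R l = l"
      by (rule cut_reflect[where F = "pre g S'" and R' = R', OF mod])
        (use m ml in \<open>auto simp: cutlists_def\<close>)
    moreover have "l \<in> lists (Pow S)" "l \<noteq> []"
      using m assms(2) by (auto simp: l_def cutlists_def in_lists_conv_set)
    moreover have "cutmap g S' R' l = m"
      using m by (simp add: cutmap_def ml cutlists_def)
    ultimately show "m \<in> cutmap g S' R' ` cutlists S R"
      by (auto simp: cutlists_def)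
  qed
qed

lemma cutmap_single: "cutmap g S R [\<phi>] = [pre g S \<phi>]"
  by (simp add: cutmap_def cut_def)

lemma single_in_cutlists: "\<phi> \<subseteq> S \<Longrightarrow> [\<phi>] \<in> cutlists S R"
  by (simp add: cutlists_def cut_def)

text \<open>Up to the injections, \<open>SD\<close> is \<open>SA \<inter> SB\<close> and \<open>RD\<close> is \<open>RA \<inter> RB\<close>.\<close>

locale cutlist_pullback =
  fixes a :: "'y \<Rightarrow> 'x" and b :: "'z \<Rightarrow> 'x" and p :: "'w \<Rightarrow> 'y"
    and q :: "'w \<Rightarrow> 'z"
    and SA RA SB RB SD RD
  assumes RSA: "RA \<subseteq> SA" and RSD: "RD \<subseteq> SD" and inja: "inj_on a SA"
    and pbS: "s \<in> SA \<Longrightarrow> t \<in> SB \<Longrightarrow> a s = b t \<Longrightarrow>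
      \<exists>r\<in>SD. p r = s \<and> q r = t"
    and pbR: "s \<in> RA \<Longrightarrow> t \<in> RB \<Longrightarrow> a s = b t \<Longrightarrow>
      \<exists>r\<in>RD. p r = s \<and> q r = t"
begin

abbreviation c where "c \<equiv> \<lambda>r. a (p r)"

text \<open>The two prescriptions, \<open>\<theta>\<close> over \<open>RA\<close> and
  \<open>\<phi>\<close> over \<open>RB\<close>, can conflict only at points of the form
  \<open>a s = b t\<close>. Such points come from \<open>RD\<close>, where \<open>\<theta>\<close>
  and \<open>\<phi>\<close> agree.\<close>

lemma glue_mod:
  assumes "pre c SD \<theta> \<inter> RD = pre c SD \<phi> \<inter> RD"
  obtains \<chi> where "\<chi> \<subseteq> a ` SA \<union> b ` SB" "pre a SA \<chi> \<inter> RA = pre a SA \<theta> \<inter> RA" "pre b SB \<chi> \<inter> RB = pre b SB \<phi> \<inter> RB"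
proof
  let ?\<chi> = "a ` (pre a SA \<theta> \<inter> RA) \<union> b ` (pre b SB \<phi> \<inter> RB)"
  show "?\<chi> \<subseteq> a ` SA \<union> b ` SB" by (auto simp: pre_def)
  have D: "a s \<in> \<theta> \<longleftrightarrow> a s \<in> \<phi>"
    if "s \<in> RA" "t \<in> RB" "a s = b t" for s t
    using pbR[OF that] RSD assms by (auto simp: pre_def set_eq_iff)
  have "a s \<in> \<theta>" if "s \<in> RA" "a s \<in> ?\<chi>" for s
    using that D RSA inja by (auto simp: pre_def dest: inj_onD)
  then show "pre a SA ?\<chi> \<inter> RA = pre a SA \<theta> \<inter> RA"
    by (auto simp: pre_def)
  have "b t \<in> \<phi>" if t: "t \<in> RB" and "b t \<in> ?\<chi>" for t
    using that(2)
  proof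
    assume "b t \<in> a ` (pre a SA \<theta> \<inter> RA)"
    then obtain s where "s \<in> RA" "a s \<in> \<theta>" "a s = b t" by (auto simp: pre_def)
    then show ?thesis using D t by metis
  qed (auto simp: pre_def)
  then show "pre b SB ?\<chi> \<inter> RB = pre b SB \<phi> \<inter> RB"
    by (auto simp: pre_def)
qed

text \<open>The same gluing with \<open>SD\<close> instead of \<open>RD\<close>; it produces single
  entries with exact preimages on both sides.\<close>

lemma glue:
  assumes "pre c SD \<theta> = pre c SD \<phi>"
  obtains \<chi> where "\<chi> \<subseteq> a ` SA \<union> b ` SB" "pre a SA \<chi> = pre a SA \<theta>" "pre b SB \<chi> = pre b SB \<phi>"
proof
  let ?\<chi> = "a ` (pre a SA \<theta>) \<union> b ` (pre b SB \<phi>)"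
  show "?\<chi> \<subseteq> a ` SA \<union> b ` SB" by (auto simp: pre_def)
  have D: "a s \<in> \<theta> \<longleftrightarrow> a s \<in> \<phi>"
    if "s \<in> SA" "t \<in> SB" "a s = b t" for s t
    using pbS[OF that] assms by (auto simp: pre_def set_eq_iff)
  have "a s \<in> \<theta>" if "s \<in> SA" "a s \<in> ?\<chi>" for s
    using that D by (auto simp: pre_def)
  then show "pre a SA ?\<chi> = pre a SA \<theta>"
    by (auto simp: pre_def)
  have "b t \<in> \<phi>" if t: "t \<in> SB" and "b t \<in> ?\<chi>" for t
    using that(2)
  proof
    assume "b t \<in> a ` (pre a SA \<theta>)"
    then obtain s where "s \<in> SA" "a s \<in> \<theta>" "a s = b t" by (auto simp: pre_def)
    then show ?thesis using D t by metis
  qed (auto simp: pre_def)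
  then show "pre b SB ?\<chi> = pre b SB \<phi>"
    by (auto simp: pre_def)
qed

text \<open>The kernel over \<open>D\<close> is the join of those over \<open>A\<close> and
  \<open>B\<close>; the join is expressed by test functions \<open>k\<close> constant on both
  kernels. Appending a glued entry links a list to the part of it that survives over
  \<open>D\<close>, and entrywise gluing links two surviving parts.\<close>

lemma cutmap_kernel_join:
  assumes SX: "a ` SA \<union> b ` SB \<subseteq> SX"
    and kA: "\<And>l l'. l \<in> lists (Pow SX) \<Longrightarrow>
      l' \<in> lists (Pow SX) \<Longrightarrow> l \<noteq> [] \<Longrightarrow>
        l' \<noteq> [] \<Longrightarrow>
      cutmap a SA RA l = cutmap a SA RA l' \<Longrightarrow> k l = k l'"
    and kB: "\<And>l l'. l \<in> lists (Pow SX) \<Longrightarrow>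
      l' \<in> lists (Pow SX) \<Longrightarrow> l \<noteq> [] \<Longrightarrow>
        l' \<noteq> [] \<Longrightarrow>
      cutmap b SB RB l = cutmap b SB RB l' \<Longrightarrow> k l = k l'"
    and l: "l \<in> lists (Pow SX)" "l' \<in> lists (Pow SX)" "l \<noteq> []" "l' \<noteq> []"
    and eq: "cutmap c SD RD l = cutmap c SD RD l'"
  shows "k l = k l'"
proof -
  \<comment> \<open>\<open>tr m\<close> is the prefix of \<open>m\<close> that survives the cut over
    \<open>RD\<close>, with its original entries rather than their preimages, so that it can be
    compared over \<open>A\<close> and \<open>B\<close>.\<close>
  define tr where "tr m = take (length (cutmap c SD RD m)) m" for m
  have tr: "map (pre c SD) (tr m) = cutmap c SD RD m" for m
    unfolding tr_def cutmap_def cut_def by (metis take_map take_length_upto_mod)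
  have tr_ne: "tr m \<noteq> []" if "m \<noteq> []" for m
    using that by (simp add: tr_def cutmap_def)
  have tr_in: "tr m \<in> lists (Pow SX)" if "m \<in> lists (Pow SX)" for m
    using that by (auto simp: tr_def in_lists_conv_set dest: in_set_takeD)
  have ktr: "k m = k (tr m)" if m: "m \<in> lists (Pow SX)" "m \<noteq> []" for m
  proof -
    have "pre c SD (last (tr m)) \<inter> RD = last (cutmap c SD RD m) \<inter> RD"
      using tr[of m] tr_ne[OF m(2)] by (metis last_map)
    also have "\<dots> = pre c SD (last m) \<inter> RD"
      unfolding cutmap_def using m(2) by (simp add: last_cut last_map)
    finally obtain \<chi> where \<chi>: "\<chi> \<subseteq> a ` SA \<union> b ` SB"
      "pre a SA \<chi> \<inter> RA = pre a SA (last m) \<inter> RA" "pre b SB \<chi> \<inter> RB = pre b SB (last (tr m)) \<inter> RB"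
      using glue_mod[of "last m" "last (tr m)"] by metis
    \<comment> \<open>\<open>m @ [\<chi>]\<close> is cut like \<open>m\<close> over \<open>RA\<close> and like \<open>tr m\<close> over \<open>RB\<close>.\<close>
    have "\<chi> \<subseteq> SX" using \<chi>(1) SX by (rule subset_trans)
    then have mx: "m @ [\<chi>] \<in> lists (Pow SX)" using m by simp
    have "cutmap a SA RA (m @ [\<chi>]) = upto_mod RA (pre a SA \<chi>) (map (pre a SA) m)"
      unfolding cutmap_def map_append list.map
      by (rule cut_snoc[of "pre a SA (last m)"]) (use m \<chi> in auto)
    also have "\<dots> = cutmap a SA RA m"
      unfolding cutmap_def cut_def using m \<chi> by (simp add: last_map upto_mod_cong[OF \<chi>(2)])
    finally have kam: "k (m @ [\<chi>]) = k m" using kA mx m by blast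
    obtain rest where rest: "m = tr m @ rest" unfolding tr_def by (metis append_take_drop_id)
    have lastin: "pre b SB (last (tr m)) \<in> set (map (pre b SB) (tr m))"
      using tr_ne[OF m(2)] by simp
    have "cutmap b SB RB (m @ [\<chi>]) = upto_mod RB (pre b SB \<chi>) (map (pre b SB) m)"
      unfolding cutmap_def map_append list.map
      by (rule cut_snoc[of "pre b SB (last (tr m))"])
        (use rest lastin \<chi>(3) in \<open>metis Un_iff map_append set_append\<close>, simp add: \<chi>(3))
    also have "\<dots> = upto_mod RB (pre b SB (last (tr m))) (map (pre b SB) (tr m) @ map (pre b SB) rest)"
      using upto_mod_cong[OF \<chi>(3)] rest by (metis map_append)
    also have "\<dots> = upto_mod RB (pre b SB (last (tr m))) (map (pre b SB) (tr m))"
      using lastin by (rule upto_mod_append) simp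
    also have "\<dots> = cutmap b SB RB (tr m)"
      unfolding cutmap_def cut_def using tr_ne[OF m(2)] by (simp add: last_map)
    finally have "k (m @ [\<chi>]) = k (tr m)" using kB mx tr_in[OF m(1)] tr_ne[OF m(2)] by blast
    then show ?thesis using kam by simp
  qed
  \<comment> \<open>The trimmed lists have the same preimages over \<open>SD\<close> entry by entry,
    which is the hypothesis of \<open>glue\<close> at each position.\<close>
  have eqtr: "map (pre c SD) (tr l) = map (pre c SD) (tr l')" using eq tr by simp
  then have len: "length (tr l) = length (tr l')" by (metis length_map)
  have "\<exists>\<chi>. \<chi> \<subseteq> a ` SA \<union> b ` SB \<and> pre a SA \<chi> = pre a SA (tr l ! i) \<and> pre b SB \<chi> = pre b SB (tr l' ! i)"
    if "i < length (tr l)" for i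
  proof -
    have "pre c SD (tr l ! i) = pre c SD (tr l' ! i)"
      using that eqtr len by (metis nth_map)
    then show ?thesis by (rule glue) blast
  qed
  then obtain \<chi> where \<chi>: "\<And>i. i < length (tr l) \<Longrightarrow>
    \<chi> i \<subseteq> a ` SA \<union> b ` SB \<and>
      pre a SA (\<chi> i) = pre a SA (tr l ! i) \<and> pre b SB (\<chi> i) = pre b SB (tr l' ! i)"
    by metis
  \<comment> \<open>The list of glued entries agrees with \<open>tr l\<close> over \<open>SA\<close>
    and with \<open>tr l'\<close> over \<open>SB\<close>, so it is a single intermediate step
    between the two.\<close>
  define m where "m = map \<chi> [0..<length (tr l)]"
  have m: "m \<in> lists (Pow SX)" "m \<noteq> []"
    using order_trans[OF conjunct1[OF \<chi>] SX] tr_ne[OF l(3)] by (auto simp: m_def in_lists_conv_set)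
  have "map (pre a SA) m = map (pre a SA) (tr l)"
    using \<chi> by (intro nth_equalityI) (auto simp: m_def)
  then have "k m = k (tr l)"
    using kA[OF m(1) tr_in[OF l(1)] m(2) tr_ne[OF l(3)]] by (simp only: cutmap_def)
  moreover have "map (pre b SB) m = map (pre b SB) (tr l')"
    using \<chi> len by (intro nth_equalityI) (auto simp: m_def)
  then have "k m = k (tr l')"
    using kB[OF m(1) tr_in[OF l(2)] m(2) tr_ne[OF l(4)]] by (simp only: cutmap_def)
  ultimately show ?thesis using ktr[OF l(1,3)] ktr[OF l(2,4)] by simp
qed

end

section \<open>Functions between sets of the universe\<close>

lemma setcat_simps [simp]:
  "Dom (setcat V) = src" "Cod (setcat V) = tgt"
  "A \<in> Ob (setcat V) \<longleftrightarrow> A \<subseteq> V \<and> small V A"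
  by (auto simp: setcat_def)

lemma setcat_hom_iff:
  "f \<in> homset (setcat V) A B \<longleftrightarrow> A \<in> Ob (setcat V) \<and> B \<in> Ob (setcat V) \<and>
     src f = A \<and> tgt f = B \<and> app f \<in> A \<rightarrow>\<^sub>E B"
  by (auto simp: setcat_def homset_def)

lemma setcat_Ar_iff: "f \<in> Ar (setcat V) \<longleftrightarrow> f \<in> homset (setcat V) (src f) (tgt f)"
  by (auto simp: setcat_def homset_def)

lemma setcat_cmp [simp]:
  "src (g \<odot>\<^bsub>setcat V\<^esub> f) = src f" "tgt (g \<odot>\<^bsub>setcat V\<^esub> f) = tgt g"
  "x \<in> src f \<Longrightarrow> app (g \<odot>\<^bsub>setcat V\<^esub> f) x = app g (app f x)"
  by (auto simp: setcat_def compose_def)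

lemma setcat_homD:
  assumes "f \<in> homset (setcat V) A B"
  shows "src f = A" "tgt f = B" "x \<in> A \<Longrightarrow> app f x \<in> B" "app f ` A \<subseteq> B"
  using assms by (auto simp: setcat_hom_iff)

lemma setfun_eqI:
  assumes "f \<in> homset (setcat V) A B" "g \<in> homset (setcat V) A B"
    and "\<And>x. x \<in> A \<Longrightarrow> app f x = app g x"
  shows "f = g"
proof -
  have "app f = app g"
    using assms by (auto simp: setcat_hom_iff intro: PiE_ext)
  then show ?thesis
    using assms by (cases f; cases g) (auto simp: setcat_hom_iff)
qed

definition setfun :: "'u set \<Rightarrow> 'u set \<Rightarrow> ('u \<Rightarrow> 'u) \<Rightarrow> 'u setfun" where
  "setfun A B h = SetFun A B (restrict h A)"

lemma setfun_simps [simp]: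
  "src (setfun A B h) = A" "tgt (setfun A B h) = B" "x \<in> A \<Longrightarrow>
    app (setfun A B h) x = h x"
  by (auto simp: setfun_def)

lemma setfun_hom:
  "A \<in> Ob (setcat V) \<Longrightarrow> B \<in> Ob (setcat V) \<Longrightarrow>
    (\<And>x. x \<in> A \<Longrightarrow> h x \<in> B) \<Longrightarrow>
    setfun A B h \<in> homset (setcat V) A B"
  by (auto simp: setcat_hom_iff setfun_def)

lemma setcat_Idt: "Idt (setcat V) A = setfun A A (\<lambda>x. x)"
  by (simp add: setcat_def setfun_def restrict_def)

lemma setcat_iso_bij: "is_iso (setcat V) f \<Longrightarrow> bij_betw (app f) (src f) (tgt f)"
proof -
  assume "is_iso (setcat V) f"
  then obtain g where f: "f \<in> homset (setcat V) (src f) (tgt f)"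
    and g: "g \<in> homset (setcat V) (tgt f) (src f)"
    "g \<odot>\<^bsub>setcat V\<^esub> f = Idt (setcat V) (src f)" "f \<odot>\<^bsub>setcat V\<^esub> g = Idt (setcat V) (tgt f)"
    by (auto simp: is_iso_def setcat_Ar_iff)
  have "app g (app f x) = x" if "x \<in> src f" for x
    using arg_cong[OF g(2), of "\<lambda>k. app k x"] that by (simp add: setcat_Idt)
  moreover have "app f (app g y) = y" if "y \<in> tgt f" for y
    using arg_cong[OF g(3), of "\<lambda>k. app k y"] that setcat_homD(1)[OF g(1)]
      by (simp add: setcat_Idt)
  ultimately show ?thesis
    using setcat_homD(3)[OF f] setcat_homD(3)[OF g(1)] by (intro bij_betwI[of _ _ _ "app g"]) auto
qed

text \<open>For injections the pullback is the intersection of images: a cone takes values in that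
  intersection, and injectivity determines the lift to \<open>P\<close>.\<close>

lemma setcat_is_pullbackI:
  assumes m: "m \<in> homset (setcat V) A X" and n: "n \<in> homset (setcat V) B X"
    and p: "p \<in> homset (setcat V) P A" and q: "q \<in> homset (setcat V) P B"
    and comm: "m \<odot>\<^bsub>setcat V\<^esub> p = n \<odot>\<^bsub>setcat V\<^esub> q"
    and inj: "inj_on (app m) A" "inj_on (app n) B" "inj_on (app p) P"
    and im: "app m ` A \<inter> app n ` B \<subseteq> (\<lambda>x. app m (app p x)) ` P"
  shows "is_pullback (setcat V) m n p q"
proof -
  note D = setcat_homD[OF m] setcat_homD[OF n] setcat_homD[OF p] setcat_homD[OF q]
  have comm': "app m (app p x) = app n (app q x)" if "x \<in> P" for x
    using arg_cong[OF comm, of "\<lambda>k. app k x"] that D by simp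
  have "\<exists>!h. h \<in> homset (setcat V) Z P \<and> p \<odot>\<^bsub>setcat V\<^esub> h = u \<and> q \<odot>\<^bsub>setcat V\<^esub> h = v"
    if u: "u \<in> homset (setcat V) Z A" and v: "v \<in> homset (setcat V) Z B"
      and uv: "m \<odot>\<^bsub>setcat V\<^esub> u = n \<odot>\<^bsub>setcat V\<^esub> v" for Z u v
  proof -
    note D' = setcat_homD[OF u] setcat_homD[OF v]
    have uv': "app m (app u z) = app n (app v z)" if "z \<in> Z" for z
      using arg_cong[OF uv, of "\<lambda>k. app k z"] that D' by simp
    have "\<exists>x\<in>P. app p x = app u z" if z: "z \<in> Z" for z
    proof -
      have "app m (app u z) \<in> app m ` A \<inter> app n ` B"
        using uv'[OF z] setcat_homD(3)[OF u z] setcat_homD(3)[OF v z] by (metis IntI imageI)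
      then obtain x where "x \<in> P" "app m (app u z) = app m (app p x)" using im by blast
      then show ?thesis using inj(1) D D' z by (metis inj_onD)
    qed
    then obtain h where h: "\<And>z. z \<in> Z \<Longrightarrow>
      h z \<in> P \<and> app p (h z) = app u z" by metis
    let ?h = "setfun Z P h"
    have hom: "?h \<in> homset (setcat V) Z P"
      using u p h by (intro setfun_hom) (auto simp: setcat_hom_iff)
    have hq: "app q (h z) = app v z" if z: "z \<in> Z" for z
      using comm'[of "h z"] uv'[OF z] h[OF z] inj(2) D D' z by (metis inj_onD)
    have C: "category (setcat V)" by (rule category_setcat)
    have "p \<odot>\<^bsub>setcat V\<^esub> ?h = u"
      by (rule setfun_eqI[OF category.cmp_hom[OF C hom p] u]) (simp add: h)
    moreover have "q \<odot>\<^bsub>setcat V\<^esub> ?h = v"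
      by (rule setfun_eqI[OF category.cmp_hom[OF C hom q] v]) (simp add: hq)
    moreover have "k = ?h"
      if k: "k \<in> homset (setcat V) Z P" "p \<odot>\<^bsub>setcat V\<^esub> k = u" for k
    proof (rule setfun_eqI[OF k(1) hom])
      fix z assume z: "z \<in> Z"
      have "app p (app k z) = app p (h z)"
        using arg_cong[OF k(2), of "\<lambda>k. app k z"] z h setcat_homD[OF k(1)] by simp
      then show "app k z = app ?h z"
        using inj_onD[OF inj(3) _ setcat_homD(3)[OF k(1) z]] h[OF z] z by simp
    qed
    ultimately show ?thesis using hom by blast
  qed
  then show ?thesis
    unfolding is_pullback_def using m n p q comm D
      by (auto simp: setcat_Ar_iff simp del: setcat_simps(3))
qed

text \<open>All sets in the square are quotients of \<open>X\<close>, so only the kernels matter.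
  That the kernel of \<open>X \<rightarrow> D\<close> is the join of the two others is phrased by
  test functions \<open>k\<close>, ready to be applied to a cocone.\<close>

lemma setcat_is_pushoutI:
  assumes d: "d \<in> homset (setcat V) X A" and e: "e \<in> homset (setcat V) X B"
    and p: "p \<in> homset (setcat V) A D" and q: "q \<in> homset (setcat V) B D"
    and comm: "p \<odot>\<^bsub>setcat V\<^esub> d = q \<odot>\<^bsub>setcat V\<^esub> e"
    and surj: "app d ` X = A" "app e ` X = B" "app p ` A = D"
    and ker: "\<And>k :: 'u \<Rightarrow> 'u. (\<And>x x'. x \<in> X \<Longrightarrow>
      x' \<in> X \<Longrightarrow> app d x = app d x' \<Longrightarrow> k x = k x') \<Longrightarrow>
      (\<And>x x'. x \<in> X \<Longrightarrow> x' \<in> X \<Longrightarrow>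
        app e x = app e x' \<Longrightarrow> k x = k x') \<Longrightarrow>
      (\<And>x x'. x \<in> X \<Longrightarrow> x' \<in> X \<Longrightarrow>
        app p (app d x) = app p (app d x') \<Longrightarrow> k x = k x')"
  shows "is_pushout (setcat V) d e p q"
proof -
  note D = setcat_homD[OF d] setcat_homD[OF e] setcat_homD[OF p] setcat_homD[OF q]
  have comm': "app p (app d x) = app q (app e x)" if "x \<in> X" for x
    using arg_cong[OF comm, of "\<lambda>k. app k x"] that D by simp
  have "\<exists>!h. h \<in> homset (setcat V) D Z \<and> h \<odot>\<^bsub>setcat V\<^esub> p = u \<and> h \<odot>\<^bsub>setcat V\<^esub> q = v"
    if u: "u \<in> homset (setcat V) A Z" and v: "v \<in> homset (setcat V) B Z"
      and uv: "u \<odot>\<^bsub>setcat V\<^esub> d = v \<odot>\<^bsub>setcat V\<^esub> e" for Z u v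
  proof -
    note D' = setcat_homD[OF u] setcat_homD[OF v]
    have uv': "app u (app d x) = app v (app e x)" if "x \<in> X" for x
      using arg_cong[OF uv, of "\<lambda>k. app k x"] that D by simp
    \<comment> \<open>\<open>r\<close> picks a preimage in \<open>X\<close> of each point of
      \<open>D\<close>. The mediating function is computed there, and \<open>ker\<close> makes its
      value independent of the choice.\<close>
    define r where "r = inv_into X (\<lambda>x. app p (app d x))"
    have onto: "(\<lambda>x. app p (app d x)) ` X = D" using surj(1,3) by (metis image_image)
    have rX: "r y \<in> X" "app p (app d (r y)) = y" if "y \<in> D" for y
      using that onto unfolding r_def by (metis inv_into_into, metis f_inv_into_f)
    have k: "app u (app d x) = app u (app d x')"
      if "x \<in> X" "x' \<in> X" "app p (app d x) = app p (app d x')" for x x'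
    proof (rule ker[OF _ _ that, where k = "\<lambda>x. app u (app d x)"])
      show "app u (app d x) = app u (app d x')" if "x \<in> X" "x' \<in> X" "app e x = app e x'" for x x'
        using that uv' by metis
    qed simp
    let ?h = "setfun D Z (\<lambda>y. app u (app d (r y)))"
    have hom: "?h \<in> homset (setcat V) D Z"
      using u p rX D D' by (intro setfun_hom) (auto simp: setcat_hom_iff)
    have h: "app ?h (app p (app d x)) = app u (app d x)" if x: "x \<in> X" for x
    proof -
      have "app p (app d x) \<in> D" using x onto by blast
      then show ?thesis using k[OF rX(1) x rX(2)] by simp
    qed
    have C: "category (setcat V)" by (rule category_setcat)
    have "?h \<odot>\<^bsub>setcat V\<^esub> p = u"
      by (rule setfun_eqI[OF category.cmp_hom[OF C p hom] u]) (use h surj(1) D in auto)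
    moreover have "?h \<odot>\<^bsub>setcat V\<^esub> q = v"
    proof (rule setfun_eqI[OF category.cmp_hom[OF C q hom] v])
      fix b assume "b \<in> B"
      then obtain x where x: "x \<in> X" "b = app e x" using surj(2) by blast
      then show "app (?h \<odot>\<^bsub>setcat V\<^esub> q) b = app v b"
        using h[OF x(1)] comm' uv' D \<open>b \<in> B\<close> by simp
    qed
    moreover have "k = ?h"
      if k: "k \<in> homset (setcat V) D Z" "k \<odot>\<^bsub>setcat V\<^esub> p = u" for k
    proof (rule setfun_eqI[OF k(1) hom])
      fix y assume y: "y \<in> D"
      have dA: "app d (r y) \<in> A" using rX(1)[OF y] surj(1) by blast
      have "app k (app p (app d (r y))) = app u (app d (r y))"
        using arg_cong[OF k(2), of "\<lambda>k. app k (app d (r y))"] dA D by simp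
      then show "app k y = app ?h y" using rX(2)[OF y] y by simp
    qed
    ultimately show ?thesis using hom by blast
  qed
  then show ?thesis
    unfolding is_pushout_def using d e p q comm D by (auto simp: setcat_Ar_iff simp del: setcat_simps(3))
qed

section \<open>Topological categories\<close>

locale topological_category =
  fixes V :: "'u set" and C :: "('o, 'a) cat" (structure) and U :: "('o, 'a, 'u set, 'u setfun) ftor"
  assumes univ: "universe V" and top: "topological V C U"
begin

abbreviation scomp (infixl "\<star>" 70) where "g \<star> f \<equiv> g \<odot>\<^bsub>setcat V\<^esub> f"
abbreviation Fun where "Fun A B \<equiv> homset (setcat V) A B"
abbreviation Hom where "Hom X Y \<equiv> homset C X Y"

sublocale category C
  using top by (simp add: topological_def is_functor_def)

sublocale S: category "setcat V"
  by (rule category_setcat)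

lemma scomp_eqD:
  assumes "g \<star> f = g' \<star> f'" "x \<in> src f" "x \<in> src f'"
  shows "app g (app f x) = app g' (app f' x)"
  using assms setcat_cmp(3) by metis

lemma U_functor: "is_functor C (setcat V) U"
  using top by (simp add: topological_def)

lemma fob_Ob: "X \<in> Ob C \<Longrightarrow> fob U X \<in> Ob (setcat V)"
  using U_functor unfolding is_functor_def by blast

lemma HomD: "f \<in> Hom X Y \<Longrightarrow> f \<in> Ar C" "f \<in> Hom X Y \<Longrightarrow>
  Dom C f = X" "f \<in> Hom X Y \<Longrightarrow> Cod C f = Y"
  "f \<in> Hom X Y \<Longrightarrow> X \<in> Ob C" "f \<in> Hom X Y \<Longrightarrow> Y \<in> Ob C"
  using dom_ob cod_ob by (auto simp: homset_def)

lemma Ar_Hom: "f \<in> Ar C \<Longrightarrow> f \<in> Hom (Dom C f) (Cod C f)"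
  by (simp add: homset_def)

lemma far_Fun: "f \<in> Hom X Y \<Longrightarrow> far U f \<in> Fun (fob U X) (fob U Y)"
  using U_functor HomD unfolding is_functor_def by blast

lemma far_Idt: "X \<in> Ob C \<Longrightarrow> far U (Idt C X) = Idt (setcat V) (fob U X)"
  using U_functor unfolding is_functor_def by blast

lemma far_cmp: "f \<in> Hom X Y \<Longrightarrow> g \<in> Hom Y Z \<Longrightarrow>
  far U (g \<odot> f) = far U g \<star> far U f"
  using U_functor HomD unfolding is_functor_def by metis

lemma far_inj:
  assumes "f \<in> Hom X Y" "g \<in> Hom X Y" "far U f = far U g"
  shows "f = g"
proof -
  have "faithful C U" using top by (simp add: topological_def)
  then have "inj_on (far U) (Hom X Y)"
    using HomD(4)[OF assms(1)] HomD(5)[OF assms(1)] by (simp add: faithful_def)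
  then show ?thesis using assms by (auto dest: inj_onD)
qed

text \<open>By faithfulness a morphism can be replaced by its underlying function; most arguments
  are then about which functions are admissible.\<close>

definition mor :: "'o \<Rightarrow> 'o \<Rightarrow> 'u setfun set" where
  "mor X Y = far U ` Hom X Y"

lemma morI: "f \<in> Hom X Y \<Longrightarrow> far U f \<in> mor X Y"
  by (simp add: mor_def)

lemma morE: assumes "h \<in> mor X Y" obtains f where "f \<in> Hom X Y" "far U f = h"
  using assms by (auto simp: mor_def)

lemma mor_Fun: "h \<in> mor X Y \<Longrightarrow> h \<in> Fun (fob U X) (fob U Y)"
  using far_Fun by (auto simp: mor_def)

lemma mor_cmp: "f \<in> mor X Y \<Longrightarrow> g \<in> mor Y Z \<Longrightarrow>
  g \<star> f \<in> mor X Z"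
  unfolding mor_def by (clarsimp simp flip: far_cmp) (blast intro: cmp_hom)

lemma mor_iff: "(\<exists>f \<in> Hom X Y. far U f = h) \<longleftrightarrow> h \<in> mor X Y"
  by (auto simp: mor_def)

lemma initial_source_mor:
  "initial_source V C U X \<A> \<longleftrightarrow> X \<in> Ob C \<and> (\<forall>a\<in>\<A>. a \<in> Ar C \<and> Dom C a = X) \<and>
     (\<forall>Z\<in>Ob C. \<forall>h \<in> Fun (fob U Z) (fob U X).
        h \<in> mor Z X \<longleftrightarrow> (\<forall>a\<in>\<A>. far U a \<star> h \<in> mor Z (Cod C a)))"
  unfolding initial_source_def mor_iff ..

lemma lift:
  assumes "S \<in> Ob (setcat V)" "\<And>X s. (X, s) \<in> \<Sigma> \<Longrightarrow>
    X \<in> Ob C \<and> s \<in> Fun S (fob U X)"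
  obtains A where "A \<in> Ob C" "fob U A = S" "\<And>X s. (X, s) \<in> \<Sigma> \<Longrightarrow>
    s \<in> mor A X"
    "\<And>Z h. Z \<in> Ob C \<Longrightarrow> h \<in> Fun (fob U Z) S \<Longrightarrow>
      (\<And>X s. (X, s) \<in> \<Sigma> \<Longrightarrow> s \<star> h \<in> mor Z X) \<Longrightarrow>
        h \<in> mor Z A"
proof -
  have "\<forall>(X, s)\<in>\<Sigma>. X \<in> Ob C \<and> s \<in> Fun S (fob U X)"
    using assms(2) by auto
  then obtain A where A: "initial_lift V C U S \<Sigma> A"
    using top assms(1) unfolding topological_def by blast
  have m: "s \<in> mor A X" if "(X, s) \<in> \<Sigma>" for X s
    using A that unfolding initial_lift_def mor_iff by blast
  have src: "initial_source V C U A {a \<in> Ar C. Dom C a = A \<and> (Cod C a, far U a) \<in> \<Sigma>}"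
    and ob: "A \<in> Ob C" "fob U A = S"
    using A unfolding initial_lift_def by blast+
  have "h \<in> mor Z A" if "Z \<in> Ob C" "h \<in> Fun (fob U Z) S"
      "\<And>X s. (X, s) \<in> \<Sigma> \<Longrightarrow> s \<star> h \<in> mor Z X" for Z h
    using src that ob unfolding initial_source_mor by simp
  then show thesis using that m ob by metis
qed

text \<open>The initial lift of the empty source: initiality puts no condition on functions into
  it.\<close>

lemma indiscrete:
  assumes "S \<in> Ob (setcat V)"
  obtains A where "A \<in> Ob C" "fob U A = S" "\<And>Z. Z \<in> Ob C \<Longrightarrow>
    mor Z A = Fun (fob U Z) S"
proof (rule lift[OF assms, of "{}"])
  fix A assume A: "A \<in> Ob C" "fob U A = S"
    "\<And>Z h. Z \<in> Ob C \<Longrightarrow> h \<in> Fun (fob U Z) S \<Longrightarrow>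
      (\<And>X s. (X, s) \<in> {} \<Longrightarrow> s \<star> h \<in> mor Z X) \<Longrightarrow>
        h \<in> mor Z A"
  show thesis by (rule that[of A]) (use A mor_Fun in auto)
qed auto

abbreviation E where "E \<equiv> surjections C U"
abbreviation M where "M \<equiv> initial_injections V C U"

text \<open>The fixed source and target of \<open>e\<close> turn membership in \<open>E\<close> into
  an equation between the image and the whole underlying set.\<close>

lemma E_iff: "e \<in> Hom X Y \<Longrightarrow>
  e \<in> E \<longleftrightarrow> app (far U e) ` fob U X = fob U Y"
  using setcat_homD(1,2)[OF far_Fun] HomD(1) by (auto simp: surjections_def surjective_fun_def)

text \<open>Only the reflecting half of initiality remains as a condition; the other half is closure
  under composition.\<close>

lemma M_iff: "m \<in> Hom X Y \<Longrightarrow>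
  m \<in> M \<longleftrightarrow> inj_on (app (far U m)) (fob U X) \<and>
    (\<forall>Z\<in>Ob C. \<forall>h \<in> Fun (fob U Z) (fob U X). far U m \<star> h \<in> mor Z Y \<longrightarrow> h \<in> mor Z X)"
  using setcat_homD(1)[OF far_Fun, of m X Y] HomD[of m X Y] mor_cmp morI[of m X Y]
  by (auto simp: initial_injections_def injective_fun_def initial_source_mor)

lemma E_epi: assumes "e \<in> E" shows "is_epi C e"
  unfolding is_epi_def
proof (intro conjI ballI impI)
  show e: "e \<in> Ar C" using assms by (simp add: surjections_def)
  note eH = Ar_Hom[OF e]
  fix Z f g assume f: "f \<in> Hom (Cod C e) Z" and g: "g \<in> Hom (Cod C e) Z"
    and eq: "f \<odot> e = g \<odot> e"
  have eq': "far U f \<star> far U e = far U g \<star> far U e"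
    using far_cmp[OF eH f] far_cmp[OF eH g] eq by simp
  show "f = g"
  proof (rule far_inj[OF f g], rule setfun_eqI[OF far_Fun[OF f] far_Fun[OF g]])
    fix y assume "y \<in> fob U (Cod C e)"
    then obtain x where "x \<in> fob U (Dom C e)" "y = app (far U e) x"
      using assms E_iff[OF eH] by blast
    then show "app (far U f) y = app (far U g) y"
      using arg_cong[OF eq', of "\<lambda>k. app k x"] setcat_homD[OF far_Fun[OF eH]] by simp
  qed
qed

lemma M_mono: assumes "m \<in> M" shows "is_mono C m"
  unfolding is_mono_def
proof (intro conjI ballI impI)
  show m: "m \<in> Ar C" using assms by (simp add: initial_injections_def)
  note mH = Ar_Hom[OF m]
  fix Z f g assume f: "f \<in> Hom Z (Dom C m)" and g: "g \<in> Hom Z (Dom C m)"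
    and eq: "m \<odot> f = m \<odot> g"
  have eq': "far U m \<star> far U f = far U m \<star> far U g"
    using far_cmp[OF f mH] far_cmp[OF g mH] eq by simp
  show "f = g"
  proof (rule far_inj[OF f g], rule setfun_eqI[OF far_Fun[OF f] far_Fun[OF g]])
    fix x assume x: "x \<in> fob U Z"
    then have "app (far U m) (app (far U f) x) = app (far U m) (app (far U g) x)"
      using arg_cong[OF eq', of "\<lambda>k. app k x"] setcat_homD[OF far_Fun[OF f]] setcat_homD[OF far_Fun[OF g]] by simp
    moreover have "inj_on (app (far U m)) (fob U (Dom C m))"
      using assms M_iff[OF mH] by blast
    ultimately show "app (far U f) x = app (far U g) x"
      using x setcat_homD[OF far_Fun[OF f]] setcat_homD[OF far_Fun[OF g]] by (auto dest: inj_onD)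
  qed
qed

lemma M_cancel:
  assumes "m \<in> M" "m \<in> Hom X Y" "f \<in> Hom Z X" "g \<in> Hom Z X" "m \<odot> f = m \<odot> g"
  shows "f = g"
  using M_mono[OF assms(1)] assms(3-) HomD(2)[OF assms(2)] HomD(4)[OF assms(3)]
  unfolding is_mono_def by blast

lemma E_cancel:
  assumes "e \<in> E" "e \<in> Hom X Y" "f \<in> Hom Y Z" "g \<in> Hom Y Z" "f \<odot> e = g \<odot> e"
  shows "f = g"
  using E_epi[OF assms(1)] assms(3-) HomD(3)[OF assms(2)] HomD(5)[OF assms(3)]
  unfolding is_epi_def by blast

text \<open>Choosing preimages under the injection gives a function, and initiality of
  \<open>m\<close> makes it a morphism.\<close>

lemma factor_through_M:
  assumes m: "m \<in> M" "m \<in> Hom A X" and f: "f \<in> Hom Z X"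
    and im: "app (far U f) ` fob U Z \<subseteq> app (far U m) ` fob U A"
  obtains h where "h \<in> Hom Z A" "m \<odot> h = f"
proof -
  have "\<forall>z\<in>fob U Z. \<exists>x\<in>fob U A. app (far U m) x = app (far U f) z"
    using im by (fastforce simp: image_iff)
  then obtain k where k: "\<And>z. z \<in> fob U Z \<Longrightarrow>
    k z \<in> fob U A \<and> app (far U m) (k z) = app (far U f) z"
    by metis
  let ?k = "setfun (fob U Z) (fob U A) k"
  have kF: "?k \<in> Fun (fob U Z) (fob U A)"
    using k fob_Ob HomD(4)[OF m(2)] HomD(4)[OF f] by (intro setfun_hom) auto
  have "far U m \<star> ?k = far U f"
    by (rule setfun_eqI[OF S.cmp_hom[OF kF far_Fun[OF m(2)]] far_Fun[OF f]]) (simp add: k)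
  then have "?k \<in> mor Z A"
    using M_iff[OF m(2)] m(1) kF morI[OF f] HomD(4)[OF f] by metis
  then obtain h where h: "h \<in> Hom Z A" "far U h = ?k" by (rule morE)
  have "m \<odot> h = f"
    using far_inj[OF cmp_hom[OF h(1) m(2)] f] far_cmp[OF h(1) m(2)] h(2) \<open>far U m \<star> ?k = far U f\<close> by simp
  then show thesis by (rule that[OF h(1)])
qed

text \<open>Initial lift of the single inclusion function, that is, the subspace structure on
  \<open>S\<close>.\<close>

lemma subobject:
  assumes X: "X \<in> Ob C" and S: "S \<subseteq> fob U X"
  obtains A m where "A \<in> Ob C" "fob U A = S" "m \<in> Hom A X" "m \<in> M" "\<And>x. x \<in> S \<Longrightarrow> app (far U m) x = x"
proof -
  let ?i = "setfun S (fob U X) (\<lambda>x. x)"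
  have SO: "S \<in> Ob (setcat V)" using fob_Ob[OF X] S small_subset by auto
  have iF: "?i \<in> Fun S (fob U X)" using S by (intro setfun_hom[OF SO fob_Ob[OF X]]) auto
  obtain A where A: "A \<in> Ob C" "fob U A = S" "\<And>Y s. (Y, s) \<in> {(X, ?i)} \<Longrightarrow>
    s \<in> mor A Y"
    "\<And>Z h. Z \<in> Ob C \<Longrightarrow> h \<in> Fun (fob U Z) S \<Longrightarrow>
      (\<And>Y s. (Y, s) \<in> {(X, ?i)} \<Longrightarrow> s \<star> h \<in> mor Z Y) \<Longrightarrow>
        h \<in> mor Z A"
    by (rule lift[OF SO, of "{(X, ?i)}"]) (use iF X in auto)
  then obtain m where m: "m \<in> Hom A X" "far U m = ?i" by (metis morE singletonI)
  have "m \<in> M" unfolding M_iff[OF m(1)] using A m by (auto intro: inj_onI)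
  then show thesis using that A m by auto
qed

text \<open>The middle object is the image with its subspace structure. As the embedding acts as the
  identity on points, the other factor has the same values as \<open>f\<close> and is onto.\<close>

lemma factorization:
  assumes f: "f \<in> Hom X Y"
  obtains e m W where "e \<in> Hom X W" "m \<in> Hom W Y" "e \<in> E" "m \<in> M" "f = m \<odot> e"
proof -
  let ?S = "app (far U f) ` fob U X"
  obtain W m where W: "W \<in> Ob C" "fob U W = ?S" and m: "m \<in> Hom W Y" "m \<in> M"
    and mx: "\<And>x. x \<in> ?S \<Longrightarrow> app (far U m) x = x"
    by (rule subobject[OF HomD(5)[OF f], of ?S]) (use setcat_homD(4)[OF far_Fun[OF f]] in auto)
  have "?S \<subseteq> app (far U m) ` fob U W" using mx W by force
  then obtain e where e: "e \<in> Hom X W" "m \<odot> e = f"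
    using factor_through_M[OF m(2,1) f] by blast
  have "app (far U e) x = app (far U f) x" if x: "x \<in> fob U X" for x
  proof -
    have "app (far U e) x \<in> ?S" using setcat_homD(3)[OF far_Fun[OF e(1)] x] W by simp
    moreover have "app (far U f) x = app (far U m) (app (far U e) x)"
      using x far_cmp[OF e(1) m(1)] e(2) setcat_homD(1)[OF far_Fun[OF e(1)]] by simp
    ultimately show ?thesis using mx by simp
  qed
  then have "e \<in> E" unfolding E_iff[OF e(1)] W by force
  then show thesis using that e m by metis
qed

lemma E_cmp: assumes "f \<in> E" "g \<in> E" "f \<in> Hom X Y" "g \<in> Hom Y Z" shows "g \<odot> f \<in> E"
proof -
  have "app (far U g \<star> far U f) ` fob U X = app (far U g) ` app (far U f) ` fob U X"
    using setcat_homD(1)[OF far_Fun[OF assms(3)]] by (force simp: image_image)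
  then show ?thesis
    using assms E_iff[OF assms(3)] E_iff[OF assms(4)] E_iff[OF cmp_hom[OF assms(3,4)]] far_cmp[OF assms(3,4)] by simp
qed

lemma M_cmp: assumes "f \<in> M" "g \<in> M" "f \<in> Hom X Y" "g \<in> Hom Y Z" shows "g \<odot> f \<in> M"
  unfolding M_iff[OF cmp_hom[OF assms(3,4)]] far_cmp[OF assms(3,4)]
proof (intro conjI ballI impI)
  note F = far_Fun[OF assms(3)] far_Fun[OF assms(4)]
  have "inj_on (\<lambda>x. app (far U g) (app (far U f) x)) (fob U X)"
    using assms(1,2) M_iff[OF assms(3)] M_iff[OF assms(4)] setcat_homD(3)[OF F(1)]
    by (auto simp: inj_on_def)
  then show "inj_on (app (far U g \<star> far U f)) (fob U X)"
    using setcat_homD(1)[OF F(1)] by (simp add: inj_on_def)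
  fix W h assume "W \<in> Ob C" and h: "h \<in> Fun (fob U W) (fob U X)"
    and gfh: "far U g \<star> far U f \<star> h \<in> mor W Z"
  have "far U g \<star> (far U f \<star> h) \<in> mor W Z" using gfh S.cmp_assoc[OF h F] by simp
  then have "far U f \<star> h \<in> mor W Y"
    using assms(2) M_iff[OF assms(4)] \<open>W \<in> Ob C\<close> S.cmp_hom[OF h F(1)] by blast
  then show "h \<in> mor W X" using assms(1) M_iff[OF assms(3)] \<open>W \<in> Ob C\<close> h by blast
qed

lemma iso_EM: assumes "is_iso C f" shows "f \<in> E" "f \<in> M"
proof -
  obtain g where g: "f \<in> Ar C" "g \<in> Hom (Cod C f) (Dom C f)" "g \<odot> f = Idt C (Dom C f)"
    "f \<odot> g = Idt C (Cod C f)"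
    using assms by (auto simp: is_iso_def)
  note f = Ar_Hom[OF g(1)]
  note F = far_Fun[OF f] far_Fun[OF g(2)]
  have gf: "far U g \<star> far U f = Idt (setcat V) (fob U (Dom C f))"
    using far_cmp[OF f g(2)] g(3) far_Idt HomD(4)[OF f] by simp
  have fg: "far U f \<star> far U g = Idt (setcat V) (fob U (Cod C f))"
    using far_cmp[OF g(2) f] g(4) far_Idt HomD(5)[OF f] by simp
  have "is_iso (setcat V) (far U f)"
    using F gf fg setcat_homD(1,2)[OF F(1)] by (auto simp: is_iso_def setcat_Ar_iff)
  then have bij: "bij_betw (app (far U f)) (fob U (Dom C f)) (fob U (Cod C f))"
    using setcat_iso_bij setcat_homD(1,2)[OF F(1)] by metis
  then show "f \<in> E" unfolding E_iff[OF f] by (simp add: bij_betw_def)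
  show "f \<in> M" unfolding M_iff[OF f]
  proof (intro conjI ballI impI)
    show "inj_on (app (far U f)) (fob U (Dom C f))" using bij by (simp add: bij_betw_def)
    fix Z h assume h: "h \<in> Fun (fob U Z) (fob U (Dom C f))"
      and fh: "far U f \<star> h \<in> mor Z (Cod C f)"
    have "far U g \<star> (far U f \<star> h) = h"
      using S.cmp_assoc[OF h F] gf S.idt_left[OF h] by simp
    then show "h \<in> mor Z (Dom C f)" using mor_cmp[OF fh morI[OF g(2)]] by simp
  qed
qed

text \<open>Surjectivity lets the identity of the codomain factor through \<open>f\<close>, giving a
  right inverse; it is also a left inverse because \<open>f\<close> is a monomorphism.\<close>

lemma EM_iso: assumes "f \<in> E" "f \<in> M" shows "is_iso C f"
proof -
  have f: "f \<in> Hom (Dom C f) (Cod C f)" using assms(1) Ar_Hom by (auto simp: surjections_def)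
  have i: "Idt C (Cod C f) \<in> Hom (Cod C f) (Cod C f)" using idt_hom HomD(5)[OF f] by blast
  have "app (far U (Idt C (Cod C f))) ` fob U (Cod C f) \<subseteq> app (far U f) ` fob U (Dom C f)"
    using setcat_homD(4)[OF far_Fun[OF i]] assms(1) E_iff[OF f] by simp
  then obtain g where g: "g \<in> Hom (Cod C f) (Dom C f)" "f \<odot> g = Idt C (Cod C f)"
    using factor_through_M[OF assms(2) f i] by blast
  have j: "Idt C (Dom C f) \<in> Hom (Dom C f) (Dom C f)" using idt_hom HomD(4)[OF f] by blast
  have "f \<odot> (g \<odot> f) = f \<odot> Idt C (Dom C f)"
    using cmp_assoc[OF f g(1) f] g(2) idt_left[OF f] idt_right[OF f] by simp
  then have "g \<odot> f = Idt C (Dom C f)"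
    by (rule M_cancel[OF assms(2) f cmp_hom[OF f g(1)] j])
  then show ?thesis using g f by (auto simp: is_iso_def homset_def)
qed

lemma EM_proper_factorization_system: "proper_factorization_system C E M"
  unfolding proper_factorization_system_def
proof (intro conjI allI impI ballI)
  show "E \<subseteq> Ar C" "M \<subseteq> Ar C" by (auto simp: surjections_def initial_injections_def)
  show "f \<in> E" "f \<in> M" if "is_iso C f" for f using that iso_EM by blast+
  show "g \<odot> f \<in> E" if "f \<in> E" "g \<in> E" "Dom C g = Cod C f" for f g
    using that E_cmp[OF that(1,2)] by (auto simp: surjections_def homset_def)
  show "g \<odot> f \<in> M" if "f \<in> M" "g \<in> M" "Dom C g = Cod C f" for f g
    using that M_cmp[OF that(1,2)] by (auto simp: initial_injections_def homset_def)
  show "\<exists>e\<in>E. \<exists>m\<in>M. Dom C m = Cod C e \<and> f = m \<odot> e" if "f \<in> Ar C"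
    for f
    by (rule factorization[OF Ar_Hom[OF that]]) (metis HomD(2,3))
  show "is_epi C e" if "e \<in> E" for e using that by (rule E_epi)
  show "is_mono C m" if "m \<in> M" for m using that by (rule M_mono)
  fix e m u v assume e: "e \<in> E" and m: "m \<in> M" and u: "u \<in> Hom (Dom C e) (Dom C m)"
    and v: "v \<in> Hom (Cod C e) (Cod C m)" and eq: "m \<odot> u = v \<odot> e"
  have eH: "e \<in> Hom (Dom C e) (Cod C e)" and mH: "m \<in> Hom (Dom C m) (Cod C m)"
    using e m Ar_Hom by (auto simp: surjections_def initial_injections_def)
  have eq': "far U m \<star> far U u = far U v \<star> far U e"
    using arg_cong[OF eq, of "far U"] unfolding far_cmp[OF u mH] far_cmp[OF eH v] .
  \<comment> \<open>The diagonal will be the factorization of \<open>v\<close> through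
    \<open>m\<close>; \<open>v\<close> takes values in the image of \<open>m\<close> because each
    point of its domain comes from a point along \<open>e\<close>.\<close>
  have "app (far U v) y \<in> app (far U m) ` fob U (Dom C m)" if "y \<in> fob U (Cod C e)" for y
  proof -
    have "y \<in> app (far U e) ` fob U (Dom C e)"
      using that e unfolding E_iff[OF eH] by simp
    then obtain x where x: "x \<in> fob U (Dom C e)" "y = app (far U e) x"
      by (rule imageE)
    have "app (far U m) (app (far U u) x) = app (far U v) y"
      unfolding x(2)
      by (rule scomp_eqD[OF eq']) (use x(1) setcat_homD(1)[OF far_Fun[OF eH]] setcat_homD(1)[OF far_Fun[OF u]] in simp_all)
    then show ?thesis using setcat_homD(3)[OF far_Fun[OF u] x(1)] by (metis imageI)
  qed
  then obtain d where d: "d \<in> Hom (Cod C e) (Dom C m)" "m \<odot> d = v"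
    using factor_through_M[OF m mH v] by blast
  have "m \<odot> (d \<odot> e) = m \<odot> u" using cmp_assoc[OF eH d(1) mH] d(2) eq by simp
  then have "d \<odot> e = u"
    by (rule M_cancel[OF m mH cmp_hom[OF eH d(1)] u])
  moreover have "d' = d" if "d' \<in> Hom (Cod C e) (Dom C m)" "m \<odot> d' = v" for d'
    using M_cancel[OF m mH that(1) d(1)] that(2) d(2) by simp
  ultimately show "\<exists>!d. d \<in> Hom (Cod C e) (Dom C m) \<and> d \<odot> e = u \<and> m \<odot> d = v"
    using d by blast
qed

end

section \<open>Test lists with one or two entries\<close>

lemma hd_cutmap: "l \<noteq> [] \<Longrightarrow> hd (cutmap g S R l) = pre g S (hd l)"
  by (cases l) (auto simp: cutmap_def cut_def)

text \<open>The trace of \<open>{\<sigma>}\<close> is nonempty exactly because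
  \<open>\<sigma>\<close> lies in \<open>R\<close>, so it differs from that of the first
  entry.\<close>

lemma pair_in_cutlists: "\<sigma> \<in> R \<Longrightarrow> R \<subseteq> S \<Longrightarrow>
  [{}, {\<sigma>}] \<in> cutlists S R"
  by (auto simp: cutlists_def cut_def)

lemma pre_singleton_empty: "\<sigma> \<notin> g ` S \<Longrightarrow> pre g S {\<sigma>} = {}"
  by (auto simp: pre_def)

text \<open>If no element of \<open>R\<close> is sent to \<open>\<sigma>\<close>, both preimages
  have empty trace on \<open>R\<close> and the second entry is cut off, even when its preimage in
  \<open>S\<close> is nonempty.\<close>

lemma cutmap_pair:
  assumes "\<sigma> \<notin> g ` R"
  shows "cutmap g S R [{}, {\<sigma>}] = cutmap g S R [{}]"
  using assms by (auto simp: cutmap_def cut_def pre_def)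

lemma cutmap_pair_neq:
  assumes "\<rho> \<in> R" "\<rho> \<in> S" "g \<rho> = \<sigma>"
  shows "cutmap g S R [{}, {\<sigma>}] \<noteq> cutmap g S R [{}]"
  using assms by (auto simp: cutmap_def cut_def pre_def)

context topological_category
begin

text \<open>Points outside the image of \<open>m\<close> are sent to an arbitrary element of
  \<open>S\<close>; nonempty underlying sets of the family are what allows this.\<close>

lemma extend_function:
  assumes m: "m \<in> Hom A X" "inj_on (app (far U m)) (fob U A)"
    and S: "S \<in> Ob (setcat V)" "S \<noteq> {}" and s: "s \<in> Fun (fob U A) S"
  obtains t where "t \<in> Fun (fob U X) S" "t \<star> far U m = s"
proof -
  obtain c where c: "c \<in> S" using S(2) by blast
  let ?m = "app (far U m)"
  let ?t = "setfun (fob U X) S (\<lambda>x. if x \<in> ?m ` fob U A then app s (inv_into (fob U A) ?m x) else c)"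
  have t: "?t \<in> Fun (fob U X) S"
    by (rule setfun_hom[OF fob_Ob[OF HomD(5)[OF m(1)]] S(1)]) (simp add: c setcat_homD(3)[OF s] inv_into_into)
  moreover have "?t \<star> far U m = s"
  proof (rule setfun_eqI[OF S.cmp_hom[OF far_Fun[OF m(1)] t] s])
    fix x assume x: "x \<in> fob U A"
    then show "app (?t \<star> far U m) x = app s x"
      using setcat_homD(1)[OF far_Fun[OF m(1)]] setcat_homD(3)[OF far_Fun[OF m(1)] x] inv_into_f_f[OF m(2) x] by simp
  qed
  ultimately show thesis by (rule that)
qed

end

section \<open>The functor of cut lists\<close>

text \<open>The family is given as a set of objects, and initiality and extension are restated for
  underlying functions. \<open>QQ_two\<close> supplies enough functions to separate points.\<close>

locale cogenerated = topological_category V C U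
  for V :: "'u set" and C :: "('o, 'a) cat" (structure) and U :: "('o, 'a, 'u set, 'u setfun) ftor" +
  fixes QQ :: "'o set"
  assumes QQ_small: "small V QQ" and QQ_ob: "Q \<in> QQ \<Longrightarrow> Q \<in> Ob C"
    and QQ_nonempty: "Q \<in> QQ \<Longrightarrow> fob U Q \<noteq> {}"
    and QQ_two: "\<exists>Q\<in>QQ. \<exists>a\<in>fob U Q. \<exists>b\<in>fob U Q. a \<noteq> b"
    and QQ_initial: "\<lbrakk>X \<in> Ob C; Z \<in> Ob C; h \<in> Fun (fob U Z) (fob U X);
      \<And>Q a. Q \<in> QQ \<Longrightarrow> a \<in> mor X Q \<Longrightarrow>
        a \<star> h \<in> mor Z Q\<rbrakk> \<Longrightarrow> h \<in> mor Z X"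
    and QQ_extend: "\<lbrakk>Q \<in> QQ; m \<in> M; m \<in> Hom A B; a \<in> mor A Q\<rbrakk> \<Longrightarrow> \<exists>b\<in>mor B Q. b \<star> far U m = a"
begin

text \<open>The tag \<open>Q\<close> is kept because different members may share an underlying set
  and yet admit different morphisms.\<close>

definition SS :: "'o \<Rightarrow> ('o \<times> 'u setfun) set" where
  "SS X = (SIGMA Q:QQ. Fun (fob U X) (fob U Q))"

definition RR :: "'o \<Rightarrow> ('o \<times> 'u setfun) set" where
  "RR X = (SIGMA Q:QQ. mor X Q)"

definition pb :: "'a \<Rightarrow> 'o \<times> 'u setfun \<Rightarrow> 'o \<times> 'u setfun" where
  "pb f = (\<lambda>(Q, s). (Q, s \<star> far U f))"

abbreviation TT :: "'o \<Rightarrow> ('o \<times> 'u setfun) set list set" where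
  "TT X \<equiv> cutlists (SS X) (RR X)"

definition Tm :: "'a \<Rightarrow> ('o \<times> 'u setfun) set list \<Rightarrow> ('o \<times> 'u setfun) set list" where
  "Tm f = cutmap (pb f) (SS (Cod C f)) (RR (Cod C f))"

lemma RR_SS: "RR X \<subseteq> SS X"
  using mor_Fun by (auto simp: RR_def SS_def)

lemma pb_simp [simp]: "pb f (Q, s) = (Q, s \<star> far U f)"
  by (simp add: pb_def)

lemma pb_SS: "f \<in> Hom X Y \<Longrightarrow> pb f ` SS Y \<subseteq> SS X"
  using S.cmp_hom[OF far_Fun] by (fastforce simp: SS_def)

lemma pb_RR: "f \<in> Hom X Y \<Longrightarrow> pb f ` RR Y \<subseteq> RR X"
  using mor_cmp[OF morI] by (fastforce simp: RR_def)

lemma pb_pb: "f \<in> Hom X Y \<Longrightarrow> g \<in> Hom Y Z \<Longrightarrow>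
  \<sigma> \<in> SS Z \<Longrightarrow> pb f (pb g \<sigma>) = pb (g \<odot> f) \<sigma>"
  using S.cmp_assoc[OF far_Fun far_Fun] by (auto simp: SS_def far_cmp)

lemma Tm_eq: "f \<in> Hom X Y \<Longrightarrow> Tm f = cutmap (pb f) (SS Y) (RR Y)"
  by (simp add: Tm_def HomD(3))

lemma TT_nonempty: "l \<in> TT X \<Longrightarrow> l \<noteq> []"
  by (simp add: cutlists_def)

lemma Tm_in: "f \<in> Hom X Y \<Longrightarrow> l \<in> TT X \<Longrightarrow> Tm f l \<in> TT Y"
  by (simp add: Tm_eq cutmap_in_cutlists TT_nonempty)

lemma Tm_Tm: "f \<in> Hom X Y \<Longrightarrow> g \<in> Hom Y Z \<Longrightarrow>
  Tm g (Tm f l) = Tm (g \<odot> f) l"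
  unfolding Tm_eq[OF cmp_hom] unfolding Tm_eq
  by (rule cutmap_cutmap) (auto simp: pb_pb dest: subsetD[OF pb_RR] subsetD[OF pb_SS])

lemma pb_Idt: "X \<in> Ob C \<Longrightarrow> \<sigma> \<in> SS X \<Longrightarrow>
  pb (Idt C X) \<sigma> = \<sigma>"
  using S.idt_right by (auto simp: SS_def far_Idt)

lemma Tm_Idt:
  assumes "X \<in> Ob C" "l \<in> TT X"
  shows "Tm (Idt C X) l = l"
  unfolding Tm_eq[OF idt_hom[OF assms(1)]] using assms(2)
  by (rule cutmap_id) (rule pb_Idt[OF assms(1)])

text \<open>A constant function and its modification at the single point \<open>x\<close>. Such a
  pair becomes equal on every set of points avoiding \<open>x\<close>, which detects points missed
  by an image.\<close>

lemma separate_point: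
  assumes "X \<in> Ob C" "x \<in> fob U X"
  obtains Q s s' where "Q \<in> QQ" "s \<in> Fun (fob U X) (fob U Q)" "s' \<in> Fun (fob U X) (fob U Q)"
    "app s x \<noteq> app s' x" "\<And>y. y \<in> fob U X \<Longrightarrow>
      y \<noteq> x \<Longrightarrow> app s y = app s' y"
proof -
  obtain Q a b where Q: "Q \<in> QQ" "a \<in> fob U Q" "b \<in> fob U Q" "a \<noteq> b" using QQ_two
    by blast
  show thesis
  proof (rule that[OF Q(1)])
    show "setfun (fob U X) (fob U Q) (\<lambda>y. a) \<in> Fun (fob U X) (fob U Q)"
      by (rule setfun_hom[OF fob_Ob[OF assms(1)] fob_Ob[OF QQ_ob[OF Q(1)]] Q(2)])
    show "setfun (fob U X) (fob U Q) (\<lambda>y. if y = x then b else a) \<in> Fun (fob U X) (fob U Q)"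
      by (rule setfun_hom[OF fob_Ob[OF assms(1)] fob_Ob[OF QQ_ob[OF Q(1)]]]) (simp add: Q)
  qed (use Q assms in auto)
qed

lemma separate_points:
  assumes "X \<in> Ob C" "x \<in> fob U X" "y \<in> fob U X" "x \<noteq> y"
  obtains Q s where "(Q, s) \<in> SS X" "app s x \<noteq> app s y"
proof -
  obtain Q s s' where "Q \<in> QQ" "s \<in> Fun (fob U X) (fob U Q)" "s' \<in> Fun (fob U X) (fob U Q)"
    "app s x \<noteq> app s' x" "app s y = app s' y"
    using separate_point[OF assms(1,2)] assms(3,4) by metis
  moreover from this have "app s x \<noteq> app s y \<or> app s' x \<noteq> app s' y" by metis
  ultimately show thesis using that[of Q s] that[of Q s'] by (auto simp: SS_def)
qed

lemma comp_eqI: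
  assumes "f \<in> Hom X Y" "s \<in> Fun (fob U Y) B" "s' \<in> Fun (fob U Y) B"
    and "\<And>x. x \<in> fob U X \<Longrightarrow> app s (app (far U f) x) = app s' (app (far U f) x)"
  shows "s \<star> far U f = s' \<star> far U f"
  by (rule setfun_eqI[OF S.cmp_hom[OF far_Fun[OF assms(1)] assms(2)] S.cmp_hom[OF far_Fun[OF assms(1)] assms(3)]])
    (use assms(4) setcat_homD(1)[OF far_Fun[OF assms(1)]] in simp)

lemma comp_eqD:
  assumes "f \<in> Hom X Y" "s \<star> far U f = s' \<star> far U f" "x \<in> fob U X"
  shows "app s (app (far U f) x) = app s' (app (far U f) x)"
  using scomp_eqD[OF assms(2)] assms(3) setcat_homD(1)[OF far_Fun[OF assms(1)]] by simp

section \<open>Action on surjections and initial injections, and its detection\<close>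

lemma comp_E_inj:
  assumes "e \<in> E" "e \<in> Hom X Y" "s \<in> Fun (fob U Y) B" "s' \<in> Fun (fob U Y) B" "s \<star> far U e = s' \<star> far U e"
  shows "s = s'"
proof (rule setfun_eqI[OF assms(3,4)])
  fix y assume "y \<in> fob U Y"
  then have "y \<in> app (far U e) ` fob U X" using assms(1) unfolding E_iff[OF assms(2)] by simp
  then show "app s y = app s' y" using comp_eqD[OF assms(2,5)] by blast
qed

lemma pb_E_inj:
  assumes "e \<in> E" "e \<in> Hom X Y" shows "inj_on (pb e) (SS Y)"
proof (rule inj_onI)
  fix \<sigma> \<tau> assume "\<sigma> \<in> SS Y" "\<tau> \<in> SS Y" "pb e \<sigma> = pb e \<tau>"
  then show "\<sigma> = \<tau>" using comp_E_inj[OF assms]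
    by (cases \<sigma>; cases \<tau>) (auto simp: SS_def)
qed

lemma Tm_E_surj: "e \<in> E \<Longrightarrow> e \<in> Hom X Y \<Longrightarrow> Tm e ` TT X = TT Y"
  unfolding Tm_eq by (rule cutmap_surj[OF pb_E_inj pb_SS pb_RR])

text \<open>Two different reasons: arbitrary functions extend along an injection into a nonempty
  set, whereas morphisms extend by the hypothesis on the family.\<close>

lemma pb_M_onto:
  assumes "m \<in> M" "m \<in> Hom A X" shows "pb m ` SS X = SS A" "pb m ` RR X = RR A"
proof -
  have inj: "inj_on (app (far U m)) (fob U A)" using assms(1) unfolding M_iff[OF assms(2)] by blast
  have "\<sigma> \<in> pb m ` SS X" if \<sigma>A: "\<sigma> \<in> SS A" for \<sigma>
  proof -
    obtain Q s where \<sigma>: "\<sigma> = (Q, s)" and Q: "Q \<in> QQ"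
      and s: "s \<in> Fun (fob U A) (fob U Q)"
      using \<sigma>A by (auto simp: SS_def)
    obtain t where "t \<in> Fun (fob U X) (fob U Q)" "t \<star> far U m = s"
      by (rule extend_function[OF assms(2) inj fob_Ob[OF QQ_ob[OF Q]] QQ_nonempty[OF Q] s])
    then have "(Q, t) \<in> SS X" "pb m (Q, t) = \<sigma>" using \<sigma> Q by (auto simp: SS_def)
    then show ?thesis by blast
  qed
  then show "pb m ` SS X = SS A" using pb_SS[OF assms(2)] by blast
  have "\<sigma> \<in> pb m ` RR X" if \<sigma>A: "\<sigma> \<in> RR A" for \<sigma>
  proof -
    obtain Q s where \<sigma>: "\<sigma> = (Q, s)" and Q: "Q \<in> QQ" and s: "s \<in> mor A Q"
      using \<sigma>A by (auto simp: RR_def)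
    obtain t where "t \<in> mor X Q" "t \<star> far U m = s"
      using QQ_extend[OF Q assms s] by blast
    then have "(Q, t) \<in> RR X" "pb m (Q, t) = \<sigma>" using \<sigma> Q by (auto simp: RR_def)
    then show ?thesis by blast
  qed
  then show "pb m ` RR X = RR A" using pb_RR[OF assms(2)] by blast
qed

lemma Tm_M_inj: "m \<in> M \<Longrightarrow> m \<in> Hom A X \<Longrightarrow> inj_on (Tm m) (TT A)"
  unfolding Tm_eq by (rule inj_on_cutmap[OF pb_M_onto RR_SS])

lemma Tm_M: "m \<in> M \<Longrightarrow> m \<in> Hom A X \<Longrightarrow>
  l \<in> TT A \<Longrightarrow> Tm m l = map (pre (pb m) (SS X)) l"
  unfolding Tm_eq by (rule cutmap_onto[OF _ pb_M_onto RR_SS])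

text \<open>A missed point gives two functions on \<open>Y\<close> with equal restrictions along
  \<open>f\<close>. No preimage under \<open>pb f\<close> separates them, but the first entry of a
  list over \<open>Y\<close>, which is never cut off, may be the singleton of one of them.\<close>

lemma E_if_Tm_surj:
  assumes f: "f \<in> Hom X Y" and surj: "Tm f ` TT X = TT Y"
  shows "f \<in> E"
proof (rule ccontr)
  assume "f \<notin> E"
  then obtain y where y: "y \<in> fob U Y" "y \<notin> app (far U f) ` fob U X"
    unfolding E_iff[OF f] using setcat_homD(4)[OF far_Fun[OF f]] by blast
  obtain Q s s' where Q: "Q \<in> QQ"
    and s: "s \<in> Fun (fob U Y) (fob U Q)" "s' \<in> Fun (fob U Y) (fob U Q)"
    "app s y \<noteq> app s' y"
      and agree: "\<And>x. x \<in> fob U Y \<Longrightarrow> x \<noteq> y \<Longrightarrow>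
        app s x = app s' x"
    by (rule separate_point[OF HomD(5)[OF f] y(1)]) blast
  have eq: "s \<star> far U f = s' \<star> far U f"
  proof (rule comp_eqI[OF f s(1,2)])
    fix x assume x: "x \<in> fob U X"
    then show "app s (app (far U f) x) = app s' (app (far U f) x)"
      using setcat_homD(3)[OF far_Fun[OF f] x] y(2) by (intro agree) auto
  qed
  have sS: "(Q, s) \<in> SS Y" "(Q, s') \<in> SS Y" using Q s by (auto simp: SS_def)
  then have "[{(Q, s)}] \<in> Tm f ` TT X" unfolding surj by (intro single_in_cutlists) auto
  then obtain l where l: "l \<in> TT X" "Tm f l = [{(Q, s)}]" by (metis imageE)
  then have "pre (pb f) (SS Y) (hd l) = {(Q, s)}"
    using hd_cutmap[OF TT_nonempty[OF l(1)], of "pb f" "SS Y" "RR Y"] Tm_eq[OF f] by simp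
  then have "(Q, s) \<in> pre (pb f) (SS Y) (hd l)" "(Q, s') \<notin> pre (pb f) (SS Y) (hd l)"
    using s(3) by auto
  then show False using sS eq by (auto simp: pre_def)
qed

text \<open>A function \<open>\<sigma>\<close> is detected by comparing \<open>[{\<sigma>}]\<close> with \<open>[{}]\<close>, and whether it is a morphism by comparing
  \<open>[{}, {\<sigma>}]\<close> with \<open>[{}]\<close>.\<close>

lemma pb_onto_if_kernel:
  assumes e: "e \<in> Hom X Y" and g: "g \<in> Hom X Z"
    and ker: "\<And>l l'. l \<in> TT X \<Longrightarrow> l' \<in> TT X \<Longrightarrow>
      Tm e l = Tm e l' \<Longrightarrow> Tm g l = Tm g l'"
  shows "pb g ` SS Z \<subseteq> pb e ` SS Y" "pb g ` RR Z \<subseteq> pb e ` RR Y"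
proof -
  have em: "[{}] \<in> TT X" by (rule single_in_cutlists) simp
  have "pb g \<sigma> \<in> pb e ` SS Y" if \<sigma>: "\<sigma> \<in> SS Z" for \<sigma>
  proof (rule ccontr)
    assume ne: "pb g \<sigma> \<notin> pb e ` SS Y"
    have "pre (pb e) (SS Y) {pb g \<sigma>} = {}"
      using ne by (rule pre_singleton_empty)
    then have "Tm e [{pb g \<sigma>}] = Tm e [{}]"
      unfolding Tm_eq[OF e] cutmap_single by (simp add: pre_def)
    moreover have "pb g \<sigma> \<in> SS X" using \<sigma> pb_SS[OF g] by blast
    then have "[{pb g \<sigma>}] \<in> TT X" by (intro single_in_cutlists) simp
    ultimately have "Tm g [{pb g \<sigma>}] = Tm g [{}]" using ker em by blast
    then have "pre (pb g) (SS Z) {pb g \<sigma>} = pre (pb g) (SS Z) {}"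
      unfolding Tm_eq[OF g] cutmap_single by simp
    moreover have "\<sigma> \<in> pre (pb g) (SS Z) {pb g \<sigma>}" using \<sigma>
      by (simp add: pre_def)
    ultimately have "\<sigma> \<in> pre (pb g) (SS Z) {}" by metis
    then show False unfolding pre_def by blast
  qed
  then show "pb g ` SS Z \<subseteq> pb e ` SS Y" by blast
  have "pb g \<sigma> \<in> pb e ` RR Y" if \<sigma>: "\<sigma> \<in> RR Z" for \<sigma>
  proof (rule ccontr)
    assume "pb g \<sigma> \<notin> pb e ` RR Y"
    then have "Tm e [{}, {pb g \<sigma>}] = Tm e [{}]"
      unfolding Tm_eq[OF e] by (rule cutmap_pair)
    moreover have "pb g \<sigma> \<in> RR X" using \<sigma> pb_RR[OF g] by blast
    then have "[{}, {pb g \<sigma>}] \<in> TT X" by (rule pair_in_cutlists[OF _ RR_SS])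
    ultimately have "Tm g [{}, {pb g \<sigma>}] = Tm g [{}]" using ker em by blast
    with cutmap_pair_neq[OF \<sigma> subsetD[OF RR_SS \<sigma>] refl, of "pb g"] show False
      unfolding Tm_eq[OF g] by (rule notE)
  qed
  then show "pb g ` RR Z \<subseteq> pb e ` RR Y" by blast
qed

text \<open>Functions into the family separate the points of \<open>Z\<close>. If their composites
  with \<open>g\<close> all factor through \<open>e\<close>, then \<open>g\<close> identifies
  whatever \<open>e\<close> identifies.\<close>

lemma kernel_le_function:
  assumes e: "e \<in> Hom X Y" and g: "g \<in> Hom X Z" and sub: "pb g ` SS Z \<subseteq> pb e ` SS Y"
    and x: "x \<in> fob U X" "x' \<in> fob U X" "app (far U e) x = app (far U e) x'"
  shows "app (far U g) x = app (far U g) x'"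
proof (rule ccontr)
  assume ne: "app (far U g) x \<noteq> app (far U g) x'"
  obtain Q s where s: "(Q, s) \<in> SS Z" "app s (app (far U g) x) \<noteq> app s (app (far U g) x')"
    by (rule separate_points[OF HomD(5)[OF g] setcat_homD(3)[OF far_Fun[OF g] x(1)] setcat_homD(3)[OF far_Fun[OF g] x(2)] ne])
  have "pb g (Q, s) \<in> pb e ` SS Y" using s(1) sub by blast
  then obtain t where "s \<star> far U g = t \<star> far U e" by auto
  then have "app s (app (far U g) z) = app t (app (far U e) z)" if "z \<in> fob U X" for z
    by (rule scomp_eqD) (use that setcat_homD(1)[OF far_Fun[OF g]] setcat_homD(1)[OF far_Fun[OF e]] in auto)
  then show False using s(2) x by simp
qed

text \<open>The inclusion for \<open>SS\<close> yields the factoring function; the inclusion for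
  \<open>RR\<close> says that its composites with all test morphisms are morphisms, so initiality
  applies.\<close>

lemma factor_through_E:
  assumes e: "e \<in> E" "e \<in> Hom X Y" and g: "g \<in> Hom X Z"
    and ker: "\<And>l l'. l \<in> TT X \<Longrightarrow> l' \<in> TT X \<Longrightarrow>
      Tm e l = Tm e l' \<Longrightarrow> Tm g l = Tm g l'"
  obtains h where "h \<in> Hom Y Z" "h \<odot> e = g"
proof -
  note sub = pb_onto_if_kernel[OF e(2) g ker]
  have onto: "app (far U e) ` fob U X = fob U Y" using e(1) unfolding E_iff[OF e(2)] .
  define k where "k y = app (far U g) (inv_into (fob U X) (app (far U e)) y)" for y
  have k: "k (app (far U e) x) = app (far U g) x" if x: "x \<in> fob U X" for x
  proof -
    have y: "app (far U e) x \<in> app (far U e) ` fob U X" using x by blast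
    show ?thesis unfolding k_def
      by (rule kernel_le_function[OF e(2) g sub(1) inv_into_into[OF y] x f_inv_into_f[OF y]])
  qed
  let ?k = "setfun (fob U Y) (fob U Z) k"
  have kF: "?k \<in> Fun (fob U Y) (fob U Z)"
  proof (rule setfun_hom[OF fob_Ob[OF HomD(5)[OF e(2)]] fob_Ob[OF HomD(5)[OF g]]])
    fix y assume "y \<in> fob U Y"
    then obtain x where "x \<in> fob U X" "y = app (far U e) x" using onto by blast
    then show "k y \<in> fob U Z" using k setcat_homD(3)[OF far_Fun[OF g]] by simp
  qed
  have ke: "?k \<star> far U e = far U g"
    by (rule setfun_eqI[OF S.cmp_hom[OF far_Fun[OF e(2)] kF] far_Fun[OF g]])
      (simp add: k setcat_homD(1)[OF far_Fun[OF e(2)]] setcat_homD(3)[OF far_Fun[OF e(2)]])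
  have "?k \<in> mor Y Z"
  proof (rule QQ_initial[OF HomD(5)[OF g] HomD(5)[OF e(2)] kF])
    fix Q a assume Q: "Q \<in> QQ" and a: "a \<in> mor Z Q"
    have "(Q, a) \<in> RR Z" using Q a by (simp add: RR_def)
    then have "pb g (Q, a) \<in> pb e ` RR Y" using sub(2) by blast
    then obtain \<tau> where "\<tau> \<in> RR Y" "pb g (Q, a) = pb e \<tau>" by blast
    then obtain b where b: "b \<in> mor Y Q" "a \<star> far U g = b \<star> far U e"
      by (cases \<tau>) (auto simp: RR_def)
    have "(a \<star> ?k) \<star> far U e = b \<star> far U e"
      using S.cmp_assoc[OF far_Fun[OF e(2)] kF mor_Fun[OF a]] ke b(2) by simp
    then have "a \<star> ?k = b"
      by (rule comp_E_inj[OF e S.cmp_hom[OF kF mor_Fun[OF a]] mor_Fun[OF b(1)]])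
    then show "a \<star> ?k \<in> mor Y Q" using b(1) by simp
  qed
  then obtain h where h: "h \<in> Hom Y Z" "far U h = ?k" by (rule morE)
  have "h \<odot> e = g"
    using far_inj[OF cmp_hom[OF e(2) h(1)] g] far_cmp[OF e(2) h(1)] h(2) ke by simp
  then show thesis by (rule that[OF h(1)])
qed

text \<open>Injectivity puts the kernel of \<open>f\<close> below that of the identity. Hence all
  functions and all morphisms from \<open>X\<close> into the family are restrictions along
  \<open>f\<close>, which give injectivity and initiality respectively.\<close>

lemma M_if_Tm_inj:
  assumes f: "f \<in> Hom X Y" and inj: "inj_on (Tm f) (TT X)"
  shows "f \<in> M"
proof -
  have i: "Idt C X \<in> Hom X X" using idt_hom HomD(4)[OF f] by blast
  have ker: "Tm (Idt C X) l = Tm (Idt C X) l'" if "l \<in> TT X" "l' \<in> TT X" "Tm f l = Tm f l'"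
    for l l'
    using inj_onD[OF inj that(3,1,2)] by simp
  have sub: "pb (Idt C X) ` SS X \<subseteq> pb f ` SS Y" "pb (Idt C X) ` RR X \<subseteq> pb f ` RR Y"
    using pb_onto_if_kernel[OF f i] ker by blast+
  note pbi = pb_Idt[OF HomD(4)[OF f]]
  show ?thesis unfolding M_iff[OF f]
  proof (intro conjI ballI impI)
    show "inj_on (app (far U f)) (fob U X)"
    proof (rule inj_onI)
      fix x x' assume x: "x \<in> fob U X" "x' \<in> fob U X" "app (far U f) x = app (far U f) x'"
      show "x = x'"
        using kernel_le_function[OF f i sub(1) x] x(1,2)
        unfolding far_Idt[OF HomD(4)[OF f]] setcat_Idt by simp
    qed
    fix Z h assume Z: "Z \<in> Ob C" and h: "h \<in> Fun (fob U Z) (fob U X)"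
      and fh: "far U f \<star> h \<in> mor Z Y"
    show "h \<in> mor Z X"
    proof (rule QQ_initial[OF HomD(4)[OF f] Z h])
      fix Q a assume Q: "Q \<in> QQ" and a: "a \<in> mor X Q"
      have aR: "(Q, a) \<in> RR X" using Q a by (auto simp: RR_def)
      then have "pb (Idt C X) (Q, a) = (Q, a)" using pbi RR_SS by blast
      then have "(Q, a) \<in> pb f ` RR Y" using aR sub(2) by (metis imageI subsetD)
      then obtain \<tau> where "\<tau> \<in> RR Y" "(Q, a) = pb f \<tau>" by blast
      then obtain b where b: "b \<in> mor Y Q" "a = b \<star> far U f"
        by (cases \<tau>) (auto simp: RR_def)
      show "a \<star> h \<in> mor Z Q"
        using mor_cmp[OF fh b(1)] S.cmp_assoc[OF h far_Fun[OF f] mor_Fun[OF b(1)]] b(2) by simp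
    qed
  qed
qed

text \<open>At a point of the image of \<open>f\<close> outside that of \<open>m\<close>, take
  functions \<open>s\<close>, \<open>s'\<close> differing only there. The first entry of a list
  coming from \<open>A\<close> cannot separate them, while one coming from \<open>Z\<close>
  can.\<close>

lemma factor_through_M_if_Tm:
  assumes m: "m \<in> M" "m \<in> Hom A X" and f: "f \<in> Hom Z X"
    and im: "Tm f ` TT Z \<subseteq> Tm m ` TT A"
  obtains h where "h \<in> Hom Z A" "m \<odot> h = f"
proof -
  have "app (far U f) z \<in> app (far U m) ` fob U A" if z: "z \<in> fob U Z" for z
  proof (rule ccontr)
    let ?y = "app (far U f) z"
    assume y: "?y \<notin> app (far U m) ` fob U A"
    have yX: "?y \<in> fob U X" using setcat_homD(3)[OF far_Fun[OF f] z] .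
    obtain Q s s' where Q: "Q \<in> QQ"
      and s: "s \<in> Fun (fob U X) (fob U Q)" "s' \<in> Fun (fob U X) (fob U Q)"
      "app s ?y \<noteq> app s' ?y"
        and agree: "\<And>x. x \<in> fob U X \<Longrightarrow> x \<noteq> ?y \<Longrightarrow>
          app s x = app s' x"
      by (rule separate_point[OF HomD(5)[OF f] yX]) blast
    have eq: "s \<star> far U m = s' \<star> far U m"
    proof (rule comp_eqI[OF m(2) s(1,2)])
      fix x assume x: "x \<in> fob U A"
      then have "app (far U m) x \<noteq> ?y" using y by (metis imageI)
      then show "app s (app (far U m) x) = app s' (app (far U m) x)"
        by (rule agree[OF setcat_homD(3)[OF far_Fun[OF m(2)] x]])
    qed
    have ne: "s \<star> far U f \<noteq> s' \<star> far U f" using comp_eqD[OF f _ z] s(3) by blast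
    have sS: "(Q, s) \<in> SS X" "(Q, s') \<in> SS X" using Q s by (auto simp: SS_def)
    have "pb f (Q, s) \<in> SS Z" using sS pb_SS[OF f] by blast
    then have "[{pb f (Q, s)}] \<in> TT Z" by (intro single_in_cutlists) simp
    then have "Tm f [{pb f (Q, s)}] \<in> Tm m ` TT A" by (rule subsetD[OF im imageI])
    then obtain l where l: "Tm f [{pb f (Q, s)}] = Tm m l" "l \<in> TT A" by (rule imageE)
    have "pre (pb m) (SS X) (hd l) = pre (pb f) (SS X) {pb f (Q, s)}"
      using hd_cutmap[OF TT_nonempty[OF l(2)], of "pb m" "SS X" "RR X"] l(1)
      unfolding Tm_eq[OF m(2)] Tm_eq[OF f] cutmap_single by (metis list.sel(1))
    moreover have "(Q, s) \<in> pre (pb f) (SS X) {pb f (Q, s)}" "(Q, s') \<notin> pre (pb f) (SS X) {pb f (Q, s)}"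
      using sS ne by (auto simp: pre_def)
    moreover have "(Q, s) \<in> pre (pb m) (SS X) (hd l) \<longleftrightarrow> (Q, s') \<in> pre (pb m) (SS X) (hd l)"
      using sS eq by (simp add: pre_def)
    ultimately show False by blast
  qed
  then have "app (far U f) ` fob U Z \<subseteq> app (far U m) ` fob U A" by blast
  then show thesis by (rule factor_through_M[OF m f]) (rule that)
qed

text \<open>Given \<open>s\<close> and \<open>c\<close> that agree on \<open>W\<close>, the function
  equal to \<open>s\<close> on the image of \<open>m\<close> and to \<open>c\<close> elsewhere
  agrees with \<open>s\<close> on \<open>A\<close> and with \<open>c\<close> on \<open>B\<close>.
  Membership in \<open>\<phi>\<close> passes along this function; morphisms would not admit such
  gluing.\<close>

lemma intersection_saturated:
  assumes m: "m \<in> Hom A X" and n: "n \<in> Hom B X" and w: "w \<in> Hom W X"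
    and im: "app (far U m) ` fob U A \<inter> app (far U n) ` fob U B \<subseteq> app (far U w) ` fob U W"
    and \<phi>m: "\<phi> = pre (pb m) (SS X) \<mu>" and \<phi>n: "\<phi> = pre (pb n) (SS X) \<nu>"
  shows "pre (pb w) (SS X) (pb w ` \<phi>) = \<phi>"
proof
  have \<phi>S: "\<phi> \<subseteq> SS X" using \<phi>m pre_subset by metis
  then show "\<phi> \<subseteq> pre (pb w) (SS X) (pb w ` \<phi>)" by (auto simp: pre_def)
  show "pre (pb w) (SS X) (pb w ` \<phi>) \<subseteq> \<phi>"
  proof
    fix \<sigma> assume "\<sigma> \<in> pre (pb w) (SS X) (pb w ` \<phi>)"
    then obtain \<tau> where "\<sigma> \<in> SS X" "\<tau> \<in> \<phi>" "pb w \<sigma> = pb w \<tau>"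
      by (auto simp: pre_def)
    then obtain Q s c where \<sigma>: "\<sigma> = (Q, s)" "(Q, s) \<in> SS X"
      and c: "(Q, c) \<in> \<phi>" and eq: "s \<star> far U w = c \<star> far U w"
      by (cases \<sigma>; cases \<tau>) auto
    have Q: "Q \<in> QQ" and s: "s \<in> Fun (fob U X) (fob U Q)"
      and c': "c \<in> Fun (fob U X) (fob U Q)"
      using \<sigma> c \<phi>S by (auto simp: SS_def)
    let ?d = "setfun (fob U X) (fob U Q) (\<lambda>x. if x \<in> app (far U m) ` fob U A then app s x else app c x)"
    have d: "?d \<in> Fun (fob U X) (fob U Q)"
      using setcat_homD(3)[OF s] setcat_homD(3)[OF c'] fob_Ob HomD(5)[OF w] QQ_ob[OF Q]
        by (intro setfun_hom) auto
    have dS: "(Q, ?d) \<in> SS X" using Q d by (simp add: SS_def)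
    have dm: "?d \<star> far U m = s \<star> far U m"
      by (rule comp_eqI[OF m d s]) (use setcat_homD(3)[OF far_Fun[OF m]] in auto)
    have dn: "?d \<star> far U n = c \<star> far U n"
    proof (rule comp_eqI[OF n d c'])
      fix b assume b: "b \<in> fob U B"
      let ?x = "app (far U n) b"
      have xX: "?x \<in> fob U X" using setcat_homD(3)[OF far_Fun[OF n] b] .
      show "app ?d ?x = app c ?x"
      proof (cases "?x \<in> app (far U m) ` fob U A")
        case True
        then have "?x \<in> app (far U w) ` fob U W" using im b by blast
        then obtain z where z: "?x = app (far U w) z" "z \<in> fob U W" by (rule imageE)
        have "app s ?x = app c ?x" unfolding z(1) by (rule comp_eqD[OF w eq z(2)])
        then show ?thesis using True xX by simp
      qed (use xX in simp)
    qed
    have "(Q, ?d) \<in> \<phi>"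
      using c dn dS unfolding \<phi>n by (simp add: pre_def)
    then have "(Q, s) \<in> \<phi>"
      using dm \<sigma>(2) unfolding \<phi>m by (simp add: pre_def)
    then show "\<sigma> \<in> \<phi>" using \<sigma> by simp
  qed
qed

text \<open>Along \<open>M\<close> no list is cut, so each entry of a common element is a preimage
  from \<open>A\<close> and from \<open>B\<close>, hence saturated over \<open>W\<close>. Direct
  images of the entries then form a list over \<open>W\<close>.\<close>

lemma Tm_intersection:
  assumes m: "m \<in> M" "m \<in> Hom A X" and n: "n \<in> M" "n \<in> Hom B X"
    and w: "w \<in> M" "w \<in> Hom W X"
    and im: "app (far U m) ` fob U A \<inter> app (far U n) ` fob U B \<subseteq> app (far U w) ` fob U W"
  shows "Tm m ` TT A \<inter> Tm n ` TT B \<subseteq> Tm w ` TT W"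
proof
  fix t assume "t \<in> Tm m ` TT A \<inter> Tm n ` TT B"
  then obtain l l' where l: "l \<in> TT A" "t = Tm m l" "l' \<in> TT B" "t = Tm n l'" by blast
  have tX: "t \<in> TT X" using l Tm_in[OF m(2)] by simp
  let ?k = "map (image (pb w)) t"
  have "pre (pb w) (SS X) (pb w ` \<phi>) = \<phi>" if "\<phi> \<in> set t" for \<phi>
  proof -
    have "\<phi> \<in> pre (pb m) (SS X) ` set l" using that l Tm_M[OF m l(1)] by (metis list.set_map)
    moreover have "\<phi> \<in> pre (pb n) (SS X) ` set l'" using that l Tm_M[OF n l(3)]
      by (metis list.set_map)
    ultimately show ?thesis using intersection_saturated[OF m(2) n(2) w(2) im] by blast
  qed
  then have k: "map (pre (pb w) (SS X)) ?k = t" by (simp add: map_idI)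
  have cut: "cut (RR X) t = t" using tX by (simp add: cutlists_def)
  have "cut (RR W) ?k = ?k"
  proof (rule cut_reflect)
    show "pre (pb w) (SS X) \<phi> \<inter> RR X = pre (pb w) (SS X) \<psi> \<inter> RR X"
      if "\<phi> \<inter> RR W = \<psi> \<inter> RR W" for \<phi> \<psi>
      using that pb_RR[OF w(2)] by (rule pre_mod)
  qed (simp only: k cut)
  moreover have "?k \<in> lists (Pow (SS W))"
    using tX pb_SS[OF w(2)] by (fastforce simp: cutlists_def in_lists_conv_set)
  ultimately have "?k \<in> TT W" using TT_nonempty[OF tX] by (simp add: cutlists_def)
  moreover have "Tm w ?k = t" unfolding Tm_eq[OF w(2)] cutmap_def k by (rule cut)
  ultimately show "t \<in> Tm w ` TT W" by (metis imageI)
qed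

end

section \<open>Pushouts of surjections\<close>

context cogenerated
begin

text \<open>Instantiates the gluing of lists with restrictions of functions and morphisms:
  \<open>gS\<close> and \<open>gR\<close> say that compatible pairs on \<open>A\<close> and
  \<open>B\<close> come from \<open>D\<close>.\<close>

lemma Tm_kernel_join:
  assumes d: "d \<in> E" "d \<in> Hom X A" and e: "e \<in> Hom X B" and p: "p \<in> Hom A D"
    and gS: "\<And>Q s t. Q \<in> QQ \<Longrightarrow> s \<in> Fun (fob U A) (fob U Q) \<Longrightarrow>
      t \<in> Fun (fob U B) (fob U Q) \<Longrightarrow>
      s \<star> far U d = t \<star> far U e \<Longrightarrow>
        \<exists>r\<in>Fun (fob U D) (fob U Q). r \<star> far U p = s \<and> r \<star> far U q = t"
    and gR: "\<And>Q s t. Q \<in> QQ \<Longrightarrow> s \<in> mor A Q \<Longrightarrow>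
      t \<in> mor B Q \<Longrightarrow>
      s \<star> far U d = t \<star> far U e \<Longrightarrow>
        \<exists>r\<in>mor D Q. r \<star> far U p = s \<and> r \<star> far U q = t"
    and kA: "\<And>l l'. l \<in> TT X \<Longrightarrow> l' \<in> TT X \<Longrightarrow>
      Tm d l = Tm d l' \<Longrightarrow> k l = k l'"
    and kB: "\<And>l l'. l \<in> TT X \<Longrightarrow> l' \<in> TT X \<Longrightarrow>
      Tm e l = Tm e l' \<Longrightarrow> k l = k l'"
    and l: "l \<in> TT X" "l' \<in> TT X" "Tm (p \<odot> d) l = Tm (p \<odot> d) l'"
  shows "k l = k l'"
proof -
  have glue: "\<exists>r\<in>RD. pb p r = \<sigma> \<and> pb q r = \<tau>"
    if "\<sigma> = (Q, s)" "\<tau> = (Q', t)" "pb d \<sigma> = pb e \<tau>" "\<exists>r\<in>F. r \<star> far U p = s \<and> r \<star> far U q = t"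
      "\<And>r. r \<in> F \<Longrightarrow> (Q, r) \<in> RD" for \<sigma> \<tau> Q Q' s t RD F
  proof -
    note hyp = that
    obtain r where r: "r \<in> F" "r \<star> far U p = s" "r \<star> far U q = t" using hyp(4) by blast
    have "Q' = Q" using hyp(1-3) by simp
    then show ?thesis using hyp(1,2) r hyp(5)[OF r(1)] by (intro bexI[of _ "(Q, r)"]) simp_all
  qed
  interpret cutlist_pullback "pb d" "pb e" "pb p" "pb q" "SS A" "RR A" "SS B" "RR B" "SS D" "RR D"
  proof
    show "inj_on (pb d) (SS A)" by (rule pb_E_inj[OF d])
    show "\<exists>r\<in>SS D. pb p r = \<sigma> \<and> pb q r = \<tau>"
      if \<sigma>: "\<sigma> \<in> SS A" "\<tau> \<in> SS B" and eq: "pb d \<sigma> = pb e \<tau>"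
        for \<sigma> \<tau>
    proof -
      obtain Q s where s: "\<sigma> = (Q, s)" "Q \<in> QQ" "s \<in> Fun (fob U A) (fob U Q)"
        using \<sigma>(1) by (auto simp: SS_def)
      obtain Q' t where t: "\<tau> = (Q', t)" "t \<in> Fun (fob U B) (fob U Q')" using \<sigma>(2)
        by (auto simp: SS_def)
      have Q': "Q' = Q" "s \<star> far U d = t \<star> far U e" using eq s t by auto
      show ?thesis
        by (rule glue[OF s(1) t(1) eq gS[OF s(2,3) _ Q'(2)]]) (use t Q' s in \<open>simp_all add: SS_def\<close>)
    qed
    show "\<exists>r\<in>RR D. pb p r = \<sigma> \<and> pb q r = \<tau>"
      if \<sigma>: "\<sigma> \<in> RR A" "\<tau> \<in> RR B" and eq: "pb d \<sigma> = pb e \<tau>"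
        for \<sigma> \<tau>
    proof -
      obtain Q s where s: "\<sigma> = (Q, s)" "Q \<in> QQ" "s \<in> mor A Q" using \<sigma>(1)
        by (auto simp: RR_def)
      obtain Q' t where t: "\<tau> = (Q', t)" "t \<in> mor B Q'" using \<sigma>(2) by (auto simp: RR_def)
      have Q': "Q' = Q" "s \<star> far U d = t \<star> far U e" using eq s t by auto
      show ?thesis
        by (rule glue[OF s(1) t(1) eq gR[OF s(2,3) _ Q'(2)]]) (use t Q' s in \<open>simp_all add: RR_def\<close>)
    qed
  qed (rule RR_SS)+
  have fixed: "cut (RR X) m = m" if "m \<in> TT X" for m using that by (simp add: cutlists_def)
  have c: "cutmap c (SS D) (RR D) m = Tm (p \<odot> d) m" for m
    unfolding Tm_Tm[OF d(2) p, symmetric] Tm_eq[OF d(2)] Tm_eq[OF p]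
    by (rule cutmap_cutmap[OF pb_RR[OF p] pb_SS[OF p] refl, symmetric])
  have Tcut: "Tm f (cut (RR X) m) = cutmap (pb f) (SS Y) (RR Y) m" if "f \<in> Hom X Y" for f Y m
    unfolding Tm_eq[OF that] by (rule cutmap_cut[OF pb_RR[OF that]])
  have "k (cut (RR X) l) = k (cut (RR X) l')"
  \<comment> \<open>The general lemma tests arbitrary lists over \<open>SS X\<close>, whereas
    \<open>k\<close> is controlled on cut lists only, so \<open>k\<close> is composed with
    \<open>cut\<close>.\<close>
  proof (rule cutmap_kernel_join[where k = "\<lambda>l. k (cut (RR X) l)"])
    show "pb d ` SS A \<union> pb e ` SS B \<subseteq> SS X" using pb_SS[OF d(2)] pb_SS[OF e] by simp
    show "cutmap c (SS D) (RR D) l = cutmap c (SS D) (RR D) l'" using l(3) c by simp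
    show "l \<in> lists (Pow (SS X))" "l' \<in> lists (Pow (SS X))" "l \<noteq> []" "l' \<noteq> []"
      using l(1,2) by (simp_all add: cutlists_def)
    fix m m' assume m: "m \<in> lists (Pow (SS X))" "m' \<in> lists (Pow (SS X))" "m \<noteq> []" "m' \<noteq> []"
    note T = cut_in_cutlists[OF m(1,3), of "RR X"] cut_in_cutlists[OF m(2,4), of "RR X"]
    show "k (cut (RR X) m) = k (cut (RR X) m')"
      if "cutmap (pb d) (SS A) (RR A) m = cutmap (pb d) (SS A) (RR A) m'"
      by (rule kA[OF T]) (simp only: Tcut[OF d(2)] that)
    show "k (cut (RR X) m) = k (cut (RR X) m')"
      if "cutmap (pb e) (SS B) (RR B) m = cutmap (pb e) (SS B) (RR B) m'"
      by (rule kB[OF T]) (simp only: Tcut[OF e] that)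
  qed
  then show ?thesis using fixed l by simp
qed

lemma pushout_HomD:
  assumes "is_pushout C d e p q" "d \<in> Hom X A" "e \<in> Hom X B"
  shows "p \<in> Hom A (Cod C p)" "q \<in> Hom B (Cod C p)" "p \<odot> d = q \<odot> e"
    "\<And>Z u v. u \<in> Hom A Z \<Longrightarrow> v \<in> Hom B Z \<Longrightarrow>
      u \<odot> d = v \<odot> e \<Longrightarrow>
      \<exists>!h. h \<in> Hom (Cod C p) Z \<and> h \<odot> p = u \<and> h \<odot> q = v"
proof -
  show "p \<in> Hom A (Cod C p)" "q \<in> Hom B (Cod C p)" "p \<odot> d = q \<odot> e"
    using assms unfolding is_pushout_def by (auto simp: homset_def)
  fix Z u v assume u: "u \<in> Hom A Z" "v \<in> Hom B Z" "u \<odot> d = v \<odot> e"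
  then show "\<exists>!h. h \<in> Hom (Cod C p) Z \<and> h \<odot> p = u \<and> h \<odot> q = v"
    using assms(1) HomD(3)[OF assms(2)] HomD(3)[OF assms(3)] HomD(5)[OF u(1)]
    unfolding is_pushout_def by blast
qed

lemma far_eqD: "f \<odot> e = g \<odot> d \<Longrightarrow> e \<in> Hom X Y \<Longrightarrow>
  f \<in> Hom Y Z \<Longrightarrow> d \<in> Hom X W \<Longrightarrow> g \<in> Hom W Z \<Longrightarrow>
    far U f \<star> far U e = far U g \<star> far U d"
  using far_cmp by metis

lemma far_eqI:
  assumes "far U f \<star> far U e = far U g \<star> far U d" "e \<in> Hom X Y" "f \<in> Hom Y Z" "d \<in> Hom X W" "g \<in> Hom W Z"
  shows "f \<odot> e = g \<odot> d"
  by (rule far_inj[OF cmp_hom[OF assms(2,3)] cmp_hom[OF assms(4,5)]])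
    (simp only: far_cmp[OF assms(2,3)] far_cmp[OF assms(4,5)] assms(1))

lemma pushout_mor:
  assumes po: "is_pushout C d e p q" and d: "d \<in> Hom X A" and e: "e \<in> Hom X B"
    and st: "s \<in> mor A Z" "t \<in> mor B Z" "s \<star> far U d = t \<star> far U e"
  obtains r where "r \<in> mor (Cod C p) Z" "r \<star> far U p = s" "r \<star> far U q = t"
    "\<And>r'. r' \<in> mor (Cod C p) Z \<Longrightarrow> r' \<star> far U p = s \<Longrightarrow>
      r' \<star> far U q = t \<Longrightarrow> r' = r"
proof -
  note P = pushout_HomD[OF po d e]
  obtain u v where u: "u \<in> Hom A Z" "far U u = s" and v: "v \<in> Hom B Z" "far U v = t"
    using st(1,2) by (metis morE)
  have "u \<odot> d = v \<odot> e" by (rule far_eqI[OF _ d u(1) e v(1)]) (simp only: u v st)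
  then obtain h where h: "h \<in> Hom (Cod C p) Z" "h \<odot> p = u" "h \<odot> q = v"
    and uniq: "\<And>k. k \<in> Hom (Cod C p) Z \<Longrightarrow> k \<odot> p = u \<Longrightarrow>
      k \<odot> q = v \<Longrightarrow> k = h"
    using P(4)[OF u(1) v(1)] by blast
  show thesis
  proof (rule that[OF morI[OF h(1)]])
    show "far U h \<star> far U p = s" "far U h \<star> far U q = t"
      using far_cmp[OF P(1) h(1)] far_cmp[OF P(2) h(1)] h u v by simp_all
    fix r' assume r': "r' \<in> mor (Cod C p) Z" "r' \<star> far U p = s" "r' \<star> far U q = t"
    obtain k where k: "k \<in> Hom (Cod C p) Z" "far U k = r'" using r'(1) by (rule morE)
    have "k \<odot> p = u"
      by (rule far_inj[OF cmp_hom[OF P(1) k(1)] u(1)]) (simp only: far_cmp[OF P(1) k(1)] k u r')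
    moreover have "k \<odot> q = v"
      by (rule far_inj[OF cmp_hom[OF P(2) k(1)] v(1)]) (simp only: far_cmp[OF P(2) k(1)] k v r')
    ultimately show "r' = far U h" using uniq[OF k(1)] k(2) by simp
  qed
qed

text \<open>All functions into an indiscrete object are morphisms, so the universal property of the
  pushout applies to arbitrary functions.\<close>

lemma pushout_fun:
  assumes po: "is_pushout C d e p q" and d: "d \<in> Hom X A" and e: "e \<in> Hom X B"
    and S: "S \<in> Ob (setcat V)"
    and st: "s \<in> Fun (fob U A) S" "t \<in> Fun (fob U B) S" "s \<star> far U d = t \<star> far U e"
  obtains r where "r \<in> Fun (fob U (Cod C p)) S" "r \<star> far U p = s" "r \<star> far U q = t"
    "\<And>r'. r' \<in> Fun (fob U (Cod C p)) S \<Longrightarrow>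
      r' \<star> far U p = s \<Longrightarrow> r' \<star> far U q = t \<Longrightarrow> r' = r"
proof -
  obtain N where N: "N \<in> Ob C" "fob U N = S" "\<And>Z. Z \<in> Ob C \<Longrightarrow>
    mor Z N = Fun (fob U Z) S"
    by (rule indiscrete[OF S]) blast
  have mA: "s \<in> mor A N" "t \<in> mor B N" using st N(3) HomD(5)[OF d] HomD(5)[OF e] by simp_all
  have D: "mor (Cod C p) N = Fun (fob U (Cod C p)) S"
    by (rule N(3)[OF HomD(5)[OF pushout_HomD(1)[OF po d e]]])
  show thesis by (rule pushout_mor[OF po d e mA st(3), unfolded D]) (rule that)
qed

text \<open>Two functions that differ only at a missed point agree after \<open>p\<close>, and also
  after \<open>q\<close> because \<open>e\<close> is onto. This contradicts uniqueness of induced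
  functions.\<close>

lemma pushout_E:
  assumes po: "is_pushout C d e p q" and d: "d \<in> E" "d \<in> Hom X A"
    and e: "e \<in> E" "e \<in> Hom X B"
  shows "p \<in> E"
proof (rule ccontr)
  note P = pushout_HomD[OF po d(2) e(2)]
  assume "p \<notin> E"
  then obtain y where y: "y \<in> fob U (Cod C p)" "y \<notin> app (far U p) ` fob U A"
    unfolding E_iff[OF P(1)] using setcat_homD(4)[OF far_Fun[OF P(1)]] by blast
  obtain Q s s' where Q: "Q \<in> QQ"
    and s: "s \<in> Fun (fob U (Cod C p)) (fob U Q)" "s' \<in> Fun (fob U (Cod C p)) (fob U Q)"
    "app s y \<noteq> app s' y"
      and agree: "\<And>x. x \<in> fob U (Cod C p) \<Longrightarrow> x \<noteq> y \<Longrightarrow>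
        app s x = app s' x"
    by (rule separate_point[OF HomD(5)[OF P(1)] y(1)]) blast
  have eqp: "s \<star> far U p = s' \<star> far U p"
  proof (rule comp_eqI[OF P(1) s(1,2)])
    fix x assume x: "x \<in> fob U A"
    then have "app (far U p) x \<noteq> y" using y(2) by (metis imageI)
    then show "app s (app (far U p) x) = app s' (app (far U p) x)"
      by (rule agree[OF setcat_homD(3)[OF far_Fun[OF P(1)] x]])
  qed
  have comm: "far U p \<star> far U d = far U q \<star> far U e"
    by (rule far_eqD[OF P(3) d(2) P(1) e(2) P(2)])
  have assoc: "s'' \<star> far U p \<star> far U d = s'' \<star> far U q \<star> far U e"
    if s'': "s'' \<in> Fun (fob U (Cod C p)) (fob U Q)" for s''
    using S.cmp_assoc[OF far_Fun[OF d(2)] far_Fun[OF P(1)] s''] S.cmp_assoc[OF far_Fun[OF e(2)] far_Fun[OF P(2)] s''] comm by simp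
  have "s \<star> far U q \<star> far U e = s' \<star> far U q \<star> far U e" using assoc s(1,2) eqp
    by metis
  then have eqq: "s \<star> far U q = s' \<star> far U q"
    by (rule comp_E_inj[OF e S.cmp_hom[OF far_Fun[OF P(2)] s(1)] S.cmp_hom[OF far_Fun[OF P(2)] s(2)]])
  obtain r where "\<And>r'. r' \<in> Fun (fob U (Cod C p)) (fob U Q) \<Longrightarrow>
    r' \<star> far U p = s \<star> far U p \<Longrightarrow>
      r' \<star> far U q = s \<star> far U q \<Longrightarrow> r' = r"
    by (rule pushout_fun[OF po d(2) e(2) fob_Ob[OF QQ_ob[OF Q]] S.cmp_hom[OF far_Fun[OF P(1)] s(1)] S.cmp_hom[OF far_Fun[OF P(2)] s(1)] assoc[OF s(1)]]) blast
  then have "s = s'" using s(1,2) eqp eqq by metis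
  then show False using s(3) by simp
qed

lemma Tm_pushout_kernel:
  assumes po: "is_pushout C d e p q" and d: "d \<in> E" "d \<in> Hom X A"
    and e: "e \<in> E" "e \<in> Hom X B"
    and kA: "\<And>l l'. l \<in> TT X \<Longrightarrow> l' \<in> TT X \<Longrightarrow>
      Tm d l = Tm d l' \<Longrightarrow> k l = k l'"
    and kB: "\<And>l l'. l \<in> TT X \<Longrightarrow> l' \<in> TT X \<Longrightarrow>
      Tm e l = Tm e l' \<Longrightarrow> k l = k l'"
    and l: "l \<in> TT X" "l' \<in> TT X" "Tm (p \<odot> d) l = Tm (p \<odot> d) l'"
  shows "k l = k l'"
proof (rule Tm_kernel_join[OF d e(2) pushout_HomD(1)[OF po d(2) e(2)]])
  fix Q s t assume Q: "Q \<in> QQ"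
  show "\<exists>r\<in>Fun (fob U (Cod C p)) (fob U Q). r \<star> far U p = s \<and> r \<star> far U q = t"
    if "s \<in> Fun (fob U A) (fob U Q)" "t \<in> Fun (fob U B) (fob U Q)" "s \<star> far U d = t \<star> far U e"
    by (rule pushout_fun[OF po d(2) e(2) fob_Ob[OF QQ_ob[OF Q]] that]) blast
  show "\<exists>r\<in>mor (Cod C p) Q. r \<star> far U p = s \<and> r \<star> far U q = t"
    if "s \<in> mor A Q" "t \<in> mor B Q" "s \<star> far U d = t \<star> far U e"
    by (rule pushout_mor[OF po d(2) e(2) that]) blast
qed (fact kA kB l)+

lemma pushout_exists:
  assumes d: "d \<in> E" "d \<in> Hom X A" and e: "e \<in> E" "e \<in> Hom X B"
  obtains p q where "is_pushout C d e p q"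
proof -
  define K where "K = {(x, x'). x \<in> fob U X \<and> x' \<in> fob U X \<and>
    (app (far U d) x = app (far U d) x' \<or> app (far U e) x = app (far U e) x')}"
  \<comment> \<open>\<open>rep\<close> selects one point from each class of the equivalence relation
    generated by both kernels, so the quotient set can be taken inside \<open>fob U X\<close>, hence
    inside \<open>V\<close>.\<close>
  define rep where "rep x = (SOME x'. (x, x') \<in> K\<^sup>*)" for x
  define S where "S = rep ` fob U X"
  have "sym (K\<^sup>*)" by (rule sym_rtrancl) (auto simp: K_def sym_def)
  then have symK: "(x, x') \<in> K\<^sup>* \<Longrightarrow> (x', x) \<in> K\<^sup>*" for x x'
    by (auto dest: symD)
  have rep: "(x, rep x) \<in> K\<^sup>*" for x
    unfolding rep_def by (rule someI[of _ x]) simp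
  have rep_eq: "rep x = rep x'" if "(x, x') \<in> K\<^sup>*" for x x'
  proof -
    have "(x, y) \<in> K\<^sup>* \<longleftrightarrow> (x', y) \<in> K\<^sup>*" for y
      using that symK by (meson rtrancl_trans)
    then show ?thesis by (simp add: rep_def)
  qed
  have KX: "x' \<in> fob U X" if "(x, x') \<in> K\<^sup>*" "x \<in> fob U X" for x x'
    using that by (induction rule: rtrancl_induct) (auto simp: K_def)
  have SX: "S \<subseteq> fob U X" using KX rep by (auto simp: S_def)
  have SO: "S \<in> Ob (setcat V)" using fob_Ob[OF HomD(4)[OF d(2)]] SX small_subset by auto
  have factor: "\<exists>f. f \<in> Fun (fob U Y) S \<and> (\<forall>x\<in>fob U X. app f (app (far U c) x) = rep x)"
    if c: "c \<in> E" "c \<in> Hom X Y"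
      and cK: "\<And>x x'. x \<in> fob U X \<Longrightarrow> x' \<in> fob U X \<Longrightarrow>
        app (far U c) x = app (far U c) x' \<Longrightarrow> (x, x') \<in> K" for c Y
  proof (intro exI conjI ballI)
    let ?i = "inv_into (fob U X) (app (far U c))"
    let ?f = "setfun (fob U Y) S (\<lambda>y. rep (?i y))"
    have onto: "app (far U c) ` fob U X = fob U Y" using c(1) unfolding E_iff[OF c(2)] .
    show "?f \<in> Fun (fob U Y) S"
      by (rule setfun_hom[OF fob_Ob[OF HomD(5)[OF c(2)]] SO]) (simp add: S_def inv_into_into onto)
    fix x assume x: "x \<in> fob U X"
    have y: "app (far U c) x \<in> app (far U c) ` fob U X" using x by blast
    have "(?i (app (far U c) x), x) \<in> K" by (rule cK[OF inv_into_into[OF y] x f_inv_into_f[OF y]])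
    then have "rep (?i (app (far U c) x)) = rep x" by (intro rep_eq) blast
    then show "app ?f (app (far U c) x) = rep x" using y onto by simp
  qed
  obtain f where f: "f \<in> Fun (fob U A) S" "\<And>x. x \<in> fob U X \<Longrightarrow>
    app f (app (far U d) x) = rep x"
    using factor[OF d] by (auto simp: K_def)
  obtain g where g: "g \<in> Fun (fob U B) S" "\<And>x. x \<in> fob U X \<Longrightarrow>
    app g (app (far U e) x) = rep x"
    using factor[OF e] by (auto simp: K_def)
  \<comment> \<open>The initial lift of all functions that are admissible on \<open>A\<close> and \<open>B\<close> is the final structure.\<close>
  define \<Sigma> where "\<Sigma> = {(Z, s). Z \<in> Ob C \<and> s \<in> Fun S (fob U Z) \<and> s \<star> f \<in> mor A Z \<and> s \<star> g \<in> mor B Z}"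
  obtain D where D: "D \<in> Ob C" "fob U D = S"
    and D\<Sigma>: "\<And>Z s. (Z, s) \<in> \<Sigma> \<Longrightarrow> s \<in> mor D Z"
    and Dinit: "\<And>Z h. Z \<in> Ob C \<Longrightarrow> h \<in> Fun (fob U Z) S \<Longrightarrow>
      (\<And>X s. (X, s) \<in> \<Sigma> \<Longrightarrow> s \<star> h \<in> mor Z X) \<Longrightarrow>
        h \<in> mor Z D"
    by (rule lift[OF SO, of \<Sigma>]) (auto simp: \<Sigma>_def)
  have "f \<in> mor A D" by (rule Dinit[OF HomD(5)[OF d(2)] f(1)]) (auto simp: \<Sigma>_def)
  then obtain p where p: "p \<in> Hom A D" "far U p = f" by (rule morE)
  have "g \<in> mor B D" by (rule Dinit[OF HomD(5)[OF e(2)] g(1)]) (auto simp: \<Sigma>_def)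
  then obtain q where q: "q \<in> Hom B D" "far U q = g" by (rule morE)
  note Fd = far_Fun[OF d(2)] and Fe = far_Fun[OF e(2)]
  have "f \<star> far U d = g \<star> far U e"
    by (rule setfun_eqI[OF S.cmp_hom[OF Fd f(1)] S.cmp_hom[OF Fe g(1)]])
      (simp add: setcat_homD(1)[OF Fd] setcat_homD(1)[OF Fe] f(2) g(2))
  then have comm: "p \<odot> d = q \<odot> e"
    by (intro far_eqI[OF _ d(2) p(1) e(2) q(1)]) (simp only: p q)
  have "app f ` fob U A = S"
  proof
    show "app f ` fob U A \<subseteq> S" by (rule setcat_homD(4)[OF f(1)])
    show "S \<subseteq> app f ` fob U A"
    proof
      fix y assume "y \<in> S"
      then obtain x where "x \<in> fob U X" "y = rep x" by (auto simp: S_def)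
      then show "y \<in> app f ` fob U A" using f(2) setcat_homD(3)[OF Fd] by (metis imageI)
    qed
  qed
  then have pE: "p \<in> E" unfolding E_iff[OF p(1)] p D .
  have univ: "\<exists>!h. h \<in> Hom D Z \<and> h \<odot> p = u \<and> h \<odot> q = v"
    if u: "u \<in> Hom A Z" and v: "v \<in> Hom B Z" and uv: "u \<odot> d = v \<odot> e" for Z u v
  proof -
    note Fu = far_Fun[OF u] and Fv = far_Fun[OF v]
    have uv': "app (far U u) (app (far U d) x) = app (far U v) (app (far U e) x)" if x: "x \<in> fob U X"
      for x
      by (rule scomp_eqD[OF far_eqD[OF uv d(2) u e(2) v]]) (simp_all add: setcat_homD(1)[OF Fd] setcat_homD(1)[OF Fe] x)
    \<comment> \<open>A step of a chain in \<open>K\<close> is an identification by \<open>d\<close>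
      or by \<open>e\<close>; in the second case the value is preserved because \<open>u\<close>
      after \<open>d\<close> equals \<open>v\<close> after \<open>e\<close>.\<close>
    have const: "app (far U u) (app (far U d) x) = app (far U u) (app (far U d) x')"
      if "(x, x') \<in> K\<^sup>*" for x x'
      using that
    proof (induction rule: rtrancl_induct)
      case (step y z)
      have yz: "y \<in> fob U X" "z \<in> fob U X"
        "app (far U d) y = app (far U d) z \<or> app (far U e) y = app (far U e) z"
        using step(2) by (auto simp: K_def)
      then have "app (far U u) (app (far U d) y) = app (far U u) (app (far U d) z)"
        using uv'[OF yz(1)] uv'[OF yz(2)] by metis
      then show ?case using step.IH by simp
    qed simp
    let ?h = "setfun S (fob U Z) (\<lambda>x. app (far U u) (app (far U d) x))"
    have h: "?h \<in> Fun S (fob U Z)"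
      using SX setcat_homD(3)[OF Fu] setcat_homD(3)[OF Fd]
      by (intro setfun_hom[OF SO fob_Ob[OF HomD(5)[OF u]]]) blast
    have hrep: "app ?h (rep x) = app (far U u) (app (far U d) x)" if "x \<in> fob U X" for x
      using that const[OF rep[of x]] by (simp add: S_def)
    have hf: "?h \<star> f = far U u"
    proof (rule setfun_eqI[OF S.cmp_hom[OF f(1) h] Fu])
      fix y assume y: "y \<in> fob U A"
      then have "y \<in> app (far U d) ` fob U X" using d(1) unfolding E_iff[OF d(2)] by simp
      then obtain x where x: "y = app (far U d) x" "x \<in> fob U X" by (rule imageE)
      have "app (?h \<star> f) y = app ?h (app f y)"
        by (rule setcat_cmp(3)) (simp add: setcat_homD(1)[OF f(1)] y)
      then show "app (?h \<star> f) y = app (far U u) y" unfolding x(1) f(2)[OF x(2)] hrep[OF x(2)] .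
    qed
    have hg: "?h \<star> g = far U v"
    proof (rule setfun_eqI[OF S.cmp_hom[OF g(1) h] Fv])
      fix y assume y: "y \<in> fob U B"
      then have "y \<in> app (far U e) ` fob U X" using e(1) unfolding E_iff[OF e(2)] by simp
      then obtain x where x: "y = app (far U e) x" "x \<in> fob U X" by (rule imageE)
      have "app (?h \<star> g) y = app ?h (app g y)"
        by (rule setcat_cmp(3)) (simp add: setcat_homD(1)[OF g(1)] y)
      then show "app (?h \<star> g) y = app (far U v) y"
        unfolding x(1) g(2)[OF x(2)] hrep[OF x(2)] uv'[OF x(2)] .
    qed
    have "?h \<in> mor D Z"
      by (rule D\<Sigma>) (simp add: \<Sigma>_def HomD(5)[OF u] h hf hg morI[OF u] morI[OF v])
    then obtain k where k: "k \<in> Hom D Z" "far U k = ?h" by (rule morE)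
    have "k \<odot> p = u"
      by (rule far_inj[OF cmp_hom[OF p(1) k(1)] u]) (simp only: far_cmp[OF p(1) k(1)] k p hf)
    moreover have "k \<odot> q = v"
      by (rule far_inj[OF cmp_hom[OF q(1) k(1)] v]) (simp only: far_cmp[OF q(1) k(1)] k q hg)
    moreover have "k' = k" if "k' \<in> Hom D Z" "k' \<odot> p = u" for k'
      by (rule E_cancel[OF pE p(1) that(1) k(1)]) (simp only: that \<open>k \<odot> p = u\<close>)
    ultimately show ?thesis using k(1) by blast
  qed
  have "is_pushout C d e p q"
    unfolding is_pushout_def
      using HomD(1-3)[OF d(2)] HomD(1-3)[OF e(2)] HomD(1-3)[OF p(1)] HomD(1-3)[OF q(1)] comm univ
    by simp
  then show thesis by (rule that)
qed

end

section \<open>The functor to sets of the universe\<close>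

context cogenerated
begin

lemma small_Fun: "A \<in> Ob (setcat V) \<Longrightarrow> B \<in> Ob (setcat V) \<Longrightarrow>
  small V (Fun A B)"
proof -
  assume A: "A \<in> Ob (setcat V)" and B: "B \<in> Ob (setcat V)"
  let ?gr = "\<lambda>f. (\<lambda>x. (x, app f x)) ` A"
  have "inj_on ?gr (Fun A B)"
  proof (rule inj_onI)
    fix f g assume f: "f \<in> Fun A B" "g \<in> Fun A B" and eq: "?gr f = ?gr g"
    show "f = g"
    proof (rule setfun_eqI[OF f])
      fix x assume "x \<in> A"
      then have "(x, app f x) \<in> ?gr g" using eq by blast
      then show "app f x = app g x" by blast
    qed
  qed
  moreover have "?gr ` Fun A B \<subseteq> Pow (A \<times> B)" using setcat_homD(3) by fast
  ultimately have "Fun A B \<lesssim> Pow (A \<times> B)" unfolding lepoll_def by blast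
  moreover have "small V (Pow (A \<times> B))" using A B by (intro small_Pow small_Sigma univ) auto
  ultimately show ?thesis by (rule small_lepoll[rotated])
qed

lemma small_TT: "X \<in> Ob C \<Longrightarrow> small V (TT X)"
proof -
  assume X: "X \<in> Ob C"
  have "small V (SS X)"
    unfolding SS_def by (rule small_Sigma[OF univ QQ_small small_Fun[OF fob_Ob[OF X] fob_Ob[OF QQ_ob]]])
  then have "small V (lists (Pow (SS X)))" by (intro small_lists small_Pow univ)
  then show ?thesis by (rule small_subset) (auto simp: cutlists_def)
qed

text \<open>Sets of the universe have elements of type \<open>'u\<close>, so cut lists are coded by
  a chosen injection into \<open>V\<close>. The choices for different objects are unrelated; arrows
  are conjugated by them.\<close>

definition enc :: "'o \<Rightarrow> ('o \<times> 'u setfun) set list \<Rightarrow> 'u" where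
  "enc X = (SOME g. inj_on g (TT X) \<and> g ` TT X \<subseteq> V)"

lemma enc:
  assumes "X \<in> Ob C"
  shows "inj_on (enc X) (TT X)" "enc X ` TT X \<subseteq> V"
proof -
  have "\<exists>g. inj_on g (TT X) \<and> g ` TT X \<subseteq> V"
    by (rule small_obtain_inj[OF small_TT[OF assms]]) blast
  then have "inj_on (enc X) (TT X) \<and> enc X ` TT X \<subseteq> V" unfolding enc_def
    by (rule someI_ex)
  then show "inj_on (enc X) (TT X)" "enc X ` TT X \<subseteq> V" by blast+
qed

definition GG :: "('o, 'a, 'u set, 'u setfun) ftor" where
  "GG = \<lparr>fob = (\<lambda>X. enc X ` TT X),
     far = (\<lambda>f. setfun (enc (Dom C f) ` TT (Dom C f)) (enc (Cod C f) ` TT (Cod C f))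
       (\<lambda>y. enc (Cod C f) (Tm f (inv_into (TT (Dom C f)) (enc (Dom C f)) y))))\<rparr>"

lemma fob_GG: "fob GG X = enc X ` TT X"
  by (simp add: GG_def)

lemma fob_GG_Ob: "X \<in> Ob C \<Longrightarrow> fob GG X \<in> Ob (setcat V)"
  unfolding fob_GG using enc(2) small_image[OF small_TT] by simp

lemma app_far_GG:
  assumes "f \<in> Hom X Y" "l \<in> TT X"
  shows "app (far GG f) (enc X l) = enc Y (Tm f l)"
  using assms(2) HomD(2)[OF assms(1)] HomD(3)[OF assms(1)] inv_into_f_f[OF enc(1)[OF HomD(4)[OF assms(1)]] assms(2)]
  by (simp add: GG_def)

lemma far_GG_Fun:
  assumes f: "f \<in> Hom X Y"
  shows "far GG f \<in> Fun (fob GG X) (fob GG Y)"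
proof -
  have "far GG f = setfun (fob GG X) (fob GG Y) (\<lambda>y. enc Y (Tm f (inv_into (TT X) (enc X) y)))"
    using HomD(2)[OF f] HomD(3)[OF f] by (simp add: GG_def)
  moreover have "\<dots> \<in> Fun (fob GG X) (fob GG Y)"
  proof (rule setfun_hom[OF fob_GG_Ob[OF HomD(4)[OF f]] fob_GG_Ob[OF HomD(5)[OF f]]])
    fix y assume "y \<in> fob GG X"
    then have "inv_into (TT X) (enc X) y \<in> TT X" unfolding fob_GG by (rule inv_into_into)
    then show "enc Y (Tm f (inv_into (TT X) (enc X) y)) \<in> fob GG Y"
      unfolding fob_GG by (intro imageI Tm_in[OF f])
  qed
  ultimately show ?thesis by simp
qed

lemma app_far_GG_eq_iff:
  assumes f: "f \<in> Hom X Y" and l: "l \<in> TT X" "l' \<in> TT X"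
  shows "app (far GG f) (enc X l) = app (far GG f) (enc X l') \<longleftrightarrow> Tm f l = Tm f l'"
  unfolding app_far_GG[OF f l(1)] app_far_GG[OF f l(2)]
  by (rule inj_on_eq_iff[OF enc(1)[OF HomD(5)[OF f]] Tm_in[OF f l(1)] Tm_in[OF f l(2)]])

lemma far_GG_image: "f \<in> Hom X Y \<Longrightarrow> app (far GG f) ` fob GG X = enc Y ` Tm f ` TT X"
  unfolding fob_GG image_image by (rule image_cong[OF refl app_far_GG])

lemma enc_image_subset_iff:
  assumes "X \<in> Ob C" "A \<subseteq> TT X" "B \<subseteq> TT X"
  shows "enc X ` A \<subseteq> enc X ` B \<longleftrightarrow> A \<subseteq> B"
proof -
  have "enc X l \<in> enc X ` B \<longleftrightarrow> l \<in> B" if "l \<in> A" for l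
    using that assms(2,3) by (intro inj_on_image_mem_iff[OF enc(1)[OF assms(1)]]) auto
  then show ?thesis by (auto simp: image_subset_iff)
qed

lemma Tm_image: "f \<in> Hom X Y \<Longrightarrow> Tm f ` TT X \<subseteq> TT Y"
  using Tm_in by blast

lemma GG_surj_iff:
  assumes f: "f \<in> Hom X Y" shows "app (far GG f) ` fob GG X = fob GG Y \<longleftrightarrow> f \<in> E"
proof -
  have "app (far GG f) ` fob GG X = fob GG Y \<longleftrightarrow> Tm f ` TT X = TT Y"
    unfolding far_GG_image[OF f] unfolding fob_GG
    by (rule inj_on_image_eq_iff[OF enc(1)[OF HomD(5)[OF f]] Tm_image[OF f] subset_refl])
  then show ?thesis using Tm_E_surj[OF _ f] E_if_Tm_surj[OF f] by blast
qed

lemma GG_inj_iff: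
  assumes f: "f \<in> Hom X Y" shows "inj_on (app (far GG f)) (fob GG X) \<longleftrightarrow> f \<in> M"
proof -
  have "inj_on (app (far GG f)) (fob GG X) \<longleftrightarrow> inj_on (Tm f) (TT X)"
    unfolding fob_GG inj_on_def using app_far_GG_eq_iff[OF f] inj_on_eq_iff[OF enc(1)[OF HomD(4)[OF f]]]
      by simp
  then show ?thesis using Tm_M_inj[OF _ f] M_if_Tm_inj[OF f] by blast
qed

lemma far_GG_cmp:
  assumes f: "f \<in> Hom X Y" and g: "g \<in> Hom Y Z"
  shows "far GG (g \<odot> f) = far GG g \<star> far GG f"
proof (rule setfun_eqI[OF far_GG_Fun[OF cmp_hom[OF f g]] S.cmp_hom[OF far_GG_Fun[OF f] far_GG_Fun[OF g]]])
  fix y assume y: "y \<in> fob GG X"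
  then obtain l where l: "l \<in> TT X" "y = enc X l" unfolding fob_GG by blast
  have "app (far GG g \<star> far GG f) y = app (far GG g) (app (far GG f) y)"
    by (rule setcat_cmp(3)) (simp add: y setcat_homD(1)[OF far_GG_Fun[OF f]])
  then show "app (far GG (g \<odot> f)) y = app (far GG g \<star> far GG f) y"
    unfolding l(2) app_far_GG[OF f l(1)] app_far_GG[OF g Tm_in[OF f l(1)]] app_far_GG[OF cmp_hom[OF f g] l(1)]
    by (simp only: Tm_Tm[OF f g])
qed

lemma far_GG_Idt:
  assumes X: "X \<in> Ob C" shows "far GG (Idt C X) = Idt (setcat V) (fob GG X)"
proof (rule setfun_eqI[OF far_GG_Fun[OF idt_hom[OF X]] S.idt_hom[OF fob_GG_Ob[OF X]]])
  fix y assume y: "y \<in> fob GG X"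
  then obtain l where l: "l \<in> TT X" "y = enc X l" unfolding fob_GG by blast
  show "app (far GG (Idt C X)) y = app (Idt (setcat V) (fob GG X)) y"
    using app_far_GG[OF idt_hom[OF X] l(1)] Tm_Idt[OF X l(1)] y unfolding setcat_Idt l(2) by simp
qed

lemma GG_functor: "is_functor C (setcat V) GG"
  unfolding is_functor_def
proof (intro conjI ballI impI)
  show "category C" "category (setcat V)" by unfold_locales
  show "fob GG X \<in> Ob (setcat V)" if "X \<in> Ob C" for X by (rule fob_GG_Ob[OF that])
  show "far GG f \<in> Fun (fob GG (Dom C f)) (fob GG (Cod C f))" if "f \<in> Ar C" for f
    by (rule far_GG_Fun[OF Ar_Hom[OF that]])
  show "far GG (Idt C X) = Idt (setcat V) (fob GG X)" if "X \<in> Ob C" for X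
    by (rule far_GG_Idt[OF that])
  show "far GG (g \<odot> f) = far GG g \<star> far GG f"
    if "f \<in> Ar C" "g \<in> Ar C" "Dom C g = Cod C f" for f g
    using that by (intro far_GG_cmp[of f "Dom C f" "Cod C f" g "Cod C g"]) (simp_all add: homset_def)
qed

lemma GG_surjective_fun: "f \<in> Ar C \<Longrightarrow>
  surjective_fun (far GG f) \<longleftrightarrow> f \<in> E"
  using GG_surj_iff[OF Ar_Hom] setcat_homD(1,2)[OF far_GG_Fun[OF Ar_Hom]]
    by (simp add: surjective_fun_def)

lemma GG_injective_fun: "f \<in> Ar C \<Longrightarrow>
  injective_fun (far GG f) \<longleftrightarrow> f \<in> M"
  using GG_inj_iff[OF Ar_Hom] setcat_homD(1)[OF far_GG_Fun[OF Ar_Hom]] by (simp add: injective_fun_def)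

text \<open>A bijection is both onto and injective, so the arrow lies in \<open>E\<close> and in
  \<open>M\<close>, and \<open>EM_iso\<close> applies.\<close>

lemma GG_conservative: "conservative C (setcat V) GG"
  unfolding conservative_def
proof (intro ballI impI)
  fix f assume f: "f \<in> Ar C" and "is_iso (setcat V) (far GG f)"
  then have "bij_betw (app (far GG f)) (src (far GG f)) (tgt (far GG f))" by (intro setcat_iso_bij)
  then have "surjective_fun (far GG f)" "injective_fun (far GG f)"
    by (auto simp: bij_betw_def surjective_fun_def injective_fun_def)
  then show "is_iso C f" using EM_iso GG_surjective_fun[OF f] GG_injective_fun[OF f] by blast
qed

lemma factor_through_E_GG:
  assumes e: "e \<in> E" "e \<in> Hom X Y" and g: "g \<in> Hom X Z"
    and ker: "\<And>a b. a \<in> fob GG X \<Longrightarrow> b \<in> fob GG X \<Longrightarrow>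
      app (far GG e) a = app (far GG e) b \<Longrightarrow> app (far GG g) a = app (far GG g) b"
  obtains h where "h \<in> Hom Y Z" "h \<odot> e = g"
proof -
  have "Tm g l = Tm g l'" if l: "l \<in> TT X" "l' \<in> TT X" "Tm e l = Tm e l'" for l l'
    using ker[of "enc X l" "enc X l'"] l app_far_GG_eq_iff[OF e(2) l(1,2)] app_far_GG_eq_iff[OF g l(1,2)]
    by (simp add: fob_GG)
  then show thesis using factor_through_E[OF e g] that by blast
qed

lemma factor_through_M_GG:
  assumes m: "m \<in> M" "m \<in> Hom A X" and f: "f \<in> Hom Z X"
    and im: "app (far GG f) ` fob GG Z \<subseteq> app (far GG m) ` fob GG A"
  obtains h where "h \<in> Hom Z A" "m \<odot> h = f"
proof -
  have "Tm f ` TT Z \<subseteq> Tm m ` TT A"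
    using im unfolding far_GG_image[OF f] far_GG_image[OF m(2)]
      enc_image_subset_iff[OF HomD(5)[OF f] Tm_image[OF f] Tm_image[OF m(2)]] .
  then show thesis by (rule factor_through_M_if_Tm[OF m f]) (rule that)
qed

text \<open>The intersection of underlying sets, with the subspace structure, factors through both
  \<open>m\<close> and \<open>n\<close>; this gives one inclusion of images. The other one is
  \<open>Tm_intersection\<close>.\<close>

lemma meet_exists:
  assumes m: "m \<in> M" "m \<in> Hom A X" and n: "n \<in> M" "n \<in> Hom B X"
  obtains W w where "w \<in> M" "w \<in> Hom W X"
    "app (far U w) ` fob U W = app (far U m) ` fob U A \<inter> app (far U n) ` fob U B"
    "app (far GG w) ` fob GG W = app (far GG m) ` fob GG A \<inter> app (far GG n) ` fob GG B"
proof -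
  let ?S = "app (far U m) ` fob U A \<inter> app (far U n) ` fob U B"
  have "?S \<subseteq> fob U X" using setcat_homD(4)[OF far_Fun[OF m(2)]] by blast
  then obtain W w where W: "fob U W = ?S" and w: "w \<in> Hom W X" "w \<in> M"
    and wx: "\<And>x. x \<in> ?S \<Longrightarrow> app (far U w) x = x"
    by (rule subobject[OF HomD(5)[OF m(2)]]) blast
  have Uw: "app (far U w) ` fob U W = ?S" unfolding W using wx by simp
  obtain a where a: "a \<in> Hom W A" "m \<odot> a = w"
    by (rule factor_through_M[OF m w(1)]) (use Uw in auto)
  obtain b where b: "b \<in> Hom W B" "n \<odot> b = w"
    by (rule factor_through_M[OF n w(1)]) (use Uw in auto)
  have "Tm w ` TT W \<subseteq> Tm m ` TT A"
  proof (rule image_subsetI)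
    fix l assume "l \<in> TT W"
    then show "Tm w l \<in> Tm m ` TT A" using Tm_in[OF a(1)] Tm_Tm[OF a(1) m(2)] a(2) by (metis imageI)
  qed
  moreover have "Tm w ` TT W \<subseteq> Tm n ` TT B"
  proof (rule image_subsetI)
    fix l assume "l \<in> TT W"
    then show "Tm w l \<in> Tm n ` TT B" using Tm_in[OF b(1)] Tm_Tm[OF b(1) n(2)] b(2) by (metis imageI)
  qed
  moreover have "Tm m ` TT A \<inter> Tm n ` TT B \<subseteq> Tm w ` TT W"
    by (rule Tm_intersection[OF m n w(2,1)]) (simp add: Uw)
  ultimately have "Tm w ` TT W = Tm m ` TT A \<inter> Tm n ` TT B" by blast
  then have "app (far GG w) ` fob GG W = app (far GG m) ` fob GG A \<inter> app (far GG n) ` fob GG B"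
    unfolding far_GG_image[OF w(1)] far_GG_image[OF m(2)] far_GG_image[OF n(2)]
    using inj_on_image_Int[OF enc(1)[OF HomD(5)[OF m(2)]] Tm_image[OF m(2)] Tm_image[OF n(2)]] by simp
  then show thesis using that[OF w(2,1) Uw] by blast
qed

lemma Tm_pushout_kernel_GG:
  assumes po: "is_pushout C d e p q" and d: "d \<in> E" "d \<in> Hom X A"
    and e: "e \<in> E" "e \<in> Hom X B"
    and kA: "\<And>a b. a \<in> fob GG X \<Longrightarrow> b \<in> fob GG X \<Longrightarrow>
      app (far GG d) a = app (far GG d) b \<Longrightarrow> k a = k b"
    and kB: "\<And>a b. a \<in> fob GG X \<Longrightarrow> b \<in> fob GG X \<Longrightarrow>
      app (far GG e) a = app (far GG e) b \<Longrightarrow> k a = k b"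
    and ab: "a \<in> fob GG X" "b \<in> fob GG X" "app (far GG (p \<odot> d)) a = app (far GG (p \<odot> d)) b"
  shows "k a = k b"
proof -
  have pd: "p \<odot> d \<in> Hom X (Cod C p)"
    by (rule cmp_hom[OF d(2) pushout_HomD(1)[OF po d(2) e(2)]])
  obtain l l' where l: "l \<in> TT X" "l' \<in> TT X" "a = enc X l" "b = enc X l'" using ab(1,2)
    unfolding fob_GG by blast
  have eq: "Tm (p \<odot> d) l = Tm (p \<odot> d) l'" using ab(3)
    unfolding l(3,4) app_far_GG_eq_iff[OF pd l(1,2)] .
  have "k (enc X l) = k (enc X l')"
  proof (rule Tm_pushout_kernel[OF po d e _ _ l(1,2) eq, where k = "\<lambda>l. k (enc X l)"])
    fix m m' assume m: "m \<in> TT X" "m' \<in> TT X"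
    then have em: "enc X m \<in> fob GG X" "enc X m' \<in> fob GG X" by (simp_all add: fob_GG)
    show "k (enc X m) = k (enc X m')" if "Tm d m = Tm d m'"
      by (rule kA[OF em]) (simp only: app_far_GG_eq_iff[OF d(2) m] that)
    show "k (enc X m) = k (enc X m')" if "Tm e m = Tm e m'"
      by (rule kB[OF em]) (simp only: app_far_GG_eq_iff[OF e(2) m] that)
  qed
  then show ?thesis unfolding l(3,4) .
qed

text \<open>The span and \<open>p\<close> lie in \<open>E\<close> and become surjections, so the
  criterion for sets asks only for the join of kernels.\<close>

lemma GG_preserves_pushouts: "preserves_pushouts_of C (setcat V) GG E"
  unfolding preserves_pushouts_of_def
proof (intro ballI allI impI)
  fix d e p q assume E: "d \<in> E" "e \<in> E" and po: "is_pushout C d e p q"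
  define X where "X = Dom C d"
  define A where "A = Cod C d"
  define B where "B = Cod C e"
  have d: "d \<in> Hom X A" and e: "e \<in> Hom X B"
    using po by (auto simp: is_pushout_def homset_def X_def A_def B_def)
  note P = pushout_HomD[OF po d e]
  have pE: "p \<in> E" by (rule pushout_E[OF po E(1) d E(2) e])
  have comm: "far GG p \<star> far GG d = far GG q \<star> far GG e"
    using far_GG_cmp[OF d P(1)] far_GG_cmp[OF e P(2)] P(3) by simp
  have onto: "app (far GG d) ` fob GG X = fob GG A" "app (far GG e) ` fob GG X = fob GG B"
    "app (far GG p) ` fob GG A = fob GG (Cod C p)"
    using E pE unfolding GG_surj_iff[OF d] GG_surj_iff[OF e] GG_surj_iff[OF P(1)] .
  show "is_pushout (setcat V) (far GG d) (far GG e) (far GG p) (far GG q)"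
  proof (rule setcat_is_pushoutI[OF far_GG_Fun[OF d] far_GG_Fun[OF e] far_GG_Fun[OF P(1)] far_GG_Fun[OF P(2)] comm onto])
    fix k :: "'u \<Rightarrow> 'u" and a b
    assume k: "\<And>x x'. x \<in> fob GG X \<Longrightarrow> x' \<in> fob GG X \<Longrightarrow>
      app (far GG d) x = app (far GG d) x' \<Longrightarrow> k x = k x'"
      "\<And>x x'. x \<in> fob GG X \<Longrightarrow> x' \<in> fob GG X \<Longrightarrow>
        app (far GG e) x = app (far GG e) x' \<Longrightarrow> k x = k x'"
      and ab: "a \<in> fob GG X" "b \<in> fob GG X"
        and eq: "app (far GG p) (app (far GG d) a) = app (far GG p) (app (far GG d) b)"
    have cmp: "app (far GG (p \<odot> d)) x = app (far GG p) (app (far GG d) x)" if "x \<in> fob GG X"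
      for x
      unfolding far_GG_cmp[OF d P(1)]
        by (rule setcat_cmp(3)) (simp add: that setcat_homD(1)[OF far_GG_Fun[OF d]])
    show "k a = k b"
      by (rule Tm_pushout_kernel_GG[OF po E(1) d E(2) e _ _ ab]) (use k in \<open>blast+\<close>, simp only: cmp[OF ab(1)] cmp[OF ab(2)] eq)
  qed
qed

text \<open>An arbitrary pullback \<open>P\<close> is compared with the concrete intersection
  \<open>W\<close>, whose image under \<open>GG\<close> is already known. The comparison maps are
  \<open>h\<close> from \<open>W\<close> to \<open>P\<close> and \<open>k\<close> back.\<close>

lemma GG_preserves_pullbacks: "preserves_pullbacks_of C (setcat V) GG M"
  unfolding preserves_pullbacks_of_def
proof (intro ballI allI impI)
  fix m n p q assume MM: "m \<in> M" "n \<in> M" and pb: "is_pullback C m n p q"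
  define X where "X = Cod C m"
  define A where "A = Dom C m"
  define B where "B = Dom C n"
  define P where "P = Dom C p"
  have m: "m \<in> Hom A X" and n: "n \<in> Hom B X" and p: "p \<in> Hom P A" and q: "q \<in> Hom P B"
    and comm: "m \<odot> p = n \<odot> q"
    using pb by (auto simp: is_pullback_def homset_def X_def A_def B_def P_def)
  have univ: "\<exists>!h. h \<in> Hom Z P \<and> p \<odot> h = u \<and> q \<odot> h = v"
    if "u \<in> Hom Z A" "v \<in> Hom Z B" "m \<odot> u = n \<odot> v" for Z u v
    using pb that HomD(4)[OF that(1)] unfolding is_pullback_def A_def B_def P_def by blast
  obtain W w where w: "w \<in> M" "w \<in> Hom W X"
    and Uw: "app (far U w) ` fob U W = app (far U m) ` fob U A \<inter> app (far U n) ` fob U B"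
    and Gw: "app (far GG w) ` fob GG W = app (far GG m) ` fob GG A \<inter> app (far GG n) ` fob GG B"
    by (rule meet_exists[OF MM(1) m MM(2) n])
  obtain a where a: "a \<in> Hom W A" "m \<odot> a = w"
    by (rule factor_through_M[OF MM(1) m w(2)]) (use Uw in auto)
  obtain b where b: "b \<in> Hom W B" "n \<odot> b = w"
    by (rule factor_through_M[OF MM(2) n w(2)]) (use Uw in auto)
  obtain h where h: "h \<in> Hom W P" "p \<odot> h = a" "q \<odot> h = b"
    using univ[OF a(1) b(1)] a(2) b(2) by auto
  have mp: "m \<odot> p \<in> Hom P X" by (rule cmp_hom[OF p m])
  have cmpU: "app (far U (g \<odot> f)) ` fob U Y \<subseteq> app (far U g) ` fob U Y'"
    if f: "f \<in> Hom Y Y'" and g: "g \<in> Hom Y' Z" for f g Y Y' Z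
  proof (rule image_subsetI)
    fix x assume x: "x \<in> fob U Y"
    have "app (far U (g \<odot> f)) x = app (far U g) (app (far U f) x)"
      unfolding far_cmp[OF f g] by (rule setcat_cmp(3)) (simp add: x setcat_homD(1)[OF far_Fun[OF f]])
    then show "app (far U (g \<odot> f)) x \<in> app (far U g) ` fob U Y'"
      using setcat_homD(3)[OF far_Fun[OF f] x] by simp
  qed
  obtain k where k: "k \<in> Hom P W" "w \<odot> k = m \<odot> p"
    by (rule factor_through_M[OF w mp]) (use Uw cmpU[OF p m] cmpU[OF q n] comm in auto)
  have "m \<odot> (a \<odot> k) = m \<odot> p" using cmp_assoc[OF k(1) a(1) m] a(2) k(2) by simp
  then have ak: "a \<odot> k = p" by (rule M_cancel[OF MM(1) m cmp_hom[OF k(1) a(1)] p])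
  have "n \<odot> (b \<odot> k) = n \<odot> q" using cmp_assoc[OF k(1) b(1) n] b(2) k(2) comm by simp
  then have bk: "b \<odot> k = q" by (rule M_cancel[OF MM(2) n cmp_hom[OF k(1) b(1)] q])
  \<comment> \<open>Uniqueness in the universal property makes \<open>h\<close> a left inverse of
    \<open>k\<close>. Together with injectivity of \<open>far GG w\<close> this shows that
    \<open>far GG p\<close> is injective.\<close>
  have hk: "h \<odot> k \<in> Hom P P" by (rule cmp_hom[OF k(1) h(1)])
  have id: "Idt C P \<in> Hom P P" by (rule idt_hom[OF HomD(4)[OF p]])
  have "p \<odot> (h \<odot> k) = p" "q \<odot> (h \<odot> k) = q"
    using cmp_assoc[OF k(1) h(1) p] cmp_assoc[OF k(1) h(1) q] h(2,3) ak bk by simp_all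
  then have hkid: "h \<odot> k = Idt C P"
    using univ[OF p q comm] hk id idt_right[OF p] idt_right[OF q] by blast
  have injm: "inj_on (app (far GG m)) (fob GG A)" "inj_on (app (far GG n)) (fob GG B)"
    using MM unfolding GG_inj_iff[OF m] GG_inj_iff[OF n] .
  have Gcmp: "app (far GG (g \<odot> f)) x = app (far GG g) (app (far GG f) x)"
    if f: "f \<in> Hom Y Y'" and g: "g \<in> Hom Y' Z" and x: "x \<in> fob GG Y" for f g Y Y' Z x
    unfolding far_GG_cmp[OF f g]
      by (rule setcat_cmp(3)) (simp add: x setcat_homD(1)[OF far_GG_Fun[OF f]])
  have injp: "inj_on (app (far GG p)) (fob GG P)"
  proof (rule inj_onI)
    fix x y assume x: "x \<in> fob GG P" and y: "y \<in> fob GG P"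
      and eq: "app (far GG p) x = app (far GG p) y"
    have kx: "app (far GG k) x \<in> fob GG W" "app (far GG k) y \<in> fob GG W"
      using setcat_homD(3)[OF far_GG_Fun[OF k(1)]] x y by blast+
    have "app (far GG w) (app (far GG k) x) = app (far GG w) (app (far GG k) y)"
      using Gcmp[OF k(1) w(2) x] Gcmp[OF k(1) w(2) y] Gcmp[OF p m x] Gcmp[OF p m y] k(2) eq by simp
    moreover have "inj_on (app (far GG w)) (fob GG W)" using w(1) unfolding GG_inj_iff[OF w(2)] .
    ultimately have "app (far GG k) x = app (far GG k) y" using kx by (auto dest: inj_onD)
    then have "app (far GG (Idt C P)) x = app (far GG (Idt C P)) y"
      using Gcmp[OF k(1) h(1) x] Gcmp[OF k(1) h(1) y] hkid by simp
    then show "x = y" using x y unfolding far_GG_Idt[OF HomD(4)[OF p]] setcat_Idt by simp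
  qed
  show "is_pullback (setcat V) (far GG m) (far GG n) (far GG p) (far GG q)"
  proof (rule setcat_is_pullbackI[OF far_GG_Fun[OF m] far_GG_Fun[OF n] far_GG_Fun[OF p] far_GG_Fun[OF q] _ injm injp])
    show "far GG m \<star> far GG p = far GG n \<star> far GG q"
      using far_GG_cmp[OF p m] far_GG_cmp[OF q n] comm by simp
    show "app (far GG m) ` fob GG A \<inter> app (far GG n) ` fob GG B \<subseteq> (\<lambda>x. app (far GG m) (app (far GG p) x)) ` fob GG P"
      unfolding Gw[symmetric]
    proof (rule image_subsetI)
      fix z assume z: "z \<in> fob GG W"
      have "app (far GG w) z = app (far GG m) (app (far GG p) (app (far GG h) z))"
        using Gcmp[OF a(1) m z] Gcmp[OF h(1) p z] a(2) h(2) by simp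
      then show "app (far GG w) z \<in> (\<lambda>x. app (far GG m) (app (far GG p) x)) ` fob GG P"
        using setcat_homD(3)[OF far_GG_Fun[OF h(1)] z] by blast
    qed
  qed
qed

end

section \<open>Lattices of subgroups\<close>

lemma subgroup_lattice_simps [simp]:
  "S \<in> carrier (subgroup_lattice A) \<longleftrightarrow> subgroup S A"
  "S \<sqsubseteq>\<^bsub>subgroup_lattice A\<^esub> T \<longleftrightarrow> S \<subseteq> T"
  by (auto simp: subgroup_lattice_def)

context group
begin

lemma complete_lattice_subgroup_lattice: "complete_lattice (subgroup_lattice G)"
  unfolding subgroup_lattice_def by (rule subgroups_complete_lattice)

lemma bounded_lattice_subgroup_lattice: "bounded_lattice (subgroup_lattice G)"
proof -
  interpret L: complete_lattice "subgroup_lattice G" by (rule complete_lattice_subgroup_lattice)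
  show ?thesis by unfold_locales
qed

lemma sup_subgroup_lattice:
  assumes "\<S> \<subseteq> {S. subgroup S G}"
  shows "subgroup (\<Squnion>\<^bsub>subgroup_lattice G\<^esub>\<S>) G" "S \<in> \<S> \<Longrightarrow>
    S \<subseteq> \<Squnion>\<^bsub>subgroup_lattice G\<^esub>\<S>"
    "\<lbrakk>subgroup T G; \<And>S. S \<in> \<S> \<Longrightarrow>
      S \<subseteq> T\<rbrakk> \<Longrightarrow>
        \<Squnion>\<^bsub>subgroup_lattice G\<^esub>\<S> \<subseteq> T"
proof -
  interpret L: complete_lattice "subgroup_lattice G" by (rule complete_lattice_subgroup_lattice)
  have \<S>: "\<S> \<subseteq> carrier (subgroup_lattice G)" using assms by auto
  show "subgroup (\<Squnion>\<^bsub>subgroup_lattice G\<^esub>\<S>) G" using L.sup_closed[OF \<S>]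
    by simp
  show "S \<in> \<S> \<Longrightarrow> S \<subseteq> \<Squnion>\<^bsub>subgroup_lattice G\<^esub>\<S>"
    using L.sup_upper[OF \<S>] by simp
  show "\<lbrakk>subgroup T G; \<And>S. S \<in> \<S> \<Longrightarrow>
    S \<subseteq> T\<rbrakk> \<Longrightarrow>
      \<Squnion>\<^bsub>subgroup_lattice G\<^esub>\<S> \<subseteq> T"
    using L.sup_least[OF \<S>, of T] by simp
qed

lemma meet_subgroup_lattice:
  assumes "subgroup S G" "subgroup T G"
  shows "S \<sqinter>\<^bsub>subgroup_lattice G\<^esub> T = S \<inter> T"
proof -
  interpret L: complete_lattice "subgroup_lattice G" by (rule complete_lattice_subgroup_lattice)
  have ST: "S \<in> carrier (subgroup_lattice G)" "T \<in> carrier (subgroup_lattice G)" "S \<inter> T \<in> carrier (subgroup_lattice G)"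
    using assms subgroups_Inter_pair by auto
  show ?thesis
    using L.meet_left[OF ST(1,2)] L.meet_right[OF ST(1,2)] L.meet_le[of "S \<inter> T" S T] ST by auto
qed

lemma top_subgroup_lattice: "\<top>\<^bsub>subgroup_lattice G\<^esub> = carrier G"
proof -
  interpret L: bounded_lattice "subgroup_lattice G" by (rule bounded_lattice_subgroup_lattice)
  show ?thesis
    using L.top_eq[of "carrier G"] subgroup_self by (simp add: subgroup.subset)
qed

lemma bottom_subgroup_lattice: "\<bottom>\<^bsub>subgroup_lattice G\<^esub> = {\<one>}"
proof -
  interpret L: bounded_lattice "subgroup_lattice G" by (rule bounded_lattice_subgroup_lattice)
  show ?thesis
    using L.bottom_eq[of "{\<one>}"] triv_subgroup by (simp add: subgroup.one_closed)
qed

text \<open>Joins of finite subfamilies form a directed system, so their union \<open>D\<close> is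
  already a subgroup, and it contains every member of the family.\<close>

lemma in_sup_subgroups_finite:
  assumes \<S>: "\<S> \<subseteq> {S. subgroup S G}"
    and x: "x \<in> \<Squnion>\<^bsub>subgroup_lattice G\<^esub>\<S>"
  obtains \<F> where "\<F> \<subseteq> \<S>" "finite \<F>" "x \<in> \<Squnion>\<^bsub>subgroup_lattice G\<^esub>\<F>"
proof -
  let ?sup = "\<lambda>\<F>. \<Squnion>\<^bsub>subgroup_lattice G\<^esub>\<F>"
  define D where "D = (\<Union>\<F>\<in>{\<F>. \<F> \<subseteq> \<S> \<and> finite \<F>}. ?sup \<F>)"
  have sub: "subgroup (?sup \<F>) G" if "\<F> \<subseteq> \<S>" for \<F>
    using that \<S> by (intro sup_subgroup_lattice(1)) auto
  have mono: "?sup \<F> \<subseteq> ?sup \<F>'" if le: "\<F> \<subseteq> \<F>'" "\<F>' \<subseteq> \<S>"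
    for \<F> \<F>'
  proof (rule sup_subgroup_lattice(3)[OF _ sub[OF le(2)]])
    have \<F>': "\<F>' \<subseteq> {S. subgroup S G}" using le(2) \<S> by (rule subset_trans)
    then show "\<F> \<subseteq> {S. subgroup S G}" using le(1) by (rule subset_trans[rotated])
    show "S \<subseteq> ?sup \<F>'" if "S \<in> \<F>" for S
      by (rule sup_subgroup_lattice(2)[OF \<F>' subsetD[OF le(1) that]])
  qed
  have "subgroup D G"
  proof
    show "D \<subseteq> carrier G" unfolding D_def
      by (rule UN_least) (use subgroup.subset[OF sub] in simp)
    show "\<one> \<in> D" unfolding D_def using subgroup.one_closed[OF sub[OF empty_subsetI]] by blast
    fix a assume "a \<in> D"
    then obtain \<F> where \<F>: "\<F> \<subseteq> \<S>" "finite \<F>" "a \<in> ?sup \<F>"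
      by (auto simp: D_def)
    then show "inv a \<in> D" unfolding D_def using subgroup.m_inv_closed[OF sub[OF \<F>(1)] \<F>(3)]
      by blast
    fix b assume "b \<in> D"
    then obtain \<F>' where \<F>': "\<F>' \<subseteq> \<S>" "finite \<F>'" "b \<in> ?sup \<F>'"
      by (auto simp: D_def)
    have "a \<in> ?sup (\<F> \<union> \<F>')" "b \<in> ?sup (\<F> \<union> \<F>')"
      using mono[of \<F> "\<F> \<union> \<F>'"] mono[of \<F>' "\<F> \<union> \<F>'"] \<F> \<F>' by auto
    then have "a \<otimes> b \<in> ?sup (\<F> \<union> \<F>')"
      by (rule subgroup.m_closed[OF sub[OF Un_least[OF \<F>(1) \<F>'(1)]]])
    then show "a \<otimes> b \<in> D" unfolding D_def
      by (rule UN_I[rotated]) (use \<F>(1,2) \<F>'(1,2) in simp)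
  qed
  moreover have "S \<subseteq> D" if "S \<in> \<S>" for S
  proof -
    have "S \<subseteq> ?sup {S}" by (rule sup_subgroup_lattice(2)) (use that \<S> in auto)
    also have "?sup {S} \<subseteq> D" unfolding D_def by (rule UN_upper) (use that in simp)
    finally show ?thesis .
  qed
  ultimately have "?sup \<S> \<subseteq> D" by (rule sup_subgroup_lattice(3)[OF \<S>])
  then obtain \<F> where "\<F> \<subseteq> \<S>" "finite \<F>" "x \<in> ?sup \<F>" using x
    by (auto simp: D_def)
  then show thesis by (rule that)
qed

text \<open>Containing a cyclic subgroup means containing its generator, and a single element of a
  join lies in a finite join.\<close>

lemma compact_cyclic_subgroup:
  assumes "x \<in> carrier G" shows "compact_element (subgroup_lattice G) (generate G {x})"
  unfolding compact_element_def
proof (intro conjI allI impI)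
  show "generate G {x} \<in> carrier (subgroup_lattice G)" using assms generate_is_subgroup by simp
  fix \<S> assume \<S>: "\<S> \<subseteq> carrier (subgroup_lattice G)"
    and le: "generate G {x} \<sqsubseteq>\<^bsub>subgroup_lattice G\<^esub> \<Squnion>\<^bsub>subgroup_lattice G\<^esub>\<S>"
  have \<S>': "\<S> \<subseteq> {S. subgroup S G}" using \<S> by auto
  have "x \<in> \<Squnion>\<^bsub>subgroup_lattice G\<^esub>\<S>" using le generate.incl[of x "{x}"]
    by auto
  then obtain \<F> where \<F>: "\<F> \<subseteq> \<S>" "finite \<F>" "x \<in> \<Squnion>\<^bsub>subgroup_lattice G\<^esub>\<F>"
    by (rule in_sup_subgroups_finite[OF \<S>']) blast
  have "subgroup (\<Squnion>\<^bsub>subgroup_lattice G\<^esub>\<F>) G" using \<F>(1) \<S>'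
    by (intro sup_subgroup_lattice(1)) auto
  then have "generate G {x} \<subseteq> \<Squnion>\<^bsub>subgroup_lattice G\<^esub>\<F>" using \<F>(3)
    by (intro generate_subgroup_incl) auto
  then show "\<exists>B\<subseteq>\<S>. finite B \<and> generate G {x} \<sqsubseteq>\<^bsub>subgroup_lattice G\<^esub> \<Squnion>\<^bsub>subgroup_lattice G\<^esub>B"
    using \<F> by auto
qed

lemma algebraic_lattice_subgroup_lattice: "algebraic_lattice (subgroup_lattice G)"
  unfolding algebraic_lattice_def
proof (intro conjI ballI complete_lattice_subgroup_lattice)
  fix S assume "S \<in> carrier (subgroup_lattice G)"
  then have S: "subgroup S G" by simp
  let ?K = "(\<lambda>x. generate G {x}) ` S"
  have x: "x \<in> carrier G" if "x \<in> S" for x using that subgroup.subset[OF S] by auto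
  have K: "?K \<subseteq> {S. subgroup S G}" using x generate_is_subgroup by auto
  have "S \<subseteq> \<Squnion>\<^bsub>subgroup_lattice G\<^esub>?K"
  proof
    fix a assume a: "a \<in> S"
    then have "generate G {a} \<subseteq> \<Squnion>\<^bsub>subgroup_lattice G\<^esub>?K"
      by (intro sup_subgroup_lattice(2)[OF K]) auto
    then show "a \<in> \<Squnion>\<^bsub>subgroup_lattice G\<^esub>?K" using generate.incl[of a "{a}"]
      by auto
  qed
  moreover have "\<Squnion>\<^bsub>subgroup_lattice G\<^esub>?K \<subseteq> S"
    using generate_subgroup_incl[OF _ S] by (intro sup_subgroup_lattice(3)[OF K S]) blast
  ultimately have "S = \<Squnion>\<^bsub>subgroup_lattice G\<^esub>?K" by (rule subset_antisym)
  moreover have "\<forall>k\<in>?K. compact_element (subgroup_lattice G) k"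
    using x compact_cyclic_subgroup by auto
  ultimately show "\<exists>K. (\<forall>k\<in>K. compact_element (subgroup_lattice G) k) \<and> S = \<Squnion>\<^bsub>subgroup_lattice G\<^esub>K"
    by blast
qed

end

context comm_group
begin

text \<open>Commutativity makes the product set of two subgroups a subgroup, hence the least one
  above both.\<close>

lemma join_subgroup_lattice:
  assumes S: "subgroup S G" and T: "subgroup T G"
  shows "S \<squnion>\<^bsub>subgroup_lattice G\<^esub> T = S <#> T"
  unfolding join_def
proof
  have ST: "{S, T} \<subseteq> {S. subgroup S G}" using S T by auto
  have "S \<subseteq> S <#> T" "T \<subseteq> S <#> T"
    using subgroup.one_closed[OF S] subgroup.one_closed[OF T] subgroup.subset[OF S] subgroup.subset[OF T]
    by (force simp: set_mult_def)+
  then show "\<Squnion>\<^bsub>subgroup_lattice G\<^esub>{S, T} \<subseteq> S <#> T"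
    by (intro sup_subgroup_lattice(3)[OF ST mult_subgroups[OF S T]]) auto
  have "S \<subseteq> \<Squnion>\<^bsub>subgroup_lattice G\<^esub>{S, T}" "T \<subseteq> \<Squnion>\<^bsub>subgroup_lattice G\<^esub>{S, T}"
    using sup_subgroup_lattice(2)[OF ST] by auto
  then show "S <#> T \<subseteq> \<Squnion>\<^bsub>subgroup_lattice G\<^esub>{S, T}"
    using subgroup.m_closed[OF sup_subgroup_lattice(1)[OF ST]] by (auto simp: set_mult_def)
qed

lemma modular_lattice_subgroup_lattice: "modular_lattice (subgroup_lattice G)"
  unfolding modular_lattice_def
proof (intro conjI ballI impI)
  show "lattice (subgroup_lattice G)" using complete_lattice_subgroup_lattice by simp
  fix S T R assume "S \<in> carrier (subgroup_lattice G)" "T \<in> carrier (subgroup_lattice G)"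
    "R \<in> carrier (subgroup_lattice G)" "S \<sqsubseteq>\<^bsub>subgroup_lattice G\<^esub> R"
  then have S: "subgroup S G" and T: "subgroup T G" and R: "subgroup R G" and SR: "S \<subseteq> R"
    by auto
  have TR: "subgroup (T \<inter> R) G" using T R subgroups_Inter_pair by blast
  have "S <#> (T \<inter> R) = (S <#> T) \<inter> R"
  proof
    show "S <#> (T \<inter> R) \<subseteq> (S <#> T) \<inter> R"
      using SR subgroup.m_closed[OF R] by (auto simp: set_mult_def)
    show "(S <#> T) \<inter> R \<subseteq> S <#> (T \<inter> R)"
    proof
      fix x assume "x \<in> (S <#> T) \<inter> R"
      then obtain s t where st: "s \<in> S" "t \<in> T" "x = s \<otimes> t" "x \<in> R"
        by (auto simp: set_mult_def)
      have c: "s \<in> carrier G" "t \<in> carrier G"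
        using st subgroup.subset[OF S] subgroup.subset[OF T] by auto
      \<comment> \<open>The inclusion \<open>S \<subseteq> R\<close> enters here: it forces the
        factor from \<open>T\<close> into \<open>R\<close>.\<close>
      have "inv s \<otimes> x \<in> R" using st SR subgroup.m_inv_closed[OF R] subgroup.m_closed[OF R]
        by blast
      moreover have "inv s \<otimes> x = t" using c st(3) by (simp add: m_assoc[symmetric])
      ultimately show "x \<in> S <#> (T \<inter> R)" using st by (auto simp: set_mult_def)
    qed
  qed
  then show "S \<squnion>\<^bsub>subgroup_lattice G\<^esub> (T \<sqinter>\<^bsub>subgroup_lattice G\<^esub> R) =
      (S \<squnion>\<^bsub>subgroup_lattice G\<^esub> T) \<sqinter>\<^bsub>subgroup_lattice G\<^esub> R"
    by (simp add: meet_subgroup_lattice join_subgroup_lattice mult_subgroups S T R TR)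
qed

end

section \<open>Linear extensions\<close>

lemma subgroup_diff_closed:
  assumes "subgroup N (free_Abelian_group A)" "a \<in> N" "b \<in> N"
  shows "a - b \<in> N"
proof -
  have "b \<in> carrier (free_Abelian_group A)" using subgroup.subset[OF assms(1)] assms(3) by blast
  then have "- b \<in> N" using subgroup.m_inv_closed[OF assms(1,3)] by simp
  then show ?thesis using subgroup.m_closed[OF assms(1,2)] by fastforce
qed

lemma free_ab_map_simps [simp]:
  "free_ab_map g 0 = 0" "free_ab_map g (frag_of x) = frag_of (app g x)"
  "free_ab_map g (a + b) = free_ab_map g a + free_ab_map g b"
  "free_ab_map g (a - b) = free_ab_map g a - free_ab_map g b"
  by (simp_all add: free_ab_map_def frag_extend_add frag_extend_diff)

lemma keys_free_ab_map: "Poly_Mapping.keys (free_ab_map g a) \<subseteq> app g ` Poly_Mapping.keys a"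
  using keys_frag_extend[of "\<lambda>x. frag_of (app g x)" a] by (auto simp: free_ab_map_def)

lemma free_ab_map_closed:
  assumes "g \<in> homset (setcat V) A B" "Poly_Mapping.keys a \<subseteq> A"
  shows "Poly_Mapping.keys (free_ab_map g a) \<subseteq> B"
  using keys_free_ab_map[of g a] setcat_homD(4)[OF assms(1)] assms(2) by blast

lemma free_ab_map_compose:
  assumes "g \<in> homset (setcat V) A B" "Poly_Mapping.keys a \<subseteq> A"
  shows "free_ab_map (h \<odot>\<^bsub>setcat V\<^esub> g) a = free_ab_map h (free_ab_map g a)"
  using assms(2)
  by (induction a rule: frag_induction) (simp_all add: setcat_homD(1)[OF assms(1)])

lemma free_ab_map_Idt:
  assumes "Poly_Mapping.keys a \<subseteq> A" shows "free_ab_map (Idt (setcat V) A) a = a"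
  using assms by (induction a rule: frag_induction) (simp_all add: setcat_Idt)

lemma free_ab_map_hom:
  assumes "g \<in> homset (setcat V) A B"
  shows "group_hom (free_Abelian_group A) (free_Abelian_group B) (free_ab_map g)"
  using free_ab_map_closed[OF assms]
  by (intro group_hom.intro group_hom_axioms.intro group_free_Abelian_group) (auto simp: hom_def)

text \<open>Choosing a section of \<open>g\<close>, every \<open>a\<close> is congruent modulo differences of points with the same
  image to an element that depends on the image of \<open>a\<close> only.\<close>

lemma free_ab_map_kernel:
  assumes N: "subgroup N (free_Abelian_group A)"
    and diff: "\<And>x y. x \<in> A \<Longrightarrow> y \<in> A \<Longrightarrow>
      app g x = app g y \<Longrightarrow> frag_of x - frag_of y \<in> N"
    and a: "Poly_Mapping.keys a \<subseteq> A" "free_ab_map g a = 0"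
  shows "a \<in> N"
proof -
  let ?\<sigma> = "frag_extend (\<lambda>y. frag_of (inv_into A (app g) y))"
  have "b - ?\<sigma> (free_ab_map g b) \<in> N" if "Poly_Mapping.keys b \<subseteq> A" for b
    using that
  proof (induction b rule: frag_induction)
    case zero
    show ?case using subgroup.one_closed[OF N] by simp
  next
    case (diff x y)
    have eq: "x - y - ?\<sigma> (free_ab_map g (x - y)) = (x - ?\<sigma> (free_ab_map g x)) - (y - ?\<sigma> (free_ab_map g y))"
      by (simp add: frag_extend_diff)
    show ?case unfolding eq by (rule subgroup_diff_closed[OF N diff])
  next
    case (one x)
    then have "app g x \<in> app g ` A" by blast
    then show ?case using one diff by (simp add: inv_into_into f_inv_into_f)
  qed
  from this[OF a(1)] show ?thesis by (simp add: a(2))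
qed

text \<open>For an injection the generating differences vanish, so the kernel lies in the trivial
  subgroup.\<close>

lemma free_ab_map_inj:
  assumes "inj_on (app g) A" "Poly_Mapping.keys a \<subseteq> A" "free_ab_map g a = 0"
  shows "a = 0"
proof -
  have "a \<in> {0}"
  proof (rule free_ab_map_kernel[OF _ _ assms(2,3)])
    show "subgroup {0} (free_Abelian_group A)"
      using group.triv_subgroup[OF group_free_Abelian_group[of A]] by simp
  qed (use assms(1) in \<open>auto dest: inj_onD\<close>)
  then show ?thesis by simp
qed

lemma free_ab_map_image:
  "free_ab_map g ` carrier (free_Abelian_group A) = carrier (free_Abelian_group (app g ` A))"
proof
  show "free_ab_map g ` carrier (free_Abelian_group A) \<subseteq> carrier (free_Abelian_group (app g ` A))"
    using keys_free_ab_map[of g] by fastforce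
  show "carrier (free_Abelian_group (app g ` A)) \<subseteq> free_ab_map g ` carrier (free_Abelian_group A)"
  proof
    fix c assume "c \<in> carrier (free_Abelian_group (app g ` A))"
    then have "Poly_Mapping.keys c \<subseteq> app g ` A" by simp
    then show "c \<in> free_ab_map g ` carrier (free_Abelian_group A)"
    proof (induction c rule: frag_induction)
      case zero
      show ?case by (rule image_eqI[of _ _ 0]) simp_all
    next
      case (diff x y)
      then obtain x' y' where "x = free_ab_map g x'" "y = free_ab_map g y'"
        "Poly_Mapping.keys x' \<subseteq> A" "Poly_Mapping.keys y' \<subseteq> A" by auto
      then show ?case using keys_diff[of x' y'] by (intro image_eqI[of _ _ "x' - y'"]) auto
    next
      case (one y)
      then obtain x where "x \<in> A" "y = app g x" by blast
      then show ?case by (intro image_eqI[of _ _ "frag_of x"]) simp_all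
    qed
  qed
qed

section \<open>The subgroup form of a functor to sets\<close>

text \<open>In \<open>join_E\<close> the values of \<open>k\<close> have a fixed type because locale assumptions are monomorphic; \<open>k\<close> will be
  the map sending a point to its coset modulo the join of two kernels.\<close>

locale subgroup_form_functor = category C
  for C :: "('o, 'a) cat" (structure) +
  fixes V :: "'u set" and G :: "('o, 'a, 'u set, 'u setfun) ftor" and E M :: "'a set"
  assumes univ: "universe V" and functor_G: "is_functor C (setcat V) G"
    and pfs: "proper_factorization_system C E M"
    and surj_iff: "f \<in> Ar C \<Longrightarrow>
      surjective_fun (far G f) \<longleftrightarrow> f \<in> E"
    and inj_iff: "f \<in> Ar C \<Longrightarrow> injective_fun (far G f) \<longleftrightarrow> f \<in> M"
    and factor_E: "\<lbrakk>e \<in> E; g \<in> Ar C; Dom C g = Dom C e;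
      \<And>x y. x \<in> fob G (Dom C e) \<Longrightarrow> y \<in> fob G (Dom C e) \<Longrightarrow>
        app (far G e) x = app (far G e) y \<Longrightarrow>
          app (far G g) x = app (far G g) y\<rbrakk> \<Longrightarrow>
      \<exists>h \<in> homset C (Cod C e) (Cod C g). h \<odot> e = g"
    and factor_M: "\<lbrakk>m \<in> M; f \<in> Ar C; Cod C f = Cod C m;
      app (far G f) ` fob G (Dom C f) \<subseteq> app (far G m) ` fob G (Dom C m)\<rbrakk> \<Longrightarrow>
      \<exists>h \<in> homset C (Dom C f) (Dom C m). m \<odot> h = f"
    and join_E: "\<lbrakk>d \<in> E; e \<in> E; Dom C d = Dom C e\<rbrakk> \<Longrightarrow>
      \<exists>f\<in>Ar C. Dom C f = Dom C d \<and>
      (\<forall>x\<in>fob G (Dom C d). \<forall>y\<in>fob G (Dom C d).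
        app (far G d) x = app (far G d) y \<or> app (far G e) x = app (far G e) y \<longrightarrow> app (far G f) x = app (far G f) y) \<and>
      (\<forall>k :: 'u \<Rightarrow> ('u \<Rightarrow>\<^sub>0 int) set. (\<forall>x\<in>fob G (Dom C d). \<forall>y\<in>fob G (Dom C d).
          app (far G d) x = app (far G d) y \<or> app (far G e) x = app (far G e) y \<longrightarrow> k x = k y) \<longrightarrow>
        (\<forall>x\<in>fob G (Dom C d). \<forall>y\<in>fob G (Dom C d). app (far G f) x = app (far G f) y \<longrightarrow> k x = k y))"
    and meet_M: "\<lbrakk>m \<in> M; n \<in> M; Cod C m = Cod C n\<rbrakk> \<Longrightarrow>
      \<exists>w\<in>Ar C. Cod C w = Cod C m \<and>
      app (far G w) ` fob G (Dom C w) = app (far G m) ` fob G (Dom C m) \<inter> app (far G n) ` fob G (Dom C n)"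
begin

abbreviation Hom where "Hom X Y \<equiv> homset C X Y"
abbreviation FA where "FA X \<equiv> free_Abelian_group (fob G X)"
abbreviation H where "H f \<equiv> free_ab_map (far G f)"
abbreviation L where "L X \<equiv> subgroup_lattice (FA X)"
abbreviation N where "N \<equiv> subgroup_form C FA (\<lambda>f. H f)"

lemma N_simps [simp]:
  "fibre N X = L X" "push N f S = H f ` S"
  "pull N f T = {x \<in> carrier (FA (Dom C f)). H f x \<in> T}"
  by (simp_all add: subgroup_form_def)

lemma HomD: "f \<in> Hom X Y \<Longrightarrow> f \<in> Ar C" "f \<in> Hom X Y \<Longrightarrow>
  Dom C f = X" "f \<in> Hom X Y \<Longrightarrow> Cod C f = Y"
  "f \<in> Hom X Y \<Longrightarrow> X \<in> Ob C" "f \<in> Hom X Y \<Longrightarrow> Y \<in> Ob C"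
  using dom_ob cod_ob by (auto simp: homset_def)

lemma Ar_Hom: "f \<in> Ar C \<Longrightarrow> f \<in> Hom (Dom C f) (Cod C f)"
  by (simp add: homset_def)

lemma G_hom: "f \<in> Hom X Y \<Longrightarrow> far G f \<in> homset (setcat V) (fob G X) (fob G Y)"
  using functor_G HomD(1-3)[of f X Y] unfolding is_functor_def by blast

lemma G_cmp: "f \<in> Hom X Y \<Longrightarrow> g \<in> Hom Y Z \<Longrightarrow>
  far G (g \<odot> f) = far G g \<odot>\<^bsub>setcat V\<^esub> far G f"
  using functor_G HomD(1-3)[of f X Y] HomD(1-3)[of g Y Z] unfolding is_functor_def by simp

lemma G_Idt: "X \<in> Ob C \<Longrightarrow> far G (Idt C X) = Idt (setcat V) (fob G X)"
  using functor_G unfolding is_functor_def by blast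

lemma G_small: "X \<in> Ob C \<Longrightarrow> small V (fob G X)"
  using functor_G unfolding is_functor_def by auto

lemma group_FA: "group (FA X)" and comm_group_FA: "comm_group (FA X)"
  by (simp_all add: abelian_free_Abelian_group)

lemma H_closed: "f \<in> Hom X Y \<Longrightarrow> x \<in> carrier (FA X) \<Longrightarrow>
  H f x \<in> carrier (FA Y)"
  using free_ab_map_closed[OF G_hom] by simp

lemma H_cmp: "f \<in> Hom X Y \<Longrightarrow> g \<in> Hom Y Z \<Longrightarrow>
  x \<in> carrier (FA X) \<Longrightarrow> H (g \<odot> f) x = H g (H f x)"
  using free_ab_map_compose[OF G_hom] by (simp add: G_cmp)

lemma H_Idt: "X \<in> Ob C \<Longrightarrow> x \<in> carrier (FA X) \<Longrightarrow> H (Idt C X) x = x"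
  by (simp add: G_Idt free_ab_map_Idt)

lemma group_hom_H: "f \<in> Hom X Y \<Longrightarrow> group_hom (FA X) (FA Y) (H f)"
  by (rule free_ab_map_hom[OF G_hom])

lemma subgroup_carrier: "subgroup S (FA X) \<Longrightarrow> x \<in> S \<Longrightarrow>
  x \<in> carrier (FA X)"
  using subgroup.subset by blast

lemma push_subgroup: "f \<in> Hom X Y \<Longrightarrow> subgroup S (FA X) \<Longrightarrow>
  subgroup (H f ` S) (FA Y)"
  by (rule group_hom.subgroup_img_is_subgroup[OF group_hom_H])

lemma subgroup_FA_I:
  assumes "S \<subseteq> carrier (FA X)" "0 \<in> S" "\<And>a b. a \<in> S \<Longrightarrow>
    b \<in> S \<Longrightarrow> a - b \<in> S"
  shows "subgroup S (FA X)"
proof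
  show "S \<subseteq> carrier (FA X)" "\<one>\<^bsub>FA X\<^esub> \<in> S" using assms by auto
  have m: "- b \<in> S" if "b \<in> S" for b using assms(3)[OF assms(2) that] by simp
  show "inv\<^bsub>FA X\<^esub> b \<in> S" if "b \<in> S" for b
  proof -
    have "b \<in> carrier (FA X)" using assms(1) that by blast
    then show ?thesis using m[OF that] by simp
  qed
  show "a \<otimes>\<^bsub>FA X\<^esub> b \<in> S" if "a \<in> S" "b \<in> S" for a b
    using assms(3)[OF that(1) m[OF that(2)]] by simp
qed

lemma pull_subgroup:
  assumes "f \<in> Hom X Y" "subgroup T (FA Y)"
  shows "subgroup {x \<in> carrier (FA X). H f x \<in> T} (FA X)"
proof (rule subgroup_FA_I)
  show "0 \<in> {x \<in> carrier (FA X). H f x \<in> T}" using subgroup.one_closed[OF assms(2)] by simp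
  show "a - b \<in> {x \<in> carrier (FA X). H f x \<in> T}"
    if "a \<in> {x \<in> carrier (FA X). H f x \<in> T}" "b \<in> {x \<in> carrier (FA X). H f x \<in> T}" for a b
    using that subgroup_diff_closed[OF assms(2), of "H f a" "H f b"] keys_diff[of a b] by auto
qed auto

lemma is_form_N: "is_form V C N"
  unfolding is_form_def
proof (intro conjI ballI allI)
  fix X assume X: "X \<in> Ob C"
  show "bounded_lattice (fibre N X)"
    by (simp add: group.bounded_lattice_subgroup_lattice[OF group_FA])
  show "small V (carrier (fibre N X))"
    using small_free_Abelian_subgroups[OF univ G_small[OF X]] by (simp add: subgroup_lattice_def)
  fix S assume S: "S \<in> carrier (fibre N X)"
  then have c: "x \<in> carrier (FA X)" if "x \<in> S" for x using that subgroup_carrier by simp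
  show "push N (Idt C X) S = S"
    using H_Idt[OF X c] by simp
  show "pull N (Idt C X) S = S"
    using c H_Idt[OF X] HomD(2)[OF idt_hom[OF X]] unfolding N_simps(3) by auto
next
  fix X Y f assume f: "f \<in> Hom X Y"
  show "push N f \<in> carrier (fibre N X) \<rightarrow> carrier (fibre N Y)"
    using push_subgroup[OF f] by simp
  show "pull N f \<in> carrier (fibre N Y) \<rightarrow> carrier (fibre N X)"
    using pull_subgroup[OF f] HomD(2)[OF f] unfolding N_simps by simp
  show "S \<sqsubseteq>\<^bsub>fibre N X\<^esub> S' \<longrightarrow> push N f S \<sqsubseteq>\<^bsub>fibre N Y\<^esub> push N f S'" for S S'
    by auto
  show "T \<sqsubseteq>\<^bsub>fibre N Y\<^esub> T' \<longrightarrow> pull N f T \<sqsubseteq>\<^bsub>fibre N X\<^esub> pull N f T'" for T T'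
    by auto
  show "push N f S \<sqsubseteq>\<^bsub>fibre N Y\<^esub> T \<longleftrightarrow> S \<sqsubseteq>\<^bsub>fibre N X\<^esub> pull N f T"
    if "S \<in> carrier (fibre N X)" for S T
    using that subgroup.subset HomD(2)[OF f] unfolding N_simps subgroup_lattice_simps by blast
next
  fix X Y Z f g S assume f: "f \<in> Hom X Y" and g: "g \<in> Hom Y Z" and "S \<in> carrier (fibre N X)"
  then have "x \<in> carrier (FA X)" if "x \<in> S" for x using that subgroup_carrier by simp
  then show "push N (g \<odot> f) S = push N g (push N f S)"
    using H_cmp[OF f g] unfolding N_simps image_image by (intro image_cong refl) blast
next
  fix X Y Z f g T assume f: "f \<in> Hom X Y" and g: "g \<in> Hom Y Z"
  show "pull N (g \<odot> f) T = pull N f (pull N g T)"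
    using H_cmp[OF f g] H_closed[OF f] HomD(2)[OF f] HomD(2)[OF g] HomD(2)[OF cmp_hom[OF f g]]
    unfolding N_simps by auto
qed

section \<open>Images, kernels and the transport identities\<close>

lemma Im_N: "f \<in> Hom X Y \<Longrightarrow>
  Im_cl C N f = carrier (free_Abelian_group (app (far G f) ` fob G X))"
  using HomD(2)[of f X Y] group.top_subgroup_lattice[OF group_FA[of X]] free_ab_map_image[of "far G f" "fob G X"]
  by (simp add: Im_cl_def)

lemma Ker_N: "f \<in> Hom X Y \<Longrightarrow> Ker_cl C N f = {x \<in> carrier (FA X). H f x = 0}"
  using HomD(2,3)[of f X Y] group.bottom_subgroup_lattice[OF group_FA[of Y]]
  unfolding Ker_cl_def N_simps by simp

lemma Ker_subgroup: "f \<in> Hom X Y \<Longrightarrow> subgroup (Ker_cl C N f) (FA X)"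
  using pull_subgroup[OF _ group.triv_subgroup[OF group_FA]] Ker_N by fastforce

lemma Im_subgroup: "f \<in> Hom X Y \<Longrightarrow> subgroup (Im_cl C N f) (FA Y)"
  using push_subgroup[OF _ group.subgroup_self[OF group_FA]] HomD(2)[of f X Y] group.top_subgroup_lattice[OF group_FA[of X]]
  by (simp add: Im_cl_def)

lemma join_N: "subgroup S (FA X) \<Longrightarrow> subgroup T (FA X) \<Longrightarrow>
    S \<squnion>\<^bsub>L X\<^esub> T = {a + b | a b. a \<in> S \<and> b \<in> T}"
  using comm_group.join_subgroup_lattice[OF comm_group_FA] by (auto simp: set_mult_def)

lemma meet_N: "subgroup S (FA X) \<Longrightarrow> subgroup T (FA X) \<Longrightarrow>
  S \<sqinter>\<^bsub>L X\<^esub> T = S \<inter> T"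
  by (rule group.meet_subgroup_lattice[OF group_FA])

lemma join_subgroup: "subgroup S (FA X) \<Longrightarrow> subgroup T (FA X) \<Longrightarrow>
  subgroup (S \<squnion>\<^bsub>L X\<^esub> T) (FA X)"
  using comm_group.join_subgroup_lattice[OF comm_group_FA] comm_group.mult_subgroups[OF comm_group_FA]
    by metis

lemma pull_push:
  assumes f: "f \<in> Hom X Y" and S: "subgroup S (FA X)"
  shows "pull N f (push N f S) = S \<squnion>\<^bsub>L X\<^esub> Ker_cl C N f"
proof -
  let ?l = "{x \<in> carrier (FA X). H f x \<in> H f ` S}"
  let ?r = "{a + b | a b. a \<in> S \<and> b \<in> {x \<in> carrier (FA X). H f x = 0}}"
  have "?l \<subseteq> ?r"
  proof
    fix x assume "x \<in> ?l"
    then obtain s where s: "x \<in> carrier (FA X)" "s \<in> S" "H f x = H f s" by blast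
    have "x - s \<in> carrier (FA X)"
      by (rule subgroup_diff_closed[OF group.subgroup_self[OF group_FA] s(1) subgroup_carrier[OF S s(2)]])
    then have "s \<in> S \<and> x - s \<in> {x \<in> carrier (FA X). H f x = 0} \<and> x = s + (x - s)"
      using s by simp
    then show "x \<in> ?r" by blast
  qed
  moreover have "?r \<subseteq> ?l"
  proof
    fix x assume "x \<in> ?r"
    then obtain a b where ab: "x = a + b" "a \<in> S" "b \<in> carrier (FA X)" "H f b = 0" by blast
    have "Poly_Mapping.keys a \<subseteq> fob G X" using subgroup_carrier[OF S ab(2)] by simp
    then have "x \<in> carrier (FA X)" using ab(1,3) keys_add[of a b] by auto
    then show "x \<in> ?l" using ab by simp
  qed
  ultimately have "?l = ?r" by (rule subset_antisym)
  then show ?thesis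
    unfolding join_N[OF S Ker_subgroup[OF f]] unfolding Ker_N[OF f] N_simps HomD(2)[OF f] .
qed

lemma push_pull:
  assumes f: "f \<in> Hom X Y" and T: "subgroup T (FA Y)"
  shows "push N f (pull N f T) = T \<sqinter>\<^bsub>L Y\<^esub> Im_cl C N f"
  unfolding meet_N[OF T Im_subgroup[OF f]]
  unfolding Im_cl_def N_simps HomD(2)[OF f] group.top_subgroup_lattice[OF group_FA] by blast

section \<open>Quotients, embeddings and the induced factorization system\<close>

lemma E_Ar: "e \<in> E \<Longrightarrow> e \<in> Ar C"
  and M_Ar: "m \<in> M \<Longrightarrow> m \<in> Ar C"
  using pfs unfolding proper_factorization_system_def by blast+

lemma E_cancel:
  assumes "e \<in> E" "e \<in> Hom X Y" "f \<in> Hom Y Z" "g \<in> Hom Y Z" "f \<odot> e = g \<odot> e"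
  shows "f = g"
proof -
  have "is_epi C e" using pfs assms(1) unfolding proper_factorization_system_def by blast
  then show ?thesis
    using assms(3-) HomD(3)[OF assms(2)] HomD(5)[OF assms(3)] unfolding is_epi_def by blast
qed

lemma M_cancel:
  assumes "m \<in> M" "m \<in> Hom X Y" "f \<in> Hom Z X" "g \<in> Hom Z X" "m \<odot> f = m \<odot> g"
  shows "f = g"
proof -
  have "is_mono C m" using pfs assms(1) unfolding proper_factorization_system_def by blast
  then show ?thesis
    using assms(3-) HomD(2)[OF assms(2)] HomD(4)[OF assms(3)] unfolding is_mono_def by blast
qed

lemma iso_E: "is_iso C f \<Longrightarrow> f \<in> E" and iso_M: "is_iso C f \<Longrightarrow> f \<in> M"
  using pfs unfolding proper_factorization_system_def by blast+

lemma E_cmp: "f \<in> E \<Longrightarrow> g \<in> E \<Longrightarrow> f \<in> Hom X Y \<Longrightarrow>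
  g \<in> Hom Y Z \<Longrightarrow> g \<odot> f \<in> E"
  and M_cmp: "f \<in> M \<Longrightarrow> g \<in> M \<Longrightarrow> f \<in> Hom X Y \<Longrightarrow>
    g \<in> Hom Y Z \<Longrightarrow> g \<odot> f \<in> M"
  using pfs HomD(3)[of f X Y] HomD(2)[of g Y Z] unfolding proper_factorization_system_def by metis+

lemma G_onto:
  assumes "e \<in> E" "e \<in> Hom X Y" shows "app (far G e) ` fob G X = fob G Y"
  using surj_iff[OF E_Ar[OF assms(1)]] assms(1) setcat_homD(1,2)[OF G_hom[OF assms(2)]]
  by (simp add: surjective_fun_def)

lemma G_inj:
  assumes "m \<in> M" "m \<in> Hom X Y" shows "inj_on (app (far G m)) (fob G X)"
  using inj_iff[OF M_Ar[OF assms(1)]] assms(1) setcat_homD(1)[OF G_hom[OF assms(2)]]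
  by (simp add: injective_fun_def)

text \<open>Linear extension keeps \<open>m\<close> injective, so \<open>f\<close> and
  \<open>e\<close> have the same kernel; \<open>e\<close> is onto on points, so \<open>f\<close> and
  \<open>m\<close> have the same image.\<close>

lemma factorization:
  assumes "f \<in> Hom X Y"
  obtains e m W where "e \<in> E" "m \<in> M" "e \<in> Hom X W" "m \<in> Hom W Y" "f = m \<odot> e"
    "Ker_cl C N f = Ker_cl C N e" "Im_cl C N f = Im_cl C N m"
proof -
  obtain e m where em: "e \<in> E" "m \<in> M" "Dom C m = Cod C e" "f = m \<odot> e"
    using pfs HomD(1)[OF assms] unfolding proper_factorization_system_def by metis
  have e': "e \<in> Hom (Dom C e) (Cod C e)" and m': "m \<in> Hom (Cod C e) (Cod C m)"
    using E_Ar[OF em(1)] M_Ar[OF em(2)] em(3) by (auto simp: homset_def)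
  have "Dom C e = X" "Cod C m = Y"
    using cmp_hom[OF e' m'] em(4) assms by (auto simp: homset_def)
  then have e: "e \<in> Hom X (Cod C e)" and m: "m \<in> Hom (Cod C e) Y" using e' m' by simp_all
  have "H m z = 0 \<longleftrightarrow> z = 0" if "z \<in> carrier (FA (Cod C e))" for z
    using free_ab_map_inj[OF G_inj[OF em(2) m]] that by auto
  then have "Ker_cl C N f = Ker_cl C N e"
    unfolding Ker_N[OF assms] Ker_N[OF e] using H_cmp[OF e m] H_closed[OF e] em(4) by auto
  moreover
  have "app (far G f) ` fob G X = app (far G m) ` app (far G e) ` fob G X"
    unfolding em(4) G_cmp[OF e m] image_image
    by (rule image_cong[OF refl setcat_cmp(3)]) (simp add: setcat_homD(1)[OF G_hom[OF e]])
  then have "Im_cl C N f = Im_cl C N m"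
    unfolding Im_N[OF assms] Im_N[OF m] G_onto[OF em(1) e] by simp
  ultimately show thesis by (rule that[OF em(1,2) e m em(4)])
qed

text \<open>A difference of two generators lies in a kernel exactly when the two points are
  identified, so kernels of subgroups remember the kernels of functions.\<close>

lemma Ker_eqD:
  assumes "f \<in> Hom X Y" "g \<in> Hom X Z" "Ker_cl C N f \<subseteq> Ker_cl C N g"
    "x \<in> fob G X" "y \<in> fob G X" "app (far G f) x = app (far G f) y"
  shows "app (far G g) x = app (far G g) y"
proof -
  have "frag_of x - frag_of y \<in> carrier (FA X)"
    using assms(4,5) keys_diff[of "frag_of x" "frag_of y"] by auto
  then have "frag_of x - frag_of y \<in> Ker_cl C N f"
    unfolding Ker_N[OF assms(1)] using assms(6) by simp
  then have "frag_of x - frag_of y \<in> Ker_cl C N g" using assms(3) by blast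
  then have "frag_of (app (far G g) x) = frag_of (app (far G g) y)"
    unfolding Ker_N[OF assms(2)] by simp
  then show ?thesis by (simp add: frag_of_eq)
qed

text \<open>By \<open>Ker_eqD\<close> the inclusion of kernels becomes a condition on points, which
  is the one for factoring through a member of \<open>E\<close>.\<close>

lemma E_quotient:
  assumes "e \<in> E" "e \<in> Hom X Y"
  shows "is_quotient C N X (Ker_cl C N e) e"
  unfolding is_quotient_def
proof (intro conjI ballI impI)
  show "normal_cl C N X (Ker_cl C N e)"
    unfolding normal_cl_def using Ker_subgroup[OF assms(2)] HomD[OF assms(2)] by auto
  show "e \<in> Ar C" "Dom C e = X" using HomD[OF assms(2)] by auto
  show "Ker_cl C N e = Ker_cl C N e" by (rule refl)
  fix g assume g: "g \<in> Ar C" "Dom C g = X \<and> Ker_cl C N e \<sqsubseteq>\<^bsub>fibre N X\<^esub> Ker_cl C N g"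
  then have gH: "g \<in> Hom X (Cod C g)" and le: "Ker_cl C N e \<subseteq> Ker_cl C N g"
    by (auto simp: homset_def)
  have "\<exists>h \<in> Hom (Cod C e) (Cod C g). h \<odot> e = g"
  proof (rule factor_E[OF assms(1) g(1)])
    show "Dom C g = Dom C e" using g(2) HomD(2)[OF assms(2)] by simp
  qed (unfold HomD(2)[OF assms(2)], rule Ker_eqD[OF assms(2) gH le])
  then obtain h where h: "h \<in> Hom (Cod C e) (Cod C g)" "h \<odot> e = g" by blast
  moreover have "h' = h" if "h' \<in> Hom (Cod C e) (Cod C g)" "g = h' \<odot> e" for h'
    by (rule E_cancel[OF assms(1) Ar_Hom[OF HomD(1)[OF assms(2)]] that(1) h(1)]) (simp add: h(2) that(2))
  ultimately show "\<exists>!h. h \<in> Hom (Cod C e) (Cod C g) \<and> g = h \<odot> e" by blast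
qed

text \<open>An image is free on the image of the points, so testing generators turns inclusion of
  subgroups into inclusion of sets.\<close>

lemma M_embedding:
  assumes "m \<in> M" "m \<in> Hom X Y"
  shows "is_embedding C N Y (Im_cl C N m) m"
  unfolding is_embedding_def
proof (intro conjI ballI impI)
  show "conormal C N Y (Im_cl C N m)"
    unfolding conormal_def using Im_subgroup[OF assms(2)] HomD[OF assms(2)] by auto
  show "m \<in> Ar C" "Cod C m = Y" using HomD[OF assms(2)] by auto
  show "Im_cl C N m = Im_cl C N m" by (rule refl)
  fix f assume f: "f \<in> Ar C" "Cod C f = Y \<and> Im_cl C N f \<sqsubseteq>\<^bsub>fibre N Y\<^esub> Im_cl C N m"
  then have fH: "f \<in> Hom (Dom C f) Y" and le: "Im_cl C N f \<subseteq> Im_cl C N m"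
    by (auto simp: homset_def)
  have "app (far G f) ` fob G (Dom C f) \<subseteq> app (far G m) ` fob G X"
  proof
    fix y assume "y \<in> app (far G f) ` fob G (Dom C f)"
    then have "frag_of y \<in> Im_cl C N f" unfolding Im_N[OF fH] by simp
    then have "frag_of y \<in> Im_cl C N m" using le by blast
    then show "y \<in> app (far G m) ` fob G X" unfolding Im_N[OF assms(2)] by simp
  qed
  then have "app (far G f) ` fob G (Dom C f) \<subseteq> app (far G m) ` fob G (Dom C m)"
    unfolding HomD(2)[OF assms(2)] .
  moreover have "Cod C f = Cod C m" using f(2) HomD(3)[OF assms(2)] by simp
  ultimately have "\<exists>h \<in> Hom (Dom C f) (Dom C m). m \<odot> h = f"
    by (intro factor_M[OF assms(1) f(1)])
  then obtain h where h: "h \<in> Hom (Dom C f) (Dom C m)" "m \<odot> h = f" by blast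
  moreover have "h' = h" if "h' \<in> Hom (Dom C f) (Dom C m)" "f = m \<odot> h'" for h'
    by (rule M_cancel[OF assms(1) Ar_Hom[OF HomD(1)[OF assms(2)]] that(1) h(1)]) (simp add: h(2) that(2))
  ultimately show "\<exists>!h. h \<in> Hom (Dom C f) (Dom C m) \<and> f = m \<odot> h" by blast
qed

text \<open>After passing to the \<open>E\<close>-parts \<open>d\<close> and \<open>e\<close>, the
  candidate is the arrow \<open>g\<close> from \<open>join_E\<close>. Kernels are generated by
  differences of identified points, so the join of point kernels becomes the join of
  subgroups.\<close>

lemma normal_join:
  assumes "normal_cl C N X K" "normal_cl C N X K'"
  shows "normal_cl C N X (K \<squnion>\<^bsub>L X\<^esub> K')"
proof -
  obtain f f' where f: "f \<in> Ar C" "Dom C f = X" "Ker_cl C N f = K"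
    and f': "f' \<in> Ar C" "Dom C f' = X" "Ker_cl C N f' = K'"
    using assms unfolding normal_cl_def by blast
  have fH: "f \<in> Hom X (Cod C f)" "f' \<in> Hom X (Cod C f')" using f f' by (auto simp: homset_def)
  obtain d A where d: "d \<in> E" "d \<in> Hom X A" "Ker_cl C N d = K"
    using factorization[OF fH(1)] f(3) by metis
  obtain e B where e: "e \<in> E" "e \<in> Hom X B" "Ker_cl C N e = K'"
    using factorization[OF fH(2)] f'(3) by metis
  have D: "Dom C d = X" "Dom C e = X" using HomD(2)[OF d(2)] HomD(2)[OF e(2)] .
  obtain g where g: "g \<in> Ar C" "Dom C g = X"
    and le: "\<forall>x\<in>fob G X. \<forall>y\<in>fob G X.
      app (far G d) x = app (far G d) y \<or> app (far G e) x = app (far G e) y \<longrightarrow> app (far G g) x = app (far G g) y"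
    and least: "\<forall>k :: 'u \<Rightarrow> ('u \<Rightarrow>\<^sub>0 int) set. (\<forall>x\<in>fob G X. \<forall>y\<in>fob G X.
        app (far G d) x = app (far G d) y \<or> app (far G e) x = app (far G e) y \<longrightarrow> k x = k y) \<longrightarrow>
      (\<forall>x\<in>fob G X. \<forall>y\<in>fob G X. app (far G g) x = app (far G g) y \<longrightarrow> k x = k y)"
    using join_E[OF d(1) e(1), unfolded D, OF refl] by (elim bexE conjE) (rule that)
  have gH: "g \<in> Hom X (Cod C g)" using g by (simp add: homset_def)
  have K: "subgroup K (FA X)" "subgroup K' (FA X)"
    using Ker_subgroup[OF d(2)] Ker_subgroup[OF e(2)] d(3) e(3) by simp_all
  let ?J = "K \<squnion>\<^bsub>L X\<^esub> K'"
  have J: "subgroup ?J (FA X)" by (rule join_subgroup[OF K])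
  have KJ: "K \<subseteq> ?J" "K' \<subseteq> ?J"
    unfolding join_N[OF K] using subgroup.one_closed[OF K(1)] subgroup.one_closed[OF K(2)] by force+
  have cK: "frag_of x - frag_of y \<in> carrier (FA X)" if "x \<in> fob G X" "y \<in> fob G X" for x y
    using that keys_diff[of "frag_of x" "frag_of y"] by auto
  have Jdiff: "frag_of x - frag_of y \<in> ?J"
    if "x \<in> fob G X" "y \<in> fob G X" "app (far G d) x = app (far G d) y \<or> app (far G e) x = app (far G e) y" for x y
  proof -
    have "frag_of x - frag_of y \<in> K \<or> frag_of x - frag_of y \<in> K'"
      using that(3) cK[OF that(1,2)]
        unfolding d(3)[symmetric] e(3)[symmetric] Ker_N[OF d(2)] Ker_N[OF e(2)] by auto
    then show ?thesis using KJ by blast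
  qed
  \<comment> \<open>The coset of a generator modulo the join is a test function compatible with
    \<open>d\<close> and \<open>e\<close>. Hence it is constant on the points identified by
    \<open>g\<close>, whose differences therefore lie in the join.\<close>
  define k where "k x = {c. c - frag_of x \<in> ?J}" for x
  have k_eq: "k x = k y" if "frag_of x - frag_of y \<in> ?J" for x y
  proof -
    have "c - frag_of x \<in> ?J \<longleftrightarrow> c - frag_of y \<in> ?J" for c
    proof
      assume "c - frag_of x \<in> ?J"
      moreover have "frag_of y - frag_of x \<in> ?J"
        using subgroup_diff_closed[OF J subgroup.one_closed[OF J] that] by simp
      ultimately have "(c - frag_of x) - (frag_of y - frag_of x) \<in> ?J"
        by (rule subgroup_diff_closed[OF J])
      then show "c - frag_of y \<in> ?J" by simp
    next
      assume "c - frag_of y \<in> ?J"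
      then have "(c - frag_of y) - (frag_of x - frag_of y) \<in> ?J"
        using that by (rule subgroup_diff_closed[OF J])
      then show "c - frag_of x \<in> ?J" by simp
    qed
    then show ?thesis by (simp add: k_def)
  qed
  have "frag_of x - frag_of y \<in> ?J"
    if "x \<in> fob G X" "y \<in> fob G X" "app (far G g) x = app (far G g) y" for x y
  proof -
    have "k x = k y" using least[rule_format, of k] k_eq[OF Jdiff] that by blast
    moreover have "frag_of x \<in> k x" using subgroup.one_closed[OF J] by (simp add: k_def)
    ultimately show ?thesis by (simp add: k_def)
  qed
  then have le_J: "Ker_cl C N g \<subseteq> ?J"
    unfolding Ker_N[OF gH] using free_ab_map_kernel[OF J] by auto
  \<comment> \<open>For the other inclusion, the kernel of any \<open>h\<close> identifying no more
    points than \<open>g\<close> is generated by differences lying in the kernel of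
    \<open>g\<close>.\<close>
  have Kg: "c \<in> Ker_cl C N g" if c: "c \<in> Ker_cl C N h" and h: "h \<in> Hom X Z"
      and hg: "\<And>x y. x \<in> fob G X \<Longrightarrow> y \<in> fob G X \<Longrightarrow>
        app (far G h) x = app (far G h) y \<Longrightarrow> app (far G g) x = app (far G g) y"
    for c h Z
  proof (rule free_ab_map_kernel[OF Ker_subgroup[OF gH], where g = "far G h"])
    show "frag_of x - frag_of y \<in> Ker_cl C N g"
      if "x \<in> fob G X" "y \<in> fob G X" "app (far G h) x = app (far G h) y" for x y
      unfolding Ker_N[OF gH] using cK[OF that(1,2)] hg[OF that] by simp
  qed (use c in \<open>simp_all add: Ker_N[OF h]\<close>)
  have "K \<subseteq> Ker_cl C N g" unfolding d(3)[symmetric]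
    by (rule subsetI, erule Kg[OF _ d(2)]) (rule le[rule_format], assumption+, rule disjI1, assumption)
  moreover have "K' \<subseteq> Ker_cl C N g" unfolding e(3)[symmetric]
    by (rule subsetI, erule Kg[OF _ e(2)]) (rule le[rule_format], assumption+, rule disjI2, assumption)
  ultimately have "a + b \<in> Ker_cl C N g" if "a \<in> K" "b \<in> K'" for a b
    using subgroup.m_closed[OF Ker_subgroup[OF gH], of a b] that by auto
  then have "?J \<subseteq> Ker_cl C N g" unfolding join_N[OF K] by blast
  with le_J have "Ker_cl C N g = ?J" by (rule subset_antisym)
  then show ?thesis unfolding normal_cl_def using g J by auto
qed

text \<open>Free groups on two subsets of points intersect in the free group on the intersection, so
  an arrow from \<open>meet_M\<close> has the required image.\<close>

lemma conormal_meet: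
  assumes "conormal C N X S" "conormal C N X T"
  shows "conormal C N X (S \<sqinter>\<^bsub>L X\<^esub> T)"
proof -
  obtain f f' where f: "f \<in> Ar C" "Cod C f = X" "Im_cl C N f = S"
    and f': "f' \<in> Ar C" "Cod C f' = X" "Im_cl C N f' = T"
    using assms unfolding conormal_def by blast
  have fH: "f \<in> Hom (Dom C f) X" "f' \<in> Hom (Dom C f') X" using f f' by (auto simp: homset_def)
  obtain m A where m: "m \<in> M" "m \<in> Hom A X" "Im_cl C N m = S"
    using factorization[OF fH(1)] f(3) by metis
  obtain n B where n: "n \<in> M" "n \<in> Hom B X" "Im_cl C N n = T"
    using factorization[OF fH(2)] f'(3) by metis
  have D: "Cod C m = X" "Cod C n = X" "Dom C m = A" "Dom C n = B"
    using HomD(2,3)[OF m(2)] HomD(2,3)[OF n(2)] by simp_all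
  obtain w where w: "w \<in> Ar C" "Cod C w = X"
    "app (far G w) ` fob G (Dom C w) = app (far G m) ` fob G A \<inter> app (far G n) ` fob G B"
    using meet_M[OF m(1) n(1)] D by auto
  have wH: "w \<in> Hom (Dom C w) X" using w by (simp add: homset_def)
  have ST: "subgroup S (FA X)" "subgroup T (FA X)"
    using Im_subgroup[OF m(2)] Im_subgroup[OF n(2)] m(3) n(3) by simp_all
  have "Im_cl C N w = S \<sqinter>\<^bsub>L X\<^esub> T"
    unfolding meet_N[OF ST]
      unfolding m(3)[symmetric] n(3)[symmetric] Im_N[OF wH] Im_N[OF m(2)] Im_N[OF n(2)] w(3)
    by (auto simp: free_Abelian_group_def)
  moreover have "subgroup (S \<sqinter>\<^bsub>L X\<^esub> T) (FA X)"
    unfolding meet_N[OF ST] by (rule group.subgroups_Inter_pair[OF group_FA ST])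
  ultimately show ?thesis unfolding conormal_def using w by auto
qed

theorem noetherian_form_N: "noetherian_form V C N"
  unfolding noetherian_form_def
proof (intro conjI allI ballI impI is_form_N)
  fix X Y f assume f: "f \<in> Hom X Y"
  show "pull N f (push N f S) = S \<squnion>\<^bsub>fibre N X\<^esub> Ker_cl C N f"
    if "S \<in> carrier (fibre N X)" for S
    using pull_push[OF f] that unfolding N_simps(1) subgroup_lattice_simps .
  show "push N f (pull N f T) = T \<sqinter>\<^bsub>fibre N Y\<^esub> Im_cl C N f"
    if "T \<in> carrier (fibre N Y)" for T
    using push_pull[OF f] that unfolding N_simps(1) subgroup_lattice_simps .
  obtain e m W where em: "e \<in> E" "m \<in> M" "e \<in> Hom X W" "m \<in> Hom W Y" "f = m \<odot> e"
    "Ker_cl C N f = Ker_cl C N e" "Im_cl C N f = Im_cl C N m"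
    by (rule factorization[OF f])
  show "\<exists>e m. is_quotient C N X (Ker_cl C N f) e \<and> is_embedding C N Y (Im_cl C N f) m \<and>
      Cod C e = Dom C m \<and> f = m \<odot> e"
    unfolding em(6,7)
    by (rule exI[of _ e], rule exI[of _ m])
      (use E_quotient[OF em(1,3)] M_embedding[OF em(2,4)] HomD(3)[OF em(3)] HomD(2)[OF em(4)] em(5) in simp)
next
  fix X K K' assume "normal_cl C N X K \<and> normal_cl C N X K'"
  then show "normal_cl C N X (K \<squnion>\<^bsub>fibre N X\<^esub> K')" unfolding N_simps(1)
    using normal_join by blast
next
  fix X S T assume "conormal C N X S \<and> conormal C N X T"
  then show "conormal C N X (S \<sqinter>\<^bsub>fibre N X\<^esub> T)" unfolding N_simps(1)
    using conormal_meet by blast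
qed

text \<open>The \<open>E\<close>-part of \<open>p\<close> has the same kernel and so factors through
  \<open>p\<close>. This makes the \<open>M\<close>-part invertible.\<close>

lemma quotient_E:
  assumes "is_quotient C N X K p" shows "p \<in> E"
proof -
  have p: "p \<in> Ar C" "Dom C p = X" "Ker_cl C N p = K"
    and fac: "\<And>g. g \<in> Ar C \<Longrightarrow> Dom C g = X \<Longrightarrow>
      K \<subseteq> Ker_cl C N g \<Longrightarrow>
      \<exists>!h. h \<in> Hom (Cod C p) (Cod C g) \<and> g = h \<odot> p"
    using assms unfolding is_quotient_def by auto
  have pH: "p \<in> Hom X (Cod C p)" using p by (simp add: homset_def)
  obtain e m W where em: "e \<in> E" "m \<in> M" "e \<in> Hom X W" "m \<in> Hom W (Cod C p)" "p = m \<odot> e"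
    "Ker_cl C N p = Ker_cl C N e"
    by (rule factorization[OF pH])
  have "K \<subseteq> Ker_cl C N e" using em(6) p(3) by simp
  then obtain h where h: "h \<in> Hom (Cod C p) W" "e = h \<odot> p"
    using fac[OF HomD(1,2)[OF em(3)]] unfolding HomD(3)[OF em(3)] by blast
  have id: "Idt C (Cod C p) \<in> Hom (Cod C p) (Cod C p)" using idt_hom HomD(5)[OF pH] by blast
  have idW: "Idt C W \<in> Hom W W" using idt_hom HomD(5)[OF em(3)] by blast
  have mh: "m \<odot> h = Idt C (Cod C p)"
  proof -
    have "p = m \<odot> h \<odot> p"
      unfolding cmp_assoc[OF pH h(1) em(4), symmetric] h(2)[symmetric] by (rule em(5))
    moreover have "p = Idt C (Cod C p) \<odot> p" by (rule idt_left[OF pH, symmetric])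
    ultimately show ?thesis
      using fac[OF p(1,2)] p(3) cmp_hom[OF h(1) em(4)] id by blast
  qed
  have "h \<odot> m = Idt C W"
  proof (rule E_cancel[OF em(1,3) cmp_hom[OF em(4) h(1)] idW])
    show "h \<odot> m \<odot> e = Idt C W \<odot> e"
      unfolding cmp_assoc[OF em(3,4) h(1), symmetric] em(5)[symmetric] h(2)[symmetric]
      by (rule idt_left[OF em(3), symmetric])
  qed
  then have "is_iso C m"
    unfolding is_iso_def using mh h(1) HomD(1-3)[OF em(4)] by auto
  then show ?thesis using E_cmp[OF em(1) iso_E em(3,4)] em(5) by simp
qed

text \<open>Dually, the \<open>M\<close>-part of \<open>i\<close> has the same image and factors
  through \<open>i\<close>, so the \<open>E\<close>-part is invertible.\<close>

lemma embedding_M: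
  assumes "is_embedding C N X S i" shows "i \<in> M"
proof -
  have i: "i \<in> Ar C" "Cod C i = X" "Im_cl C N i = S"
    and fac: "\<And>f. f \<in> Ar C \<Longrightarrow> Cod C f = X \<Longrightarrow>
      Im_cl C N f \<subseteq> S \<Longrightarrow>
      \<exists>!h. h \<in> Hom (Dom C f) (Dom C i) \<and> f = i \<odot> h"
    using assms unfolding is_embedding_def by auto
  have iH: "i \<in> Hom (Dom C i) X" using i by (simp add: homset_def)
  obtain e m W where em: "e \<in> E" "m \<in> M" "e \<in> Hom (Dom C i) W" "m \<in> Hom W X" "i = m \<odot> e"
    "Ker_cl C N i = Ker_cl C N e" "Im_cl C N i = Im_cl C N m"
    by (rule factorization[OF iH])
  have "Im_cl C N m \<subseteq> S" using em(7) i(3) by simp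
  then obtain h where h: "h \<in> Hom W (Dom C i)" "m = i \<odot> h"
    using fac[OF HomD(1,3)[OF em(4)]] unfolding HomD(2)[OF em(4)] by blast
  have id: "Idt C (Dom C i) \<in> Hom (Dom C i) (Dom C i)" using idt_hom HomD(4)[OF iH] by blast
  have idW: "Idt C W \<in> Hom W W" using idt_hom HomD(5)[OF em(3)] by blast
  have he: "h \<odot> e = Idt C (Dom C i)"
  proof -
    have "i = i \<odot> (h \<odot> e)"
      unfolding cmp_assoc[OF em(3) h(1) iH] h(2)[symmetric] by (rule em(5))
    moreover have "i = i \<odot> Idt C (Dom C i)" by (rule idt_right[OF iH, symmetric])
    ultimately show ?thesis
      using fac[OF i(1,2)] i(3) cmp_hom[OF em(3) h(1)] id by blast
  qed
  have "e \<odot> h = Idt C W"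
  proof (rule M_cancel[OF em(2,4) cmp_hom[OF h(1) em(3)] idW])
    show "m \<odot> (e \<odot> h) = m \<odot> Idt C W"
      unfolding cmp_assoc[OF h(1) em(3,4)] em(5)[symmetric] h(2)[symmetric]
      by (rule idt_right[OF em(4), symmetric])
  qed
  then have "is_iso C e"
    unfolding is_iso_def using he h(1) HomD(1-3)[OF em(3)] by auto
  then show ?thesis using M_cmp[OF iso_M em(2) em(3,4)] em(5) by simp
qed

theorem form_induces_N: "form_induces C N E M"
  unfolding form_induces_def
proof (intro conjI pfs)
  show "E = {e. \<exists>X\<in>Ob C. \<exists>K. is_quotient C N X K e}"
    using quotient_E E_quotient[OF _ Ar_Hom[OF E_Ar]] dom_ob[OF E_Ar] by blast
  show "M = {m. \<exists>X\<in>Ob C. \<exists>S. is_embedding C N X S m}"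
    using embedding_M M_embedding[OF _ Ar_Hom[OF M_Ar]] cod_ob[OF M_Ar] by blast
qed

end

section \<open>Assembling the functor and the form\<close>

lemma small_insert:
  assumes "universe V" "small V A" shows "small V (insert x A)"
proof (cases "finite A")
  case True
  then show ?thesis
    unfolding small_def by (intro finite_lesspoll_infinite universe_infinite[OF assms(1)]) simp
next
  case False
  then have "insert x A \<lesssim> A" by (intro eqpoll_imp_lepoll infinite_insert_eqpoll)
  with assms(2) show ?thesis by (rule small_lepoll)
qed

context cogenerated
begin

lemma subgroup_form_functor_GG: "subgroup_form_functor C V GG E M"
proof unfold_locales
  show "universe V" by (rule univ)
  show "is_functor C (setcat V) GG" by (rule GG_functor)
  show "proper_factorization_system C E M" by (rule EM_proper_factorization_system)
  show "surjective_fun (far GG f) \<longleftrightarrow> f \<in> E" "injective_fun (far GG f) \<longleftrightarrow> f \<in> M" if "f \<in> Ar C" for f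
    using GG_surjective_fun[OF that] GG_injective_fun[OF that] .
  show "\<exists>h \<in> Hom (Cod C e) (Cod C g). h \<odot> e = g"
    if e: "e \<in> E" and g: "g \<in> Ar C" "Dom C g = Dom C e"
      and ker: "\<And>x y. x \<in> fob GG (Dom C e) \<Longrightarrow>
        y \<in> fob GG (Dom C e) \<Longrightarrow>
        app (far GG e) x = app (far GG e) y \<Longrightarrow>
          app (far GG g) x = app (far GG g) y" for e g
  proof -
    have eH: "e \<in> Hom (Dom C e) (Cod C e)" using e by (simp add: surjections_def homset_def)
    have gH: "g \<in> Hom (Dom C e) (Cod C g)" using g by (simp add: homset_def)
    show ?thesis by (rule factor_through_E_GG[OF e eH gH ker]) (assumption+, rule bexI)
  qed
  show "\<exists>h \<in> Hom (Dom C f) (Dom C m). m \<odot> h = f"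
    if m: "m \<in> M" and f: "f \<in> Ar C" "Cod C f = Cod C m"
      and im: "app (far GG f) ` fob GG (Dom C f) \<subseteq> app (far GG m) ` fob GG (Dom C m)" for m f
  proof -
    have mH: "m \<in> Hom (Dom C m) (Cod C m)" using m by (simp add: initial_injections_def homset_def)
    have fH: "f \<in> Hom (Dom C f) (Cod C m)" using f by (simp add: homset_def)
    show ?thesis by (rule factor_through_M_GG[OF m mH fH im]) (rule bexI)
  qed
  show "\<exists>w\<in>Ar C. Cod C w = Cod C m \<and>
      app (far GG w) ` fob GG (Dom C w) = app (far GG m) ` fob GG (Dom C m) \<inter> app (far GG n) ` fob GG (Dom C n)"
    if m: "m \<in> M" and n: "n \<in> M" and eq: "Cod C m = Cod C n" for m n
  proof -
    have mH: "m \<in> Hom (Dom C m) (Cod C m)" using m by (simp add: initial_injections_def homset_def)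
    have nH: "n \<in> Hom (Dom C n) (Cod C m)" using n eq
      by (simp add: initial_injections_def homset_def)
    obtain W w where w: "w \<in> Hom W (Cod C m)"
      "app (far GG w) ` fob GG W = app (far GG m) ` fob GG (Dom C m) \<inter> app (far GG n) ` fob GG (Dom C n)"
      by (rule meet_exists[OF m mH n nH])
    show ?thesis using w(2) HomD(1-3)[OF w(1)] by (intro bexI[of _ w]) simp_all
  qed
  fix d e assume d: "d \<in> E" and e: "e \<in> E" and eq: "Dom C d = Dom C e"
  define X where "X = Dom C d"
  have dH: "d \<in> Hom X (Cod C d)" using d by (simp add: surjections_def homset_def X_def)
  have eH: "e \<in> Hom X (Cod C e)" using e eq by (simp add: surjections_def homset_def X_def)
  \<comment> \<open>The diagonal of a pushout realizes the join of the two kernels, as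
    \<open>join_E\<close> demands.\<close>
  obtain p q where po: "is_pushout C d e p q" by (rule pushout_exists[OF d dH e eH])
  note P = pushout_HomD[OF po dH eH]
  have pd: "p \<odot> d \<in> Hom X (Cod C p)" by (rule cmp_hom[OF dH P(1)])
  have cmp: "app (far GG (g \<odot> f)) x = app (far GG g) (app (far GG f) x)"
    if f: "f \<in> Hom X Y" and g: "g \<in> Hom Y Z" and x: "x \<in> fob GG X" for f g Y Z x
    unfolding far_GG_cmp[OF f g]
      by (rule setcat_cmp(3)) (simp add: x setcat_homD(1)[OF far_GG_Fun[OF f]])
  show "\<exists>f\<in>Ar C. Dom C f = Dom C d \<and>
      (\<forall>x\<in>fob GG (Dom C d). \<forall>y\<in>fob GG (Dom C d).
        app (far GG d) x = app (far GG d) y \<or> app (far GG e) x = app (far GG e) y \<longrightarrow> app (far GG f) x = app (far GG f) y) \<and>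
      (\<forall>k :: 'u \<Rightarrow> ('u \<Rightarrow>\<^sub>0 int) set. (\<forall>x\<in>fob GG (Dom C d). \<forall>y\<in>fob GG (Dom C d).
          app (far GG d) x = app (far GG d) y \<or> app (far GG e) x = app (far GG e) y \<longrightarrow> k x = k y) \<longrightarrow>
        (\<forall>x\<in>fob GG (Dom C d). \<forall>y\<in>fob GG (Dom C d). app (far GG f) x = app (far GG f) y \<longrightarrow> k x = k y))"
    unfolding X_def[symmetric]
  proof (intro bexI[of _ "p \<odot> d"] conjI ballI allI impI)
    show "p \<odot> d \<in> Ar C" "Dom C (p \<odot> d) = X" using HomD(1,2)[OF pd] .
    fix x y assume xy: "x \<in> fob GG X" "y \<in> fob GG X"
    show "app (far GG (p \<odot> d)) x = app (far GG (p \<odot> d)) y"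
      if "app (far GG d) x = app (far GG d) y \<or> app (far GG e) x = app (far GG e) y"
      using that
    proof
      assume "app (far GG d) x = app (far GG d) y"
      then show ?thesis unfolding cmp[OF dH P(1) xy(1)] cmp[OF dH P(1) xy(2)] by simp
    next
      assume "app (far GG e) x = app (far GG e) y"
      then show ?thesis unfolding P(3) cmp[OF eH P(2) xy(1)] cmp[OF eH P(2) xy(2)] by simp
    qed
    show "k x = k y" if k: "\<forall>x\<in>fob GG X. \<forall>y\<in>fob GG X.
          app (far GG d) x = app (far GG d) y \<or> app (far GG e) x = app (far GG e) y \<longrightarrow> k x = k y"
        and eq: "app (far GG (p \<odot> d)) x = app (far GG (p \<odot> d)) y"
          for k :: "'u \<Rightarrow> ('u \<Rightarrow>\<^sub>0 int) set"
    proof (rule Tm_pushout_kernel_GG[OF po d dH e eH _ _ xy eq])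
      show "k a = k b" if "a \<in> fob GG X" "b \<in> fob GG X" "app (far GG d) a = app (far GG d) b"
        for a b
        by (rule k[rule_format, OF that(1,2) disjI1[OF that(3)]])
      show "k a = k b" if "a \<in> fob GG X" "b \<in> fob GG X" "app (far GG e) a = app (far GG e) b"
        for a b
        by (rule k[rule_format, OF that(1,2) disjI2[OF that(3)]])
    qed
  qed
qed

end

text \<open>Initiality survives the enlargement because the old members already test it. For the new
  indiscrete object every function is a morphism, so extension along an injection is a matter of
  sets.\<close>

lemma (in topological_category) cogenerated_insert_two_points:
  assumes small: "small V QQ" and ob: "\<And>Q. Q \<in> QQ \<Longrightarrow> Q \<in> Ob C"
    and ne: "\<And>Q. Q \<in> QQ \<Longrightarrow> fob U Q \<noteq> {}"
    and init: "\<And>X. X \<in> Ob C \<Longrightarrow>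
      initial_source V C U X (\<Union>Q\<in>QQ. Hom X Q)"
    and ext: "\<And>Q A B a m. \<lbrakk>Q \<in> QQ; m \<in> M; m \<in> Hom A B; a \<in> Hom A Q\<rbrakk> \<Longrightarrow> extends_along C a m"
  obtains P where "cogenerated V C U (insert P QQ)"
proof -
  have inf: "infinite V" by (rule universe_infinite[OF univ])
  then obtain a where a: "a \<in> V" by (metis finite.emptyI ex_in_conv)
  have "infinite (V - {a})" using inf by simp
  then obtain b where b: "b \<in> V" "b \<noteq> a"
    by (metis Diff_iff finite.emptyI ex_in_conv singletonI)
  have two: "{a, b} \<in> Ob (setcat V)"
    using a b finite_lesspoll_infinite[OF inf, of "{a, b}"] by (simp add: small_def)
  obtain P where P: "P \<in> Ob C" "fob U P = {a, b}" "\<And>Z. Z \<in> Ob C \<Longrightarrow>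
    mor Z P = Fun (fob U Z) {a, b}"
    by (rule indiscrete[OF two]) blast
  have "cogenerated V C U (insert P QQ)"
  proof (intro cogenerated.intro cogenerated_axioms.intro topological_category_axioms)
    show "small V (insert P QQ)" by (rule small_insert[OF univ small])
    show "Q \<in> Ob C" "fob U Q \<noteq> {}" if "Q \<in> insert P QQ" for Q using that P ob ne by auto
    show "\<exists>Q\<in>insert P QQ. \<exists>a\<in>fob U Q. \<exists>b\<in>fob U Q. a \<noteq> b"
      using P(2) b(2) by auto
  next
    fix X Z h assume X: "X \<in> Ob C" and Z: "Z \<in> Ob C" and h: "h \<in> Fun (fob U Z) (fob U X)"
      and test: "\<And>Q a. Q \<in> insert P QQ \<Longrightarrow> a \<in> mor X Q \<Longrightarrow>
        a \<star> h \<in> mor Z Q"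
    have "far U a \<star> h \<in> mor Z (Cod C a)" if a: "a \<in> (\<Union>Q\<in>QQ. Hom X Q)" for a
    proof -
      obtain Q where Q: "Q \<in> QQ" "a \<in> Hom X Q" using a by blast
      show ?thesis unfolding HomD(3)[OF Q(2)] by (rule test[OF insertI2[OF Q(1)] morI[OF Q(2)]])
    qed
    then show "h \<in> mor Z X" using init[OF X] Z h unfolding initial_source_mor by blast
  next
    fix Q m A B s assume Q: "Q \<in> insert P QQ" and m: "m \<in> M" "m \<in> Hom A B"
      and s: "s \<in> mor A Q"
    show "\<exists>t\<in>mor B Q. t \<star> far U m = s"
    proof (cases "Q = P")
      case True
      have inj: "inj_on (app (far U m)) (fob U A)" using m(1) unfolding M_iff[OF m(2)] by blast
      have "s \<in> Fun (fob U A) {a, b}" using s True P(3)[OF HomD(4)[OF m(2)]] by simp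
      then obtain t where "t \<in> Fun (fob U B) {a, b}" "t \<star> far U m = s"
        by (rule extend_function[OF m(2) inj two insert_not_empty])
      then show ?thesis using True P(3)[OF HomD(5)[OF m(2)]] by blast
    next
      case False
      then have Q': "Q \<in> QQ" using Q by simp
      obtain f where f: "f \<in> Hom A Q" "far U f = s" using s by (rule morE)
      obtain g where g: "g \<in> Hom B Q" "f = g \<odot> m"
        using ext[OF Q' m f(1)] unfolding extends_along_def HomD(3)[OF f(1)] HomD(3)[OF m(2)] by blast
      show ?thesis
        by (rule bexI[OF _ morI[OF g(1)]]) (simp only: far_cmp[OF m(2) g(1), symmetric] g(2)[symmetric] f(2))
    qed
  qed
  then show thesis by (rule that)
qed

theorem theorem4p15:
  fixes V :: "'u set"
    and C :: "('o, 'a) cat"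
    and U :: "('o, 'a, 'u set, 'u setfun) ftor"
    and I :: "'i set"
    and Q :: "'i \<Rightarrow> 'o"
  assumes "universe V"
    and "category C" and "locally_small V C"
    and "topological V C U"
    and "small V I"
    and "\<And>i. i \<in> I \<Longrightarrow> Q i \<in> Ob C"
    and "\<And>i. i \<in> I \<Longrightarrow> fob U (Q i) \<noteq> {}"
    and "\<And>X. X \<in> Ob C \<Longrightarrow> initial_source V C U X (\<Union>i\<in>I. homset C X (Q i))"
    and "\<And>i A B a m. \<lbrakk>i \<in> I; m \<in> initial_injections V C U; m \<in> homset C A B;
           a \<in> homset C A (Q i)\<rbrakk> \<Longrightarrow> extends_along C a m"
  shows "\<exists>G :: ('o, 'a, 'u set, 'u setfun) ftor.
    is_functor C (setcat V) G \<and>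
    conservative C (setcat V) G \<and>
    (\<forall>f\<in>Ar C. surjective_fun (far G f) \<longleftrightarrow> f \<in> surjections C U) \<and>
    (\<forall>f\<in>Ar C. injective_fun (far G f) \<longleftrightarrow> f \<in> initial_injections V C U) \<and>
    preserves_pullbacks_of C (setcat V) G (initial_injections V C U) \<and>
    preserves_pushouts_of C (setcat V) G (surjections C U) \<and>
    (let N = subgroup_form C (\<lambda>X. free_Abelian_group (fob G X)) (\<lambda>f. free_ab_map (far G f)) in
      noetherian_form V C N \<and>
      (\<forall>X\<in>Ob C. complete_lattice (fibre N X) \<and> algebraic_lattice (fibre N X) \<and>
        modular_lattice (fibre N X)) \<and>
      form_induces C N (surjections C U) (initial_injections V C U))"
proof -
  interpret topological_category V C U
    using assms(1,4) by (rule topological_category.intro)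
  have init: "initial_source V C U X (\<Union>R\<in>Q ` I. homset C X R)" if "X \<in> Ob C" for X
    using assms(8)[OF that] by simp
  have ext: "extends_along C a m" if R: "R \<in> Q ` I" and m: "m \<in> M" "m \<in> homset C A B"
    and a: "a \<in> homset C A R" for R A B a m
  proof -
    obtain i where i: "i \<in> I" "R = Q i" using R by blast
    show ?thesis using a unfolding i(2) by (rule assms(9)[OF i(1) m])
  qed
  obtain P where "cogenerated V C U (insert P (Q ` I))"
  proof (rule cogenerated_insert_two_points[OF small_image[OF assms(5), of Q] _ _ init ext])
    show "R \<in> Ob C" "fob U R \<noteq> {}" if "R \<in> Q ` I" for R using that assms(6,7) by auto
  qed
  then interpret cogenerated V C U "insert P (Q ` I)" .
  interpret F: subgroup_form_functor C V GG E M by (rule subgroup_form_functor_GG)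
  have lattices: "complete_lattice (fibre F.N X)" "algebraic_lattice (fibre F.N X)" "modular_lattice (fibre F.N X)" for X
    unfolding F.N_simps(1)
    by (rule group.complete_lattice_subgroup_lattice[OF F.group_FA]
        group.algebraic_lattice_subgroup_lattice[OF F.group_FA]
        comm_group.modular_lattice_subgroup_lattice[OF F.comm_group_FA])+
  show ?thesis
    unfolding Let_def
    by (intro exI[of _ GG] conjI ballI GG_functor GG_conservative GG_surjective_fun GG_injective_fun
        GG_preserves_pullbacks GG_preserves_pushouts F.noetherian_form_N F.form_induces_N lattices)
qed

end
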